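(* Let $\Bbbk$ be a field of characteristic zero and let $A$ and $C$ be as defined in the context. (1) The centre of $A$ is the polynomial algebra $Z(A)=\Bbbk[C]$. (2) The classical quotient ring of $A$ is $Q(A)\cong M_2(\mathbf{D})$, a central simple algebra over the Weyl skewfield $\mathbf{D}:=\operatorname{Frac}(\Bbbk[C]\otimes A_1)$.
   Context: $A$ (the bosonization of the super Jordan plane) is the $\Bbbk$-algebra generated by $x,y,g,g^{-1}$ with relations $x^2=0$, $ys-sy-xs=0$ where $s:=xy+yx$, $gg^{-1}=g^{-1}g=1$, $gxg^{-1}=-x$, $gyg^{-1}=-y+x$. Put $C:=(2yx-s)g^{-1}\in A$, a central element. $A_1$ denotes the first Weyl algebra over $\Bbbk$ (generated by $\partial, t$ with $\partial t-t\partial=1$), tensor products are over $\Bbbk$, and $\operatorname{Frac}$ of a Noetherian domain denotes its skew field of fractions. The classical quotient ring $Q(R)$ of a ring $R$ whose set of regular elements is a left and right Ore set is the localization of $R$ at the set of all its regular elements; $A$ is Noetherian and has a classical quotient ring. $Z(R)$ denotes the centre of $R$. *)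

theory Defs
  imports "HOL-Analysis.Analysis" "HOL-Library.Poly_Mapping"
    "HOL-Computational_Algebra.Polynomial"
begin

section \<open>Rings\<close>

text \<open>
  The sort \<open>{ring, monoid_mult}\<close> is that of associative unital rings in which \<open>0 = 1\<close> is not
  excluded; \<open>ring_1\<close> adds \<open>0 \<noteq> 1\<close>. Algebras given by generators and relations are declared with
  the former, so that their nontriviality need not be known beforehand.
\<close>

definition is_ideal :: "'a::ring set \<Rightarrow> bool" where
  "is_ideal I \<longleftrightarrow> 0 \<in> I \<and> (\<forall>a\<in>I. \<forall>b\<in>I. a + b \<in> I) \<and> (\<forall>a\<in>I. - a \<in> I) \<and>
     (\<forall>a\<in>I. \<forall>r. r * a \<in> I \<and> a * r \<in> I)"

definition ideal_cong :: "'a::ring set \<Rightarrow> 'a \<Rightarrow> 'a \<Rightarrow> bool" where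
  "ideal_cong S a b \<longleftrightarrow> a - b \<in> is_ideal hull S"

definition unital_ring_hom ::
    "('a::{ring, monoid_mult} \<Rightarrow> 'b::{ring, monoid_mult}) \<Rightarrow> bool" where
  "unital_ring_hom f \<longleftrightarrow>
     f 1 = 1 \<and> (\<forall>a b. f (a + b) = f a + f b) \<and> (\<forall>a b. f (a * b) = f a * f b)"

definition centre :: "'a::ring set" where
  "centre = {z. \<forall>a. z * a = a * z}"

definition regular :: "'a::ring \<Rightarrow> bool" where
  "regular r \<longleftrightarrow> (\<forall>a. r * a = 0 \<longrightarrow> a = 0) \<and> (\<forall>a. a * r = 0 \<longrightarrow> a = 0)"

definition two_sided_unit :: "'a::monoid_mult \<Rightarrow> bool" where
  "two_sided_unit u \<longleftrightarrow> (\<exists>v. u * v = 1 \<and> v * u = 1)"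

text \<open>
  \<open>\<iota> : R \<rightarrow> Q\<close> is the localization of \<open>R\<close> at the set of all its regular elements, as a left and
  right ring of fractions: every \<open>q\<close> can be written \<open>\<iota>(a) \<iota>(s)\<^sup>-\<^sup>1\<close> and \<open>\<iota>(s)\<^sup>-\<^sup>1 \<iota>(a)\<close>. Such a \<open>\<iota>\<close>
  exists if and only if the regular elements form a left and right Ore set, and is then unique up
  to a unique isomorphism. If \<open>R\<close> is a domain, \<open>Q\<close> is its skew field of fractions.
\<close>
definition classical_quotient_ring ::
    "('r::{ring, monoid_mult} \<Rightarrow> 'q::{ring, monoid_mult}) \<Rightarrow> bool" where
  "classical_quotient_ring \<iota> \<longleftrightarrow>
     unital_ring_hom \<iota> \<and> inj \<iota> \<and>
     (\<forall>s. regular s \<longrightarrow> two_sided_unit (\<iota> s)) \<and>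
     (\<forall>q. \<exists>a s. regular s \<and> q * \<iota> s = \<iota> a) \<and>
     (\<forall>q. \<exists>a s. regular s \<and> \<iota> s * q = \<iota> a)"

definition skew_field :: "'a::ring_1 itself \<Rightarrow> bool" where
  "skew_field _ \<longleftrightarrow> (\<forall>a::'a. a \<noteq> 0 \<longrightarrow> two_sided_unit a)"

definition simple_ring :: "'a::ring_1 itself \<Rightarrow> bool" where
  "simple_ring _ \<longleftrightarrow> (\<forall>I::'a set. is_ideal I \<longrightarrow> I = {0} \<or> I = UNIV)"

text \<open>
  Central simple algebra over a skew field \<open>D\<close> which need not be commutative, with structure map
  \<open>\<phi> : D \<rightarrow> R\<close>: the ring \<open>R\<close> is simple, finitely generated as a left \<open>D\<close>-module, and its centre is
  the image of the centre of \<open>D\<close>. For commutative \<open>D\<close> this is the usual notion.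
\<close>
definition central_simple_algebra :: "('d::ring_1 \<Rightarrow> 'r::ring_1) \<Rightarrow> bool" where
  "central_simple_algebra \<phi> \<longleftrightarrow>
     skew_field TYPE('d) \<and> unital_ring_hom \<phi> \<and> simple_ring TYPE('r) \<and>
     (\<exists>B. finite B \<and> (\<forall>r. \<exists>c. r = (\<Sum>b\<in>B. \<phi> (c b) * b))) \<and>
     centre = \<phi> ` centre"

lemma is_ideal_hull: "is_ideal (is_ideal hull S)"
  by (rule hull_in) (auto simp: is_ideal_def)

lemma ideal_cong_refl: "ideal_cong S a a"
  using is_ideal_hull[of S] by (simp add: ideal_cong_def is_ideal_def)

lemma ideal_cong_add:
  assumes "ideal_cong S a b" "ideal_cong S c d"
  shows "ideal_cong S (a + c) (b + d)"
proof -
  have "(a - b) + (c - d) \<in> is_ideal hull S"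
    using is_ideal_hull[of S] assms by (simp only: ideal_cong_def is_ideal_def)
  then show ?thesis by (simp add: ideal_cong_def add_diff_add)
qed

lemma ideal_cong_uminus:
  assumes "ideal_cong S a b"
  shows "ideal_cong S (- a) (- b)"
proof -
  have "- (a - b) \<in> is_ideal hull S"
    using is_ideal_hull[of S] assms by (simp only: ideal_cong_def is_ideal_def)
  then show ?thesis by (simp add: ideal_cong_def)
qed

lemma ideal_cong_diff:
  "ideal_cong S a b \<Longrightarrow> ideal_cong S c d \<Longrightarrow> ideal_cong S (a - c) (b - d)"
  using ideal_cong_add[of S a b "- c" "- d"] ideal_cong_uminus[of S c d] by simp

lemma ideal_cong_sym: "ideal_cong S a b \<Longrightarrow> ideal_cong S b a"
  using ideal_cong_uminus[of S a b] by (simp add: ideal_cong_def)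

lemma ideal_cong_trans: "ideal_cong S a b \<Longrightarrow> ideal_cong S b c \<Longrightarrow> ideal_cong S a c"
  using ideal_cong_add[of S a b b c] by (simp add: ideal_cong_def add.commute[of b c])

lemma ideal_cong_mult:
  assumes "ideal_cong S a b" "ideal_cong S c d"
  shows "ideal_cong S (a * c) (b * d)"
proof -
  have "(a - b) * c \<in> is_ideal hull S" "b * (c - d) \<in> is_ideal hull S"
    using is_ideal_hull[of S] assms by (simp_all only: ideal_cong_def is_ideal_def)
  then have "ideal_cong S (a * c) (b * c)" "ideal_cong S (b * c) (b * d)"
    by (simp_all add: ideal_cong_def left_diff_distrib right_diff_distrib)
  then show ?thesis by (rule ideal_cong_trans)
qed

lemma equivp_ideal_cong: "equivp (ideal_cong S)"
proof (rule equivpI)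
  show "reflp (ideal_cong S)" by (rule reflpI) (rule ideal_cong_refl)
  show "symp (ideal_cong S)" by (rule sympI) (rule ideal_cong_sym)
  show "transp (ideal_cong S)" by (rule transpI) (rule ideal_cong_trans)
qed


section \<open>Free algebras\<close>

text \<open>
  The free algebra on \<open>'g\<close> over \<open>'k\<close> is the monoid algebra \<open>'g word \<Rightarrow>\<^sub>0 'k\<close> of the free monoid.
  The library writes the monoid additively, so \<open>+\<close> on words is concatenation.
\<close>

datatype 'g word = Word (letters: "'g list")

instantiation word :: (type) monoid_add
begin
definition zero_word :: "'a word" where "zero_word = Word []"
definition plus_word :: "'a word \<Rightarrow> 'a word \<Rightarrow> 'a word"
  where "plus_word u v = Word (letters u @ letters v)"
instance
  by standard (simp_all add: zero_word_def plus_word_def)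
end

definition free_gen :: "'g \<Rightarrow> 'g word \<Rightarrow>\<^sub>0 'k::ring_1" where
  "free_gen a = Poly_Mapping.single (Word [a]) 1"


section \<open>The bosonization of the super Jordan plane\<close>

datatype sjp_gen = Gen_x | Gen_y | Gen_g | Gen_ginv

definition sjp_relations :: "(sjp_gen word \<Rightarrow>\<^sub>0 'k::ring_1) set" where
  "sjp_relations =
    (let x = free_gen Gen_x; y = free_gen Gen_y; g = free_gen Gen_g; h = free_gen Gen_ginv;
         s = x * y + y * x
     in {x^2, y * s - s * y - x * s, g * h - 1, h * g - 1,
         g * x * h - (- x), g * y * h - (- y + x)})"

quotient_type (overloaded) 'k sjp = "sjp_gen word \<Rightarrow>\<^sub>0 ('k::field)" / "ideal_cong sjp_relations"
  by (rule equivp_ideal_cong)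

instantiation sjp :: (field) "{ring, monoid_mult}"
begin
lift_definition zero_sjp :: "'a sjp" is 0 .
lift_definition one_sjp :: "'a sjp" is 1 .
lift_definition plus_sjp :: "'a sjp \<Rightarrow> 'a sjp \<Rightarrow> 'a sjp" is "(+)" by (rule ideal_cong_add)
lift_definition uminus_sjp :: "'a sjp \<Rightarrow> 'a sjp" is uminus by (rule ideal_cong_uminus)
lift_definition minus_sjp :: "'a sjp \<Rightarrow> 'a sjp \<Rightarrow> 'a sjp" is "(-)" by (rule ideal_cong_diff)
lift_definition times_sjp :: "'a sjp \<Rightarrow> 'a sjp \<Rightarrow> 'a sjp" is "(*)" by (rule ideal_cong_mult)
instance
  by standard (transfer; simp add: algebra_simps ideal_cong_refl)+
end

instance sjp :: (field) numeral ..

lift_definition sjp_scalar :: "'k::field \<Rightarrow> 'k sjp" is "Poly_Mapping.single 0" .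
lift_definition sjp_x :: "'k::field sjp" is "free_gen Gen_x" .
lift_definition sjp_y :: "'k::field sjp" is "free_gen Gen_y" .
lift_definition sjp_g :: "'k::field sjp" is "free_gen Gen_g" .
lift_definition sjp_ginv :: "'k::field sjp" is "free_gen Gen_ginv" .

definition sjp_s :: "'k::field sjp" where
  "sjp_s = sjp_x * sjp_y + sjp_y * sjp_x"

definition sjp_C :: "'k::field sjp" where
  "sjp_C = (2 * sjp_y * sjp_x - sjp_s) * sjp_ginv"

definition eval_C :: "'k::field poly \<Rightarrow> 'k sjp" where
  "eval_C p = (\<Sum>i\<le>degree p. sjp_scalar (coeff p i) * sjp_C ^ i)"


section \<open>The first Weyl algebra\<close>

datatype weyl_gen = Gen_d | Gen_t

definition weyl_relations :: "(weyl_gen word \<Rightarrow>\<^sub>0 'k::ring_1) set" where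
  "weyl_relations = {free_gen Gen_d * free_gen Gen_t - free_gen Gen_t * free_gen Gen_d - 1}"

quotient_type (overloaded) 'k weyl = "weyl_gen word \<Rightarrow>\<^sub>0 ('k::field)" / "ideal_cong weyl_relations"
  by (rule equivp_ideal_cong)

instantiation weyl :: (field) "{ring, monoid_mult}"
begin
lift_definition zero_weyl :: "'a weyl" is 0 .
lift_definition one_weyl :: "'a weyl" is 1 .
lift_definition plus_weyl :: "'a weyl \<Rightarrow> 'a weyl \<Rightarrow> 'a weyl" is "(+)" by (rule ideal_cong_add)
lift_definition uminus_weyl :: "'a weyl \<Rightarrow> 'a weyl" is uminus by (rule ideal_cong_uminus)
lift_definition minus_weyl :: "'a weyl \<Rightarrow> 'a weyl \<Rightarrow> 'a weyl" is "(-)" by (rule ideal_cong_diff)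
lift_definition times_weyl :: "'a weyl \<Rightarrow> 'a weyl \<Rightarrow> 'a weyl" is "(*)" by (rule ideal_cong_mult)
instance
  by standard (transfer; simp add: algebra_simps ideal_cong_refl)+
end

lift_definition weyl_scalar :: "'k::field \<Rightarrow> 'k weyl" is "Poly_Mapping.single 0" .


section \<open>The tensor product of the polynomial algebra and the Weyl algebra\<close>

text \<open>
  \<open>('a, 'b) tensor_symbol \<Rightarrow>\<^sub>0 'k\<close> is the free \<open>'k\<close>-module on the symbols \<open>a \<otimes> b\<close>, with the product
  determined by \<open>(a \<otimes> b) (a' \<otimes> b') = a a' \<otimes> b b'\<close>; as for words, the monoid of symbols is written
  additively. The tensor product is its quotient by the bilinearity relations; the
  submodule they span is already an ideal.
\<close>

datatype ('a, 'b) tensor_symbol = Tensor (left_factor: 'a) (right_factor: 'b)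

instantiation tensor_symbol :: (monoid_mult, monoid_mult) monoid_add
begin
definition zero_tensor_symbol :: "('a, 'b) tensor_symbol"
  where "zero_tensor_symbol = Tensor 1 1"
definition plus_tensor_symbol ::
    "('a, 'b) tensor_symbol \<Rightarrow> ('a, 'b) tensor_symbol \<Rightarrow> ('a, 'b) tensor_symbol"
  where "plus_tensor_symbol u v =
    Tensor (left_factor u * left_factor v) (right_factor u * right_factor v)"
instance
  by standard (simp_all add: zero_tensor_symbol_def plus_tensor_symbol_def mult.assoc)
end

text \<open>The arguments \<open>\<eta>\<close> and \<open>\<theta>\<close> are the structure maps of the two algebras.\<close>
definition tensor_relations ::
    "('k::ring_1 \<Rightarrow> 'a::{ring, monoid_mult}) \<Rightarrow> ('k \<Rightarrow> 'b::{ring, monoid_mult}) \<Rightarrow>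
     (('a, 'b) tensor_symbol \<Rightarrow>\<^sub>0 'k) set" where
  "tensor_relations \<eta> \<theta> =
    (let T = (\<lambda>c a b. Poly_Mapping.single (Tensor a b) c) in
      {T 1 (a + a') b - T 1 a b - T 1 a' b | a a' b. True} \<union>
      {T 1 a (b + b') - T 1 a b - T 1 a b' | a b b'. True} \<union>
      {T 1 (\<eta> c * a) b - T c a b | c a b. True} \<union>
      {T 1 a (\<theta> c * b) - T c a b | c a b. True})"

text \<open>The type \<open>'k poly\<close> is \<open>\<bbbk>[C]\<close>, with indeterminate \<open>C = [:0, 1:]\<close>.\<close>
quotient_type (overloaded) 'k polyC_weyl =
    "('k poly, 'k weyl) tensor_symbol \<Rightarrow>\<^sub>0 ('k::field)" /
    "ideal_cong (tensor_relations (\<lambda>c. [:c:]) weyl_scalar)"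
  by (rule equivp_ideal_cong)

instantiation polyC_weyl :: (field) "{ring, monoid_mult}"
begin
lift_definition zero_polyC_weyl :: "'a polyC_weyl" is 0 .
lift_definition one_polyC_weyl :: "'a polyC_weyl" is 1 .
lift_definition plus_polyC_weyl :: "'a polyC_weyl \<Rightarrow> 'a polyC_weyl \<Rightarrow> 'a polyC_weyl" is "(+)"
  by (rule ideal_cong_add)
lift_definition uminus_polyC_weyl :: "'a polyC_weyl \<Rightarrow> 'a polyC_weyl" is uminus
  by (rule ideal_cong_uminus)
lift_definition minus_polyC_weyl :: "'a polyC_weyl \<Rightarrow> 'a polyC_weyl \<Rightarrow> 'a polyC_weyl" is "(-)"
  by (rule ideal_cong_diff)
lift_definition times_polyC_weyl :: "'a polyC_weyl \<Rightarrow> 'a polyC_weyl \<Rightarrow> 'a polyC_weyl" is "(*)"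
  by (rule ideal_cong_mult)
instance
  by standard (transfer; simp add: algebra_simps ideal_cong_refl)+
end

definition pure_tensor :: "'k::field poly \<Rightarrow> 'k weyl \<Rightarrow> 'k polyC_weyl" where
  "pure_tensor p w = abs_polyC_weyl (Poly_Mapping.single (Tensor p w) 1)"


section \<open>Isomorphisms onto the matrix ring\<close>

text \<open>
  The ring \<open>M\<^sub>2(D)\<close> is the type \<open>'d^2^2\<close> with pointwise addition and the product \<open>**\<close> (not the
  pointwise \<open>*\<close>); \<open>mat d\<close> is the scalar matrix with diagonal entries \<open>d\<close>.
\<close>
definition iso_matrix_ring :: "('q::ring_1 \<Rightarrow> 'd::ring_1 ^ 2 ^ 2) \<Rightarrow> bool" where
  "iso_matrix_ring f \<longleftrightarrow>
     bij f \<and> f 1 = mat 1 \<and> (\<forall>a b. f (a + b) = f a + f b) \<and> (\<forall>a b. f (a * b) = f a ** f b)"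

end

theory Submission
  imports Defs "HOL-Computational_Algebra.Formal_Laurent_Series"
    "HOL-Computational_Algebra.Polynomial_Factorial"
begin

text \<open>
  Everything rests on one representation. Writing \<open>C' = C\<^sup>-\<^sup>1\<close>, the assignment
  \<open>x \<mapsto> (0, 1; 0, 0)\<close>, \<open>y \<mapsto> (0, t\<partial>; t, 0)\<close>, \<open>g \<mapsto> diag(- C' t, C' t)\<close> defines a homomorphism \<open>\<psi>\<close>
  from the bosonization to the \<open>2 \<times> 2\<close> matrices over any extension of \<open>\<bbbk>[C] \<otimes> A\<^sub>1\<close> in which \<open>C\<close>
  and \<open>t\<close> are invertible; it sends \<open>s\<close>, \<open>\<tau> = y\<^sup>2 - x y\<close> and \<open>C\<close> to the scalar matrices \<open>t\<close>,
  \<open>t\<^sup>2\<partial>\<close> and \<open>C\<close>. It is faithful: up to a power of \<open>g\<close>, every element is a combination of \<open>1\<close>,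
  \<open>x\<close>, \<open>y\<close>, \<open>x y\<close> with coefficients \<open>\<Sum> u\<^sub>i(g, s) \<tau>\<^sup>i\<close>, and over the differential operators with
  coefficients in \<open>\<bbbk>(C)((t))\<close> the leading coefficients in \<open>\<partial>\<close> recover the \<open>u\<^sub>i\<close>. A central element
  maps to a scalar matrix that commutes with \<open>t\<close> and \<open>\<partial>\<close>, hence lies in \<open>\<bbbk>(C)\<close>, and a grading shows
  that it lies in \<open>\<bbbk>[C]\<close>. Finally, every matrix over \<open>\<bbbk>[C] \<otimes> A\<^sub>1\<close> is carried into the image of
  \<open>\<psi>\<close> by a power of \<open>t\<close>, so that \<open>M\<^sub>2(\<^bold>D)\<close> is a ring of left fractions of the bosonization, and such
  rings are unique.
\<close>

section \<open>Homomorphisms out of the presented algebras\<close>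

text \<open>The matrices are nearly forced. If \<open>x\<close> is the matrix unit
  \<open>E12\<close> and \<open>y\<close> is off-diagonal with entries \<open>b\<close> and
  \<open>c\<close>, then \<open>s = x y + y x\<close> is the scalar matrix \<open>c\<close>, which
  is taken to be \<open>t\<close>. The relation \<open>y s = s y + x s\<close> becomes
  \<open>b t = t b + t\<close>, solved by \<open>b = t \<partial>\<close>. For
  \<open>g = diag(- a, a)\<close> the conjugation relations become \<open>a t = t a\<close> and
  \<open>a b = (b - 1) a\<close>, solved by \<open>a = t\<close> up to a central factor; asking that
  \<open>(2 y x - s) g^-1\<close> be the scalar \<open>C\<close> makes this factor
  \<open>C^-1\<close>.

  Since the algebras are given by relations, no basis is available at the start, not even
  \<open>0 \<noteq> 1\<close>. Rewriting only yields spanning sets; independence has to be read off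
  in a model. The model must contain an inverse of \<open>t\<close> and have no zero divisors,
  whence coefficients in the field \<open>\<bbbk>(C)((t))\<close>.

  Characteristic zero enters in the centre, where a vanishing derivative has to force a
  constant.\<close>

lemma unital_ring_homD:
  assumes "unital_ring_hom f"
  shows "f 0 = 0" "f 1 = 1" "f (a + b) = f a + f b" "f (a - b) = f a - f b" "f (- a) = - f a"
    "f (a * b) = f a * f b"
proof -
  have *: "f 1 = 1" "\<And>a b. f (a + b) = f a + f b" "\<And>a b. f (a * b) = f a * f b"
    using assms by (auto simp: unital_ring_hom_def)
  have 0: "f 0 = 0" using *(2)[of 0 0] by simp
  have m: "f (- a) = - f a" for a
    using *(2)[of a "- a"] 0 by (simp add: eq_neg_iff_add_eq_0 add.commute)
  show "f 0 = 0" "f 1 = 1" "f (a + b) = f a + f b" "f (- a) = - f a" "f (a * b) = f a * f b"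
    using * 0 m by simp_all
  show "f (a - b) = f a - f b"
    using *(2)[of a "- b"] m by simp
qed

lemma unital_ring_hom_power:
  "unital_ring_hom f \<Longrightarrow> f (a ^ n) = f a ^ n"
  by (induction n) (simp_all add: unital_ring_homD)

lemma unital_ring_hom_comp:
  "unital_ring_hom f \<Longrightarrow> unital_ring_hom g \<Longrightarrow> unital_ring_hom (\<lambda>x. f (g x))"
  unfolding unital_ring_hom_def by simp

lemma ideal_cong_hom:
  assumes "unital_ring_hom f" "\<And>r. r \<in> S \<Longrightarrow> f r = 0" "ideal_cong S a b"
  shows "f a = f b"
proof -
  have "is_ideal {a. f a = 0}"
    using assms(1) by (simp add: is_ideal_def unital_ring_homD)
  then have "is_ideal hull S \<subseteq> {a. f a = 0}"
    by (rule hull_minimal[rotated]) (use assms(2) in auto)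
  then show ?thesis
    using assms(1,3) by (auto simp: ideal_cong_def unital_ring_homD)
qed

section \<open>Homomorphisms out of monoid algebras\<close>

lemma poly_mapping_add_induct [case_names single add]:
  assumes "\<And>m c. P (Poly_Mapping.single m c)" "\<And>p q. P p \<Longrightarrow> P q \<Longrightarrow> P (p + q)"
  shows "P p"
proof (induction p rule: update_induct)
  case const
  show ?case using assms(1)[of _ 0] by simp
next
  case (update p m c)
  have "Poly_Mapping.update m c p = p + Poly_Mapping.single m c"
    using update(1) by (intro poly_mapping_eqI)
      (auto simp: lookup_update lookup_add lookup_single when_def in_keys_iff)
  then show ?case using assms update by simp
qed

text \<open>Words and tensor symbols both form monoids, so one universal property serves the free
  algebras as well as the tensor product.\<close>

definition monoid_algebra_lift ::
    "('k::ring_1 \<Rightarrow> 'r::{ring, monoid_mult}) \<Rightarrow> ('m \<Rightarrow> 'r) \<Rightarrow> ('m \<Rightarrow>\<^sub>0 'k) \<Rightarrow> 'r" where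
  "monoid_algebra_lift \<eta> \<mu> p = (\<Sum>m\<in>Poly_Mapping.keys p. \<eta> (Poly_Mapping.lookup p m) * \<mu> m)"

lemma monoid_algebra_lift_single:
  "unital_ring_hom \<eta> \<Longrightarrow> monoid_algebra_lift \<eta> \<mu> (Poly_Mapping.single m c) = \<eta> c * \<mu> m"
  by (simp add: monoid_algebra_lift_def unital_ring_homD)

lemma monoid_algebra_lift_superset:
  assumes "unital_ring_hom \<eta>" "finite A" "Poly_Mapping.keys p \<subseteq> A"
  shows "monoid_algebra_lift \<eta> \<mu> p = (\<Sum>m\<in>A. \<eta> (Poly_Mapping.lookup p m) * \<mu> m)"
  unfolding monoid_algebra_lift_def using assms
  by (intro sum.mono_neutral_left) (auto simp: in_keys_iff unital_ring_homD)

lemma monoid_algebra_lift_add: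
  assumes "unital_ring_hom \<eta>"
  shows "monoid_algebra_lift \<eta> \<mu> (p + q) = monoid_algebra_lift \<eta> \<mu> p + monoid_algebra_lift \<eta> \<mu> q"
proof -
  let ?A = "Poly_Mapping.keys p \<union> Poly_Mapping.keys q"
  note sup = monoid_algebra_lift_superset[OF assms, of ?A _ \<mu>]
  show ?thesis
    using Poly_Mapping.keys_add[of p q]
    by (subst (1 2 3) sup)
       (auto simp: lookup_add unital_ring_homD[OF assms] distrib_right sum.distrib)
qed

lemma unital_ring_hom_monoid_algebra_lift:
  fixes \<mu> :: "'m::monoid_add \<Rightarrow> 'r::{ring, monoid_mult}"
  assumes \<eta>: "unital_ring_hom \<eta>" and \<mu>: "\<mu> 0 = 1" "\<And>m n. \<mu> (m + n) = \<mu> m * \<mu> n"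
    and comm: "\<And>c m. \<eta> c * \<mu> m = \<mu> m * \<eta> c"
  shows "unital_ring_hom (monoid_algebra_lift \<eta> \<mu>)"
proof -
  let ?F = "monoid_algebra_lift \<eta> \<mu>"
  note single = monoid_algebra_lift_single[OF \<eta>] and add = monoid_algebra_lift_add[OF \<eta>, of \<mu>]
  have mult_single: "?F (Poly_Mapping.single m c * q) = ?F (Poly_Mapping.single m c) * ?F q" for m c q
  proof (induction q rule: poly_mapping_add_induct)
    case (single n d)
    have "\<eta> c * \<eta> d * (\<mu> m * \<mu> n) = \<eta> c * (\<eta> d * \<mu> m) * \<mu> n"
      by (simp only: mult.assoc)
    also have "\<dots> = \<eta> c * \<mu> m * (\<eta> d * \<mu> n)"
      unfolding comm[of d m] by (simp only: mult.assoc)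
    finally have "\<eta> (c * d) * \<mu> (m + n) = \<eta> c * \<mu> m * (\<eta> d * \<mu> n)"
      by (simp only: unital_ring_homD[OF \<eta>] \<mu>)
    then show ?case
      by (simp only: mult_single monoid_algebra_lift_single[OF \<eta>])
  next
    case (add p q)
    then show ?case
      by (simp add: distrib_left monoid_algebra_lift_add[OF \<eta>])
  qed
  have "?F (p * q) = ?F p * ?F q" for p q
    by (induction p rule: poly_mapping_add_induct) (simp_all add: mult_single distrib_right add)
  moreover have "?F 1 = 1"
    using single[of \<mu> 0 1] \<mu> \<eta> by (simp add: unital_ring_homD)
  ultimately show ?thesis
    using add by (simp add: unital_ring_hom_def)
qed

definition free_lift ::
    "('k::ring_1 \<Rightarrow> 'r::{ring, monoid_mult}) \<Rightarrow> ('g \<Rightarrow> 'r) \<Rightarrow> ('g word \<Rightarrow>\<^sub>0 'k) \<Rightarrow> 'r" where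
  "free_lift \<eta> f = monoid_algebra_lift \<eta> (\<lambda>w. prod_list (map f (letters w)))"

lemma
  assumes \<eta>: "unital_ring_hom \<eta>" and comm: "\<And>c a. \<eta> c * f a = f a * \<eta> c"
  shows unital_ring_hom_free_lift: "unital_ring_hom (free_lift \<eta> f)"
    and free_lift_gen: "free_lift \<eta> f (free_gen a) = f a"
    and free_lift_scalar: "free_lift \<eta> f (Poly_Mapping.single 0 c) = \<eta> c"
proof -
  have "\<eta> c * prod_list (map f l) = prod_list (map f l) * \<eta> c" for c l
  proof (induction l)
    case (Cons a l)
    then show ?case by (simp add: mult.assoc) (metis comm mult.assoc)
  qed simp
  then show "unital_ring_hom (free_lift \<eta> f)"
    unfolding free_lift_def
    by (intro unital_ring_hom_monoid_algebra_lift) (simp_all add: \<eta> zero_word_def plus_word_def)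
  show "free_lift \<eta> f (free_gen a) = f a"
    by (simp add: free_lift_def free_gen_def monoid_algebra_lift_single \<eta> unital_ring_homD[OF \<eta>])
  show "free_lift \<eta> f (Poly_Mapping.single 0 c) = \<eta> c"
    by (simp add: free_lift_def monoid_algebra_lift_single \<eta> zero_word_def)
qed

lemma free_algebra_induct [case_names scalar add gen]:
  fixes p :: "'g word \<Rightarrow>\<^sub>0 'k::ring_1"
  assumes "\<And>c. P (Poly_Mapping.single 0 c)" "\<And>p q. P p \<Longrightarrow> P q \<Longrightarrow> P (p + q)"
    "\<And>a p. P p \<Longrightarrow> P (free_gen a * p)"
  shows "P p"
proof (induction p rule: poly_mapping_add_induct)
  case (single m c)
  have "P (Poly_Mapping.single (Word l) c)" for l
  proof (induction l)
    case Nil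
    then show ?case using assms(1) by (simp add: zero_word_def)
  next
    case (Cons a l)
    have "free_gen a * Poly_Mapping.single (Word l) c = Poly_Mapping.single (Word (a # l)) c"
      by (simp add: free_gen_def mult_single plus_word_def)
    then show ?case using assms(3)[OF Cons, of a] by simp
  qed
  then show ?case by (cases m) simp
next
  case (add p q)
  then show ?case by (rule assms(2))
qed

subsection \<open>The bosonization\<close>

text \<open>Every word is built up by left multiplication with generators. This is why the normal
  forms and gradings below are only tested against left multiplication.\<close>

lemma sjp_induct [case_names scalar add x y g ginv]:
  fixes a :: "'k::field sjp"
  assumes "\<And>c. P (sjp_scalar c)" "\<And>a b. P a \<Longrightarrow> P b \<Longrightarrow> P (a + b)"
    "\<And>a. P a \<Longrightarrow> P (sjp_x * a)" "\<And>a. P a \<Longrightarrow> P (sjp_y * a)"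
    "\<And>a. P a \<Longrightarrow> P (sjp_g * a)" "\<And>a. P a \<Longrightarrow> P (sjp_ginv * a)"
  shows "P a"
proof (induction a rule: sjp.abs_induct)
  fix p :: "sjp_gen word \<Rightarrow>\<^sub>0 'k"
  show "P (abs_sjp p)"
  proof (induction p rule: free_algebra_induct)
    case (scalar c)
    show ?case using assms(1)[of c] by (simp add: sjp_scalar.abs_eq)
  next
    case (add p q)
    show ?case using assms(2)[OF add] by (simp add: plus_sjp.abs_eq)
  next
    case (gen z p)
    show ?case
      using assms(3-)[OF gen]
      by (cases z) (simp_all add: times_sjp.abs_eq sjp_x_def sjp_y_def sjp_g_def sjp_ginv_def)
  qed
qed

lemma sjp_hom_exists:
  fixes \<eta> :: "'k::field \<Rightarrow> 'r::{ring, monoid_mult}"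
  assumes \<eta>: "unital_ring_hom \<eta>" and comm: "\<And>c a. a \<in> {X, Y, G, H} \<Longrightarrow> \<eta> c * a = a * \<eta> c"
    and rel: "X * X = 0" "Y * (X * Y + Y * X) = (X * Y + Y * X) * Y + X * (X * Y + Y * X)"
      "G * H = 1" "H * G = 1" "G * X = - X * G" "G * Y = (- Y + X) * G"
  obtains F :: "'k sjp \<Rightarrow> 'r" where "unital_ring_hom F" "\<And>c. F (sjp_scalar c) = \<eta> c"
    "F sjp_x = X" "F sjp_y = Y" "F sjp_g = G" "F sjp_ginv = H"
proof -
  define f where "f z = (case z of Gen_x \<Rightarrow> X | Gen_y \<Rightarrow> Y | Gen_g \<Rightarrow> G | Gen_ginv \<Rightarrow> H)" for z
  define L where "L = free_lift \<eta> f"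
  have comm': "\<eta> c * f z = f z * \<eta> c" for c z
    using comm by (cases z) (simp_all add: f_def)
  have L: "unital_ring_hom L"
    unfolding L_def by (rule unital_ring_hom_free_lift[OF \<eta> comm'])
  have gen: "L (free_gen z) = f z" for z
    unfolding L_def by (rule free_lift_gen[OF \<eta> comm'])
  have "G * X * H = - X" "G * Y * H = - Y + X"
    using rel(3) by (simp_all only: rel(5,6) mult.assoc mult_1_right)
  moreover have "Y * (X * Y + Y * X) - (X * Y + Y * X) * Y - X * (X * Y + Y * X) = 0"
    unfolding rel(2) by simp
  ultimately have "L r = 0" if "r \<in> sjp_relations" for r
    using that rel(1,3,4)
    unfolding sjp_relations_def Let_def power2_eq_square insert_iff
    by (elim disjE; simp add: unital_ring_homD[OF L] gen f_def)
  then have eq: "L p = L q" if "abs_sjp p = abs_sjp q" for p q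
    using ideal_cong_hom[OF L _ that[unfolded sjp.abs_eq_iff]] by simp
  define F where "F a = L (rep_sjp a)" for a
  have F: "F (abs_sjp p) = L p" for p
    unfolding F_def by (rule eq) (simp add: Quotient3_abs_rep[OF Quotient3_sjp])
  show thesis
  proof
    show "unital_ring_hom F"
      unfolding unital_ring_hom_def
    proof (intro conjI allI)
      show "F 1 = 1" by (simp add: one_sjp.abs_eq F unital_ring_homD[OF L])
      fix a b :: "'k sjp"
      obtain p q where [simp]: "a = abs_sjp p" "b = abs_sjp q"
        by (metis Quotient3_abs_rep[OF Quotient3_sjp])
      show "F (a + b) = F a + F b"
        by (simp add: plus_sjp.abs_eq F unital_ring_homD[OF L])
      show "F (a * b) = F a * F b"
        by (simp add: times_sjp.abs_eq F unital_ring_homD[OF L])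
    qed
    show "F (sjp_scalar c) = \<eta> c" for c
      unfolding sjp_scalar.abs_eq F L_def by (rule free_lift_scalar[OF \<eta> comm'])
  qed (simp_all add: sjp_x_def sjp_y_def sjp_g_def sjp_ginv_def F gen f_def)
qed

lemma unital_ring_hom_sjp_scalar: "unital_ring_hom (sjp_scalar :: 'k::field \<Rightarrow> 'k sjp)"
  unfolding unital_ring_hom_def
  by (simp add: sjp_scalar.abs_eq one_sjp.abs_eq plus_sjp.abs_eq times_sjp.abs_eq single_add mult_single)

lemma single_zero_commute:
  fixes p :: "'m::monoid_add \<Rightarrow>\<^sub>0 'k::comm_ring_1"
  shows "Poly_Mapping.single 0 c * p = p * Poly_Mapping.single 0 c"
  by (induction p rule: poly_mapping_add_induct)
     (simp_all add: mult_single distrib_left distrib_right mult.commute)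

lemma sjp_scalar_commute: "sjp_scalar c * a = a * sjp_scalar c"
  by (induction a rule: sjp.abs_induct)
     (simp add: sjp_scalar.abs_eq times_sjp.abs_eq single_zero_commute)

lemma sjp_rels:
  "sjp_x * sjp_x = (0 :: 'a::field sjp)" "sjp_y * sjp_s = sjp_s * sjp_y + sjp_x * (sjp_s :: 'a sjp)"
  "sjp_g * sjp_ginv = (1 :: 'a sjp)" "sjp_ginv * sjp_g = (1 :: 'a sjp)"
  "sjp_g * sjp_x = - sjp_x * (sjp_g :: 'a sjp)"
  "sjp_g * sjp_y = (- sjp_y + sjp_x) * (sjp_g :: 'a sjp)"
proof -
  have hull: "abs_sjp p = abs_sjp q" if "p - q \<in> sjp_relations" for p q :: "sjp_gen word \<Rightarrow>\<^sub>0 'a"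
    using that by (simp add: sjp.abs_eq_iff ideal_cong_def hull_inc)
  note defs = sjp_x_def sjp_y_def sjp_g_def sjp_ginv_def sjp_s_def times_sjp.abs_eq plus_sjp.abs_eq
    zero_sjp.abs_eq one_sjp.abs_eq uminus_sjp.abs_eq
  show "sjp_x * sjp_x = (0 :: 'a sjp)"
    unfolding defs by (rule hull) (simp add: sjp_relations_def Let_def power2_eq_square)
  show "sjp_y * sjp_s = sjp_s * sjp_y + sjp_x * (sjp_s :: 'a sjp)"
    unfolding defs by (rule hull) (simp add: sjp_relations_def Let_def algebra_simps)
  show *: "sjp_g * sjp_ginv = (1 :: 'a sjp)" "sjp_ginv * sjp_g = (1 :: 'a sjp)"
    unfolding defs by (rule hull, simp add: sjp_relations_def Let_def)+
  have "sjp_g * sjp_x * sjp_ginv = - (sjp_x :: 'a sjp)"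
    "sjp_g * sjp_y * sjp_ginv = - sjp_y + (sjp_x :: 'a sjp)"
    unfolding defs by (rule hull, simp add: sjp_relations_def Let_def)+
  then show "sjp_g * sjp_x = - sjp_x * (sjp_g :: 'a sjp)"
    "sjp_g * sjp_y = (- sjp_y + sjp_x) * (sjp_g :: 'a sjp)"
    using * by (metis mult.assoc mult_1_right)+
qed


subsection \<open>Evaluation of polynomials at a ring element\<close>

text \<open>Coefficients stand on the left and need not commute with \<open>r\<close>. Thus the same
  map evaluates polynomials in the central \<open>C\<close> and writes normal forms, where
  \<open>r\<close> is \<open>tensor_d\<close> or \<open>sjp_tau\<close>; only multiplicativity asks
  for commutation.\<close>

definition poly_eval ::
    "('c::comm_ring_1 \<Rightarrow> 'r::{ring, monoid_mult}) \<Rightarrow> 'r \<Rightarrow> 'c poly \<Rightarrow> 'r" where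
  "poly_eval h r p = (\<Sum>i\<le>degree p. h (coeff p i) * r ^ i)"

lemma eval_C_eq_poly_eval: "eval_C = poly_eval sjp_scalar sjp_C"
  by (simp add: fun_eq_iff eval_C_def poly_eval_def)

lemma poly_eval_bound:
  assumes "unital_ring_hom h" "degree p \<le> n"
  shows "poly_eval h r p = (\<Sum>i\<le>n. h (coeff p i) * r ^ i)"
  unfolding poly_eval_def using assms
  by (intro sum.mono_neutral_left) (auto simp: coeff_eq_0 unital_ring_homD)

lemma poly_eval_pCons:
  assumes "unital_ring_hom h"
  shows "poly_eval h r (pCons a p) = h a + poly_eval h r p * r"
proof -
  have "poly_eval h r (pCons a p) = (\<Sum>i\<le>Suc (degree p). h (coeff (pCons a p) i) * r ^ i)"
    by (intro poly_eval_bound assms degree_pCons_le)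
  also have "\<dots> = h a + (\<Sum>i\<le>degree p. h (coeff p i) * r ^ Suc i)"
    unfolding sum.atMost_Suc_shift by simp
  also have "\<dots> = h a + poly_eval h r p * r"
    by (simp add: poly_eval_def sum_distrib_right mult.assoc power_commutes)
  finally show ?thesis .
qed

lemma poly_eval_0: "unital_ring_hom h \<Longrightarrow> poly_eval h r 0 = 0"
  by (simp add: poly_eval_def unital_ring_homD)

lemma poly_eval_const: "unital_ring_hom h \<Longrightarrow> poly_eval h r [:c:] = h c"
  by (simp add: poly_eval_pCons poly_eval_0)

lemma poly_eval_add:
  assumes "unital_ring_hom h"
  shows "poly_eval h r (p + q) = poly_eval h r p + poly_eval h r q"
proof -
  let ?n = "max (degree p) (degree q)"
  note b = poly_eval_bound[OF assms, of _ ?n r]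
  show ?thesis
    by (subst (1 2 3) b)
       (auto simp: unital_ring_homD[OF assms] distrib_right sum.distrib degree_add_le_max)
qed

lemma poly_eval_commute:
  assumes h: "unital_ring_hom h" and "z * r = r * z" "\<And>c. z * h c = h c * z"
  shows "z * poly_eval h r p = poly_eval h r p * z"
proof (induction p)
  case 0
  then show ?case by (simp add: poly_eval_0 h)
next
  case (pCons a p)
  have "z * (poly_eval h r p * r) = poly_eval h r p * r * z"
    by (metis assms(2) pCons.IH mult.assoc)
  then show ?case by (simp add: poly_eval_pCons h distrib_left distrib_right assms)
qed

lemma poly_eval_smult:
  assumes "unital_ring_hom h"
  shows "poly_eval h r (smult a q) = h a * poly_eval h r q"
  by (induction q)
     (simp_all add: poly_eval_pCons poly_eval_0 assms unital_ring_homD[OF assms] distrib_left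
       mult.assoc)

lemma unital_ring_hom_poly_eval:
  assumes h: "unital_ring_hom h" and comm: "\<And>c. h c * r = r * h c"
  shows "unital_ring_hom (poly_eval h r)"
proof -
  note hD = unital_ring_homD[OF h]
  have mult: "poly_eval h r (p * q) = poly_eval h r p * poly_eval h r q" for p q
  proof (induction p)
    case 0
    then show ?case by (simp add: poly_eval_0 h)
  next
    case (pCons a p)
    have "r * poly_eval h r q = poly_eval h r q * r"
      by (rule poly_eval_commute) (simp_all add: h comm)
    then show ?case
      by (simp add: mult_pCons_left poly_eval_add poly_eval_smult pCons.IH h poly_eval_pCons hD distrib_right
          mult.assoc)
  qed
  show ?thesis
    using poly_eval_const[OF h, of r 1] poly_eval_add[OF h] mult
    by (simp add: unital_ring_hom_def hD pCons_one)
qed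

lemma hom_poly_eval:
  assumes "unital_ring_hom f" "unital_ring_hom h"
  shows "f (poly_eval h r p) = poly_eval (\<lambda>c. f (h c)) (f r) p"
  by (induction p)
     (simp_all add: poly_eval_0 poly_eval_pCons assms unital_ring_homD[OF assms(1)]
       unital_ring_hom_comp)


subsection \<open>The tensor product of the polynomial algebra and the Weyl algebra\<close>

lift_definition weyl_d :: "'k::field weyl" is "free_gen Gen_d" .
lift_definition weyl_t :: "'k::field weyl" is "free_gen Gen_t" .

lemma weyl_induct [case_names scalar add d t]:
  fixes a :: "'k::field weyl"
  assumes "\<And>c. P (weyl_scalar c)" "\<And>a b. P a \<Longrightarrow> P b \<Longrightarrow> P (a + b)"
    "\<And>a. P a \<Longrightarrow> P (weyl_d * a)" "\<And>a. P a \<Longrightarrow> P (weyl_t * a)"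
  shows "P a"
proof (induction a rule: weyl.abs_induct)
  fix p :: "weyl_gen word \<Rightarrow>\<^sub>0 'k"
  show "P (abs_weyl p)"
  proof (induction p rule: free_algebra_induct)
    case (scalar c)
    show ?case using assms(1)[of c] by (simp add: weyl_scalar.abs_eq)
  next
    case (add p q)
    show ?case using assms(2)[OF add] by (simp add: plus_weyl.abs_eq)
  next
    case (gen z p)
    show ?case
      using assms(3-)[OF gen] by (cases z) (simp_all add: times_weyl.abs_eq weyl_d_def weyl_t_def)
  qed
qed

lemma weyl_hom_exists:
  fixes \<eta> :: "'k::field \<Rightarrow> 'r::{ring, monoid_mult}"
  assumes \<eta>: "unital_ring_hom \<eta>" and comm: "\<And>c a. a \<in> {D, T} \<Longrightarrow> \<eta> c * a = a * \<eta> c"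
    and rel: "D * T = T * D + 1"
  obtains F :: "'k weyl \<Rightarrow> 'r" where "unital_ring_hom F" "\<And>c. F (weyl_scalar c) = \<eta> c"
    "F weyl_d = D" "F weyl_t = T"
proof -
  define f where "f z = (case z of Gen_d \<Rightarrow> D | Gen_t \<Rightarrow> T)" for z
  define L where "L = free_lift \<eta> f"
  have comm': "\<eta> c * f z = f z * \<eta> c" for c z
    using comm by (cases z) (simp_all add: f_def)
  have L: "unital_ring_hom L"
    unfolding L_def by (rule unital_ring_hom_free_lift[OF \<eta> comm'])
  have gen: "L (free_gen z) = f z" for z
    unfolding L_def by (rule free_lift_gen[OF \<eta> comm'])
  have "L r = 0" if "r \<in> weyl_relations" for r
    using that rel by (simp add: weyl_relations_def unital_ring_homD[OF L] gen f_def)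
  then have eq: "L p = L q" if "abs_weyl p = abs_weyl q" for p q
    using ideal_cong_hom[OF L _ that[unfolded weyl.abs_eq_iff]] by simp
  define F where "F a = L (rep_weyl a)" for a
  have F: "F (abs_weyl p) = L p" for p
    unfolding F_def by (rule eq) (simp add: Quotient3_abs_rep[OF Quotient3_weyl])
  show thesis
  proof
    show "unital_ring_hom F"
      unfolding unital_ring_hom_def
    proof (intro conjI allI)
      show "F 1 = 1" by (simp add: one_weyl.abs_eq F unital_ring_homD[OF L])
      fix a b :: "'k weyl"
      obtain p q where [simp]: "a = abs_weyl p" "b = abs_weyl q"
        by (metis Quotient3_abs_rep[OF Quotient3_weyl])
      show "F (a + b) = F a + F b"
        by (simp add: plus_weyl.abs_eq F unital_ring_homD[OF L])
      show "F (a * b) = F a * F b"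
        by (simp add: times_weyl.abs_eq F unital_ring_homD[OF L])
    qed
    show "F (weyl_scalar c) = \<eta> c" for c
      unfolding weyl_scalar.abs_eq F L_def by (rule free_lift_scalar[OF \<eta> comm'])
  qed (simp_all add: weyl_d_def weyl_t_def F gen f_def)
qed

lemma weyl_rel: "weyl_d * weyl_t = weyl_t * weyl_d + (1 :: 'k::field weyl)"
  unfolding weyl_d_def weyl_t_def times_weyl.abs_eq plus_weyl.abs_eq one_weyl.abs_eq weyl.abs_eq_iff
  by (simp add: ideal_cong_def weyl_relations_def hull_inc diff_diff_eq)

section \<open>Pure tensors and generators of \<open>\<bbbk>[C] \<otimes> A_1\<close>\<close>

abbreviation tensor_scalar :: "'k::field \<Rightarrow> 'k polyC_weyl" where
  "tensor_scalar c \<equiv> pure_tensor [:c:] 1"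

abbreviation tensor_C :: "'k::field polyC_weyl" where "tensor_C \<equiv> pure_tensor [:0, 1:] 1"
abbreviation tensor_d :: "'k::field polyC_weyl" where "tensor_d \<equiv> pure_tensor 1 weyl_d"
abbreviation tensor_t :: "'k::field polyC_weyl" where "tensor_t \<equiv> pure_tensor 1 weyl_t"

lemma abs_polyC_weyl_eqI:
  "p - q \<in> tensor_relations (\<lambda>c. [:c:]) weyl_scalar \<Longrightarrow> abs_polyC_weyl p = abs_polyC_weyl q"
  by (simp add: polyC_weyl.abs_eq_iff ideal_cong_def hull_inc)

lemma pure_tensor_add_left: "pure_tensor (p + q) w = pure_tensor p w + pure_tensor q w"
  unfolding pure_tensor_def plus_polyC_weyl.abs_eq
  by (rule abs_polyC_weyl_eqI) (force simp: tensor_relations_def Let_def diff_diff_eq)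

lemma pure_tensor_add_right: "pure_tensor p (v + w) = pure_tensor p v + pure_tensor p w"
  unfolding pure_tensor_def plus_polyC_weyl.abs_eq
  by (rule abs_polyC_weyl_eqI) (force simp: tensor_relations_def Let_def diff_diff_eq)

lemma pure_tensor_scalar_left:
  "pure_tensor (smult c p) w = abs_polyC_weyl (Poly_Mapping.single (Tensor p w) c)"
  unfolding pure_tensor_def
  by (rule abs_polyC_weyl_eqI) (force simp: tensor_relations_def Let_def)

lemma pure_tensor_scalar_right:
  "pure_tensor p (weyl_scalar c * w) = abs_polyC_weyl (Poly_Mapping.single (Tensor p w) c)"
  unfolding pure_tensor_def
  by (rule abs_polyC_weyl_eqI) (force simp: tensor_relations_def Let_def)

lemma pure_tensor_mult: "pure_tensor p v * pure_tensor q w = pure_tensor (p * q) (v * w)"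
  by (simp add: pure_tensor_def times_polyC_weyl.abs_eq mult_single plus_tensor_symbol_def)

lemma pure_tensor_one: "pure_tensor 1 1 = 1"
  by (simp add: pure_tensor_def one_polyC_weyl.abs_eq flip: single_one zero_tensor_symbol_def)

lemma polyC_weyl_induct [case_names scalar add C d t]:
  fixes a :: "'k::field polyC_weyl"
  assumes "\<And>c. P (tensor_scalar c)" "\<And>a b. P a \<Longrightarrow> P b \<Longrightarrow> P (a + b)"
    "\<And>a. P a \<Longrightarrow> P (tensor_C * a)" "\<And>a. P a \<Longrightarrow> P (tensor_d * a)"
    "\<And>a. P a \<Longrightarrow> P (tensor_t * a)"
  shows "P a"
proof -
  have poly: "P (pure_tensor p 1)" for p
  proof (induction p)
    case 0
    then show ?case using assms(1)[of 0] by simp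
  next
    case (pCons a p)
    have "pure_tensor (pCons a p) 1 = tensor_scalar a + tensor_C * pure_tensor p 1"
      by (simp add: pure_tensor_mult flip: pure_tensor_add_left)
    then show ?case using assms(1-3) pCons.IH by simp
  qed
  have pure: "P (pure_tensor p w)" for p w
  proof (induction w rule: weyl_induct)
    case (scalar c)
    show ?case
      using poly[of "smult c p"] pure_tensor_scalar_right[of p c 1]
      by (simp add: pure_tensor_scalar_left)
  next
    case (add v w)
    then show ?case by (simp add: pure_tensor_add_right assms(2))
  next
    case (d w)
    then show ?case using assms(4)[OF d] by (simp add: pure_tensor_mult)
  next
    case (t w)
    then show ?case using assms(5)[OF t] by (simp add: pure_tensor_mult)
  qed
  show ?thesis
  proof (induction a rule: polyC_weyl.abs_induct)
    fix p :: "('k poly, 'k weyl) tensor_symbol \<Rightarrow>\<^sub>0 'k"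
    show "P (abs_polyC_weyl p)"
    proof (induction p rule: poly_mapping_add_induct)
      case (single m c)
      then show ?case using pure by (cases m) (simp flip: pure_tensor_scalar_left)
    next
      case (add p q)
      show ?case using assms(2)[OF add] by (simp add: plus_polyC_weyl.abs_eq)
    qed
  qed
qed

text \<open>A pure tensor goes to the product of the two images. This is multiplicative because
  \<open>Z\<close> commutes with \<open>D\<close> and \<open>T\<close>, so that the image of
  \<open>\<bbbk>[C]\<close> commutes with that of the Weyl algebra.\<close>

lemma polyC_weyl_hom_exists:
  fixes \<eta> :: "'k::field \<Rightarrow> 'r::{ring, monoid_mult}"
  assumes \<eta>: "unital_ring_hom \<eta>" and comm: "\<And>c a. a \<in> {Z, D, T} \<Longrightarrow> \<eta> c * a = a * \<eta> c"
    and Z: "Z * D = D * Z" "Z * T = T * Z" and rel: "D * T = T * D + 1"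
  obtains F :: "'k polyC_weyl \<Rightarrow> 'r" where "unital_ring_hom F"
    "\<And>p. F (pure_tensor p 1) = poly_eval \<eta> Z p" "F tensor_d = D" "F tensor_t = T"
proof -
  define E where "E = poly_eval \<eta> Z"
  have E: "unital_ring_hom E"
    unfolding E_def by (rule unital_ring_hom_poly_eval[OF \<eta> comm]) simp
  obtain W :: "'k weyl \<Rightarrow> 'r" where W: "unital_ring_hom W" "\<And>c. W (weyl_scalar c) = \<eta> c"
    "W weyl_d = D" "W weyl_t = T"
    using weyl_hom_exists[OF \<eta>, of D T] comm rel by auto
  note WD = unital_ring_homD[OF W(1)] and ED = unital_ring_homD[OF E]
  have \<eta>comm: "\<eta> c * \<eta> d = \<eta> d * \<eta> c" for c d
    using \<eta> by (metis mult.commute unital_ring_homD(6))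
  have W_comm: "z * W w = W w * z" if "z * D = D * z" "z * T = T * z" "\<And>c. z * \<eta> c = \<eta> c * z" for w z
  proof (induction w rule: weyl_induct)
    case (d w)
    then show ?case by (metis that(1) WD(6) W(3) mult.assoc)
  next
    case (t w)
    then show ?case by (metis that(2) WD(6) W(4) mult.assoc)
  qed (simp_all add: W(2) WD that distrib_left distrib_right)
  have EW: "E p * W w = W w * E p" for p w
    unfolding E_def using \<eta> comm Z \<eta>comm
    by (intro poly_eval_commute[symmetric]) (auto intro!: W_comm[symmetric])
  have \<eta>EW: "\<eta> c * (E p * W w) = E p * W w * \<eta> c" for c p w
  proof -
    have "\<eta> c * E p = E p * \<eta> c"
      unfolding E_def using \<eta> comm \<eta>comm by (intro poly_eval_commute) auto
    moreover have "\<eta> c * W w = W w * \<eta> c"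
      using comm \<eta>comm by (intro W_comm) auto
    ultimately show ?thesis by (metis mult.assoc)
  qed
  define L where "L = monoid_algebra_lift \<eta> (\<lambda>m. E (left_factor m) * W (right_factor m))"
  have L: "unital_ring_hom L"
    unfolding L_def
  proof (rule unital_ring_hom_monoid_algebra_lift[OF \<eta> _ _ \<eta>EW])
    fix m n :: "('k poly, 'k weyl) tensor_symbol"
    have "E (left_factor m) * (E (left_factor n) * W (right_factor m)) * W (right_factor n) =
        E (left_factor m) * (W (right_factor m) * E (left_factor n)) * W (right_factor n)"
      by (simp only: EW)
    then show "E (left_factor (m + n)) * W (right_factor (m + n)) =
        E (left_factor m) * W (right_factor m) * (E (left_factor n) * W (right_factor n))"
      by (simp add: plus_tensor_symbol_def ED WD mult.assoc)
  qed (simp add: zero_tensor_symbol_def ED WD)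
  have single: "L (Poly_Mapping.single (Tensor p w) c) = \<eta> c * (E p * W w)" for p w c
    by (simp add: L_def monoid_algebra_lift_single[OF \<eta>])
  have Ec: "E [:c:] = \<eta> c" for c
    unfolding E_def by (rule poly_eval_const[OF \<eta>])
  have Es: "E (smult c p) = \<eta> c * E p" for c p
    using ED(6)[of "[:c:]" p] by (simp add: Ec)
  have \<eta>E: "E p * (\<eta> c * z) = \<eta> c * (E p * z)" for c p z
    using \<eta>EW[of c p 1] by (simp add: WD flip: mult.assoc)
  have "L r = 0" if "r \<in> tensor_relations (\<lambda>c. [:c:]) weyl_scalar" for r
    using that unfolding tensor_relations_def Let_def
    by (auto simp: unital_ring_homD[OF L] single ED WD unital_ring_homD[OF \<eta>] W(2) Es \<eta>E
        distrib_left distrib_right mult.assoc)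
  then have eq: "L p = L q" if "abs_polyC_weyl p = abs_polyC_weyl q" for p q
    using ideal_cong_hom[OF L _ that[unfolded polyC_weyl.abs_eq_iff]] by simp
  define F where "F a = L (rep_polyC_weyl a)" for a
  have F: "F (abs_polyC_weyl p) = L p" for p
    unfolding F_def by (rule eq) (simp add: Quotient3_abs_rep[OF Quotient3_polyC_weyl])
  have F_pure: "F (pure_tensor p w) = E p * W w" for p w
    by (simp add: pure_tensor_def F single unital_ring_homD[OF \<eta>])
  show thesis
  proof
    show "unital_ring_hom F"
      unfolding unital_ring_hom_def
    proof (intro conjI allI)
      show "F 1 = 1" by (simp add: one_polyC_weyl.abs_eq F unital_ring_homD[OF L])
      fix a b :: "'k polyC_weyl"
      obtain p q where [simp]: "a = abs_polyC_weyl p" "b = abs_polyC_weyl q"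
        by (metis Quotient3_abs_rep[OF Quotient3_polyC_weyl])
      show "F (a + b) = F a + F b"
        by (simp add: plus_polyC_weyl.abs_eq F unital_ring_homD[OF L])
      show "F (a * b) = F a * F b"
        by (simp add: times_polyC_weyl.abs_eq F unital_ring_homD[OF L])
    qed
  qed (simp_all add: F_pure ED WD W E_def[symmetric])
qed

lemma tensor_rels:
  "tensor_d * tensor_t = tensor_t * tensor_d + (1 :: 'k::field polyC_weyl)"
  by (simp add: pure_tensor_mult weyl_rel pure_tensor_add_right pure_tensor_one)

lemma commute_mult:
  "z * u = u * z \<Longrightarrow> z * v = v * z \<Longrightarrow> z * (u * v) = u * v * (z :: 'a::semigroup_mult)"
  by (metis mult.assoc)

lemma pure_tensor_1_commute: "pure_tensor p 1 * w = w * pure_tensor p (1 :: 'k::field weyl)"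
  by (induction w rule: polyC_weyl_induct)
     (simp_all add: pure_tensor_mult mult.commute commute_mult distrib_left distrib_right)

lemma unital_ring_hom_pure_tensor_1: "unital_ring_hom (\<lambda>p. pure_tensor p (1 :: 'k::field weyl))"
  by (simp add: unital_ring_hom_def pure_tensor_one pure_tensor_add_left pure_tensor_mult)


section \<open>Two-by-two matrices\<close>

text \<open>On \<open>'d^2^2\<close> the class operation \<open>*\<close> is pointwise. A separate
  type carrying the matrix product as its ring structure makes homomorphisms, ideals, units and
  centres applicable to matrices.\<close>

datatype 'a m2 = M2 (m11: 'a) (m12: 'a) (m21: 'a) (m22: 'a)

instantiation m2 :: (ring_1) ring_1
begin
definition zero_m2 :: "'a m2" where "zero_m2 = M2 0 0 0 0"
definition one_m2 :: "'a m2" where "one_m2 = M2 1 0 0 1"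
definition plus_m2 :: "'a m2 \<Rightarrow> 'a m2 \<Rightarrow> 'a m2" where
  "plus_m2 A B = M2 (m11 A + m11 B) (m12 A + m12 B) (m21 A + m21 B) (m22 A + m22 B)"
definition uminus_m2 :: "'a m2 \<Rightarrow> 'a m2" where
  "uminus_m2 A = M2 (- m11 A) (- m12 A) (- m21 A) (- m22 A)"
definition minus_m2 :: "'a m2 \<Rightarrow> 'a m2 \<Rightarrow> 'a m2" where
  "minus_m2 A B = M2 (m11 A - m11 B) (m12 A - m12 B) (m21 A - m21 B) (m22 A - m22 B)"
definition times_m2 :: "'a m2 \<Rightarrow> 'a m2 \<Rightarrow> 'a m2" where
  "times_m2 A B =
    M2 (m11 A * m11 B + m12 A * m21 B) (m11 A * m12 B + m12 A * m22 B)
       (m21 A * m11 B + m22 A * m21 B) (m21 A * m12 B + m22 A * m22 B)"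
instance
  by standard
    (simp_all add: zero_m2_def one_m2_def plus_m2_def uminus_m2_def minus_m2_def times_m2_def
      algebra_simps)
end

lemma m2_simps [simp]:
  "M2 a b c d + M2 a' b' c' d' = M2 (a + a') (b + b') (c + c') (d + d')"
  "M2 a b c d - M2 a' b' c' d' = M2 (a - a') (b - b') (c - c') (d - d')"
  "- M2 a b c d = M2 (- a) (- b) (- c) (- d)"
  "M2 a b c d * M2 a' b' c' d' =
    M2 (a * a' + b * c') (a * b' + b * d') (c * a' + d * c') (c * b' + d * d')"
  by (simp_all add: plus_m2_def uminus_m2_def minus_m2_def times_m2_def)

lemma m2_sel_simps [simp]:
  "m11 0 = 0" "m12 0 = 0" "m21 0 = 0" "m22 0 = 0"
  "m11 1 = 1" "m12 1 = 0" "m21 1 = 0" "m22 1 = 1"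
  "m11 (A + B) = m11 A + m11 B" "m12 (A + B) = m12 A + m12 B"
  "m21 (A + B) = m21 A + m21 B" "m22 (A + B) = m22 A + m22 B"
  by (simp_all add: zero_m2_def one_m2_def plus_m2_def)

definition scalar_m2 :: "'a::ring_1 \<Rightarrow> 'a m2" where
  "scalar_m2 a = M2 a 0 0 a"

lemma unital_ring_hom_scalar_m2: "unital_ring_hom scalar_m2"
  by (simp add: unital_ring_hom_def scalar_m2_def one_m2_def)

lemma scalar_m2_eq_iff [simp]: "scalar_m2 a = scalar_m2 b \<longleftrightarrow> a = b"
  by (simp add: scalar_m2_def)

lemma two_sided_unit_mult:
  assumes "two_sided_unit (a :: 'a::monoid_mult)" "two_sided_unit b"
  shows "two_sided_unit (a * b)"
proof -
  obtain u v where "a * u = 1" "u * a = 1" "b * v = 1" "v * b = 1"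
    using assms by (auto simp: two_sided_unit_def)
  then have "a * b * (v * u) = 1" "v * u * (a * b) = 1"
    by (metis mult.assoc mult_1_left)+
  then show ?thesis by (auto simp: two_sided_unit_def)
qed

lemma two_sided_unit_hom:
  "unital_ring_hom f \<Longrightarrow> two_sided_unit u \<Longrightarrow> two_sided_unit (f u)"
  unfolding two_sided_unit_def by (metis unital_ring_homD(2,6))

text \<open>Gaussian elimination with pivot \<open>a\<close>: the matrix is lower unitriangular
  times \<open>diag(a, e)\<close> times upper unitriangular, where \<open>e\<close> is the Schur
  complement. If \<open>e = 0\<close>, the row \<open>(- c a', 1)\<close> annihilates the matrix
  from the left.\<close>

lemma m2_unit_or_zero_divisor_aux:
  assumes "skew_field TYPE('d::ring_1)" "a \<noteq> (0::'d)"
  shows "two_sided_unit (M2 a b c d) \<or> (\<exists>N. N \<noteq> 0 \<and> N * M2 a b c d = 0)"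
proof -
  obtain a' where a': "a * a' = 1" "a' * a = 1"
    using assms by (auto simp: skew_field_def two_sided_unit_def)
  define e where "e = d - c * a' * b"
  have a'_assoc: "a * (a' * z) = z" "a' * (a * z) = z" for z
    using a' by (simp_all flip: mult.assoc)
  show ?thesis
  proof (cases "e = 0")
    case True
    have "M2 (- (c * a')) 1 0 0 * M2 a b c d = 0"
      using True by (simp add: zero_m2_def mult.assoc a' e_def)
    moreover have "M2 (- (c * a')) 1 0 0 \<noteq> (0 :: 'd m2)"
      by (simp add: zero_m2_def)
    ultimately show ?thesis by blast
  next
    case False
    then obtain e' where e': "e * e' = 1" "e' * e = 1"
      using assms by (auto simp: skew_field_def two_sided_unit_def)
    have eq: "M2 a b c d = M2 1 0 (c * a') 1 * (M2 a 0 0 e * M2 1 (a' * b) 0 1)"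
      by (simp add: e_def a'_assoc mult.assoc a')
    have "two_sided_unit (M2 1 0 (c * a') 1)" "two_sided_unit (M2 1 (a' * b) 0 1)"
      unfolding two_sided_unit_def one_m2_def
      by (rule exI[of _ "M2 1 0 (- c * a') 1"], simp) (rule exI[of _ "M2 1 (- a' * b) 0 1"], simp)
    moreover have "two_sided_unit (M2 a 0 0 e)"
      unfolding two_sided_unit_def one_m2_def
      by (rule exI[of _ "M2 a' 0 0 e'"]) (simp add: a' e')
    ultimately show ?thesis unfolding eq by (intro disjI1 two_sided_unit_mult)
  qed
qed

text \<open>Swapping rows or columns brings a nonzero entry to the pivot position. The annihilator
  is wanted on the left, where its denominators can later be cleared to contradict the regularity of
  an element.\<close>

lemma m2_unit_or_zero_divisor:
  assumes "skew_field TYPE('d::ring_1)"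
  shows "two_sided_unit (M :: 'd m2) \<or> (\<exists>N. N \<noteq> 0 \<and> N * M = 0)"
proof -
  obtain a b c d where M: "M = M2 a b c d" by (cases M)
  define P :: "'d m2" where "P = M2 0 1 1 0"
  have PP: "P * P = 1" by (simp add: P_def one_m2_def)
  then have P: "two_sided_unit P" unfolding two_sided_unit_def by blast
  have row: "two_sided_unit M \<or> (\<exists>N. N \<noteq> 0 \<and> N * M = 0)"
    if "two_sided_unit (P * M) \<or> (\<exists>N. N \<noteq> 0 \<and> N * (P * M) = 0)" for M
    using that
  proof (elim disjE exE conjE)
    assume "two_sided_unit (P * M)"
    then have "two_sided_unit (P * (P * M))" by (rule two_sided_unit_mult[OF P])
    moreover have "P * (P * M) = M" by (metis PP mult.assoc mult_1_left)
    ultimately show ?thesis by simp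
  next
    fix N assume N: "N \<noteq> 0" "N * (P * M) = 0"
    have "N * P * P = N" using PP by (simp add: mult.assoc)
    then have "N * P \<noteq> 0" using N by auto
    then show ?thesis using N by (metis mult.assoc)
  qed
  have col: "two_sided_unit M \<or> (\<exists>N. N \<noteq> 0 \<and> N * M = 0)"
    if "two_sided_unit (M * P) \<or> (\<exists>N. N \<noteq> 0 \<and> N * (M * P) = 0)" for M
    using that
  proof (elim disjE exE conjE)
    assume "two_sided_unit (M * P)"
    then have "two_sided_unit (M * P * P)" by (rule two_sided_unit_mult[OF _ P])
    then show ?thesis by (simp add: PP mult.assoc)
  next
    fix N assume N: "N \<noteq> 0" "N * (M * P) = 0"
    then have "N * (M * P) * P = 0" by simp
    then have "N * M = 0" by (simp add: PP mult.assoc)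
    then show ?thesis using N by blast
  qed
  note aux = m2_unit_or_zero_divisor_aux[OF assms]
  consider "a \<noteq> 0" | "c \<noteq> 0" | "b \<noteq> 0" | "a = 0" "b = 0" "c = 0" by blast
  then show ?thesis
  proof cases
    case 1
    then show ?thesis unfolding M by (rule aux)
  next
    case 2
    then show ?thesis using row[of M] aux[of c d a b] by (simp add: M P_def)
  next
    case 3
    then show ?thesis using col[of M] aux[of b a d c] by (simp add: M P_def)
  next
    case 4
    have "M2 1 0 0 0 * M = 0" "M2 1 0 0 0 \<noteq> (0 :: 'd m2)"
      unfolding M 4 by (simp_all add: zero_m2_def)
    then show ?thesis by blast
  qed
qed


section \<open>Differential operators over Laurent series\<close>

text \<open>
  \<open>Wop (\<Sum> a\<^sub>i z\<^sup>i)\<close> stands for the operator \<open>\<Sum> a\<^sub>i \<partial>\<^sup>i\<close>. Its action on polynomials in \<open>z\<close>, with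
  \<open>\<partial>\<close> acting as \<open>z + d/dX\<close>, is the regular representation: applied to \<open>1\<close> it returns \<open>\<Sum> a\<^sub>i z\<^sup>i\<close>.
\<close>

typedef (overloaded) 'a wop = "UNIV :: ('a::zero) fls poly set"
  morphisms symbol Wop by simp

lemmas wop_inverse [simp] = symbol_inverse Wop_inverse[OF UNIV_I]

lemma wop_inject [simp]: "Wop p = Wop q \<longleftrightarrow> p = q"
  by (simp add: Wop_inject)

lemma wop_eq_iff: "p = q \<longleftrightarrow> symbol p = symbol q"
  by (simp add: symbol_inject)

definition dz :: "'a::field fls poly \<Rightarrow> 'a fls poly" where
  "dz f = pCons 0 f + map_poly fls_deriv f"

definition wapp :: "'a::field fls poly \<Rightarrow> 'a fls poly \<Rightarrow> 'a fls poly" where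
  "wapp q f = (\<Sum>i\<le>degree q. smult (coeff q i) ((dz ^^ i) f))"

lemma coeff_dz: "coeff (dz f) n = (if n = 0 then 0 else coeff f (n - 1)) + fls_deriv (coeff f n)"
  by (cases n) (simp_all add: dz_def coeff_map_poly)

lemma dz_add: "dz (f + g) = dz f + dz g"
  by (rule poly_eqI) (simp add: coeff_dz)

lemma dz_smult: "dz (smult a f) = smult a (dz f) + smult (fls_deriv a) f"
  by (rule poly_eqI) (simp add: coeff_dz algebra_simps)

lemma dz_pCons: "dz (pCons a q) = pCons (fls_deriv a) ([:a:] + dz q)"
  by (rule poly_eqI) (simp add: coeff_dz coeff_pCons split: nat.split)

lemma dz_monom: "dz (monom 1 n) = monom 1 (Suc n)"
  by (rule poly_eqI) (auto simp: coeff_dz)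

lemma wapp_bound:
  "degree q \<le> n \<Longrightarrow> wapp q f = (\<Sum>i\<le>n. smult (coeff q i) ((dz ^^ i) f))"
  unfolding wapp_def by (rule sum.mono_neutral_left) (auto simp: coeff_eq_0)

lemma wapp_0 [simp]: "wapp 0 f = 0"
  by (simp add: wapp_def)

lemma wapp_pCons: "wapp (pCons a q) f = smult a f + wapp q (dz f)"
proof -
  have "wapp (pCons a q) f = (\<Sum>i\<le>Suc (degree q). smult (coeff (pCons a q) i) ((dz ^^ i) f))"
    by (rule wapp_bound) (rule degree_pCons_le)
  then show ?thesis
    unfolding sum.atMost_Suc_shift by (simp add: wapp_def funpow_swap1)
qed

lemma wapp_add_left: "wapp (p + q) f = wapp p f + wapp q f"
  by (induction p q arbitrary: f rule: poly_induct2) (simp_all add: wapp_pCons smult_add_left)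

lemma dz_0 [simp]: "dz 0 = 0"
  by (simp add: dz_def)

lemma wapp_0_right [simp]: "wapp q 0 = 0"
  by (induction q) (simp_all add: wapp_pCons)

lemma wapp_add_right: "wapp q (f + g) = wapp q f + wapp q g"
  by (induction q arbitrary: f g) (simp_all add: wapp_pCons smult_add_right dz_add)

lemma wapp_smult: "wapp (smult a q) f = smult a (wapp q f)"
  by (induction q arbitrary: f) (simp_all add: wapp_pCons smult_add_right)

text \<open>Associativity for the left factor \<open>\<partial>\<close>: the product rule for the
  coefficients of \<open>q\<close>. Linearity in the left factor then gives the general
  case.\<close>

lemma dz_wapp: "dz (wapp q f) = wapp (dz q) f"
proof (induction q arbitrary: f)
  case 0
  then show ?case by (simp add: dz_def)
next
  case (pCons a q)
  then show ?case
    by (simp add: wapp_pCons dz_pCons dz_add dz_smult wapp_add_left del: add_pCons)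
qed

lemma wapp_assoc: "wapp (wapp p q) f = wapp p (wapp q f)"
  by (induction p arbitrary: q) (simp_all add: wapp_pCons wapp_add_left wapp_smult dz_wapp)

lemma wapp_monom: "wapp q (monom 1 n) = q * monom 1 n"
proof (induction q arbitrary: n)
  case (pCons a q)
  then show ?case
    by (simp add: wapp_pCons dz_monom del: monom_Suc) (simp add: monom_Suc)
qed simp

lemma wapp_one_right: "wapp q 1 = q"
  using wapp_monom[of q 0] by simp

text \<open>The commutator with \<open>X\<close> differentiates the symbol with respect to
  \<open>\<partial>\<close>. The computation of the centre rests on this.\<close>

lemma wapp_X: "wapp q (smult fls_X f) = smult fls_X (wapp q f) + wapp (pderiv q) f"
  by (induction q arbitrary: f)
     (simp_all add: wapp_pCons dz_smult pderiv_pCons wapp_add_left wapp_add_right smult_add_right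
       mult.commute)

text \<open>\<open>dz\<close> multiplies by \<open>z\<close> up to a term of no larger degree, so
  leading terms multiply as for commutative polynomials. Hence operators have no zero divisors and
  degrees add.\<close>

lemma wapp_lead:
  assumes "q \<noteq> 0" "f \<noteq> 0"
  shows "degree (wapp q f) = degree q + degree f \<and>
    coeff (wapp q f) (degree q + degree f) = lead_coeff q * lead_coeff f"
  using assms
proof (induction q arbitrary: f)
  case 0
  then show ?case by simp
next
  case (pCons a q)
  show ?case
  proof (cases "q = 0")
    case True
    then show ?thesis using pCons.hyps by (simp add: wapp_pCons)
  next
    case False
    have c: "coeff (dz f) (Suc (degree f)) = lead_coeff f"
      by (simp add: coeff_dz coeff_eq_0)
    have "degree (dz f) \<le> Suc (degree f)"
      by (rule degree_le) (auto simp: coeff_dz coeff_eq_0)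
    moreover have "Suc (degree f) \<le> degree (dz f)"
      using c pCons.prems by (intro le_degree) simp
    ultimately have d: "degree (dz f) = Suc (degree f)" by simp
    then have nz: "dz f \<noteq> 0" by auto
    note IH = pCons.IH[OF False nz, unfolded d]
    have deg: "degree (smult a f) < degree (wapp q (dz f))"
      using IH degree_smult_le[of a f] by linarith
    show ?thesis
      using IH False c d deg
      by (simp add: wapp_pCons degree_add_eq_right coeff_eq_0 del: degree_smult_eq)
  qed
qed

instantiation wop :: (field) ring_1_no_zero_divisors
begin
definition zero_wop :: "'a wop" where "zero_wop = Wop 0"
definition one_wop :: "'a wop" where "one_wop = Wop 1"
definition plus_wop :: "'a wop \<Rightarrow> 'a wop \<Rightarrow> 'a wop" where
  "plus_wop p q = Wop (symbol p + symbol q)"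
definition uminus_wop :: "'a wop \<Rightarrow> 'a wop" where "uminus_wop p = Wop (- symbol p)"
definition minus_wop :: "'a wop \<Rightarrow> 'a wop \<Rightarrow> 'a wop" where
  "minus_wop p q = Wop (symbol p - symbol q)"
definition times_wop :: "'a wop \<Rightarrow> 'a wop \<Rightarrow> 'a wop" where
  "times_wop p q = Wop (wapp (symbol p) (symbol q))"
instance
proof
  fix a b :: "'a wop"
  assume "a \<noteq> 0" "b \<noteq> 0"
  then have nz: "symbol a \<noteq> 0" "symbol b \<noteq> 0"
    by (metis symbol_inverse zero_wop_def)+
  then have "coeff (wapp (symbol a) (symbol b)) (degree (symbol a) + degree (symbol b)) \<noteq> 0"
    using wapp_lead[OF nz] by simp
  then have "wapp (symbol a) (symbol b) \<noteq> 0" by auto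
  then show "a * b \<noteq> 0" by (simp add: times_wop_def zero_wop_def)
next
  fix a b c :: "'a wop"
  have "wapp 1 f = f" for f :: "'a fls poly"
    by (simp add: wapp_def)
  then show "1 * a = a" by (simp add: times_wop_def one_wop_def)
qed (simp_all add: zero_wop_def one_wop_def plus_wop_def uminus_wop_def minus_wop_def times_wop_def
      wapp_assoc wapp_add_left wapp_add_right wapp_one_right
      wop_eq_iff add.assoc)
end

definition wconst :: "'a::field fls \<Rightarrow> 'a wop" where "wconst a = Wop [:a:]"

definition wd :: "'a::field wop" where "wd = Wop [:0, 1:]"

lemma Wop_add: "Wop p + Wop q = Wop (p + q)"
  by (simp add: plus_wop_def)

lemma wconst_mult_Wop: "wconst a * Wop q = Wop (smult a q)"
  by (simp add: wconst_def times_wop_def wapp_pCons)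

lemma wd_mult_Wop: "wd * Wop q = Wop (dz q)"
  by (simp add: wd_def times_wop_def wapp_pCons)

lemma Wop_mult_wd: "Wop q * wd = Wop (pCons 0 q)"
  using wapp_monom[of q 1] by (simp add: wd_def times_wop_def monom_Suc one_pCons)

lemma Wop_mult_wconst_X: "Wop q * wconst fls_X = Wop (smult fls_X q + pderiv q)"
  using wapp_X[of q 1] by (simp add: wconst_def times_wop_def wapp_one_right)

lemma unital_ring_hom_wconst: "unital_ring_hom wconst"
  unfolding unital_ring_hom_def
  by (auto simp: wconst_def one_wop_def Wop_add wconst_mult_Wop[unfolded wconst_def] pCons_one)

lemma wd_mult_wconst: "wd * wconst a = wconst a * wd + wconst (fls_deriv a)"
  by (simp add: wconst_def wd_mult_Wop Wop_mult_wd Wop_add dz_pCons)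

lemma wconst_eq_0_iff [simp]: "wconst a = 0 \<longleftrightarrow> a = 0"
  by (simp add: wconst_def zero_wop_def)


section \<open>The Weyl algebra as a ring of differential operators\<close>

text \<open>Characteristic zero has to reach \<open>\<bbbk>(C)\<close>, since the derivatives in the
  centre computation act on Laurent series and symbols over that field.\<close>

instance fract :: ("{idom, ring_char_0}") field_char_0
proof
  show "inj (of_nat :: nat \<Rightarrow> 'a fract)"
    by (rule injI) (simp add: of_nat_fract eq_fract)
qed

definition wfun :: "'k::field poly \<Rightarrow> 'k poly fract wop" where
  "wfun p = wconst (fls_const (to_fract p))"

lemma unital_ring_hom_wfun: "unital_ring_hom wfun"
proof -
  have "unital_ring_hom (\<lambda>p. fls_const (to_fract p :: 'k::field poly fract))"
    by (simp add: unital_ring_hom_def fls_plus_const fls_const_mult_const)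
  then show ?thesis
    unfolding wfun_def by (rule unital_ring_hom_comp[OF unital_ring_hom_wconst])
qed

lemma wfun_eq_iff [simp]: "wfun p = wfun q \<longleftrightarrow> p = q"
proof -
  have "fls_const c = fls_const d \<longleftrightarrow> c = d" for c d :: "'a poly fract"
    by (metis fls_const_nth)
  then show ?thesis by (simp add: wfun_def wconst_def)
qed

lemma wfun_commute: "wfun p * a = a * wfun p"
proof (cases a)
  case (Wop q)
  let ?k = "fls_const (to_fract p)"
  have "wapp q (smult ?k f) = smult ?k (wapp q f)" for f
    by (induction q arbitrary: f) (simp_all add: wapp_pCons dz_smult smult_add_right mult.commute)
  from this[of 1] show ?thesis
    by (simp add: Wop wfun_def wconst_mult_Wop) (simp add: wconst_def times_wop_def wapp_one_right)
qed

lemma unital_ring_hom_const_poly: "unital_ring_hom (\<lambda>c. [:c::'k::comm_ring_1:])"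
  by (simp add: unital_ring_hom_def pCons_one)

lemma poly_eval_const_poly: "poly_eval (\<lambda>c. [:c:]) [:0, 1:] p = p"
  by (induction p) (simp_all add: poly_eval_0 poly_eval_pCons unital_ring_hom_const_poly)

lemma weyl_op_exists:
  "\<exists>F :: 'k::field polyC_weyl \<Rightarrow> 'k poly fract wop. unital_ring_hom F \<and>
    (\<forall>p. F (pure_tensor p 1) = wfun p) \<and> F tensor_d = wd \<and> F tensor_t = wconst fls_X"
proof -
  let ?\<eta> = "\<lambda>c::'k. wfun [:c:]"
  have \<eta>: "unital_ring_hom ?\<eta>"
    by (intro unital_ring_hom_comp[OF unital_ring_hom_wfun] unital_ring_hom_const_poly)
  have rel: "wd * wconst fls_X = wconst fls_X * wd + (1 :: 'k poly fract wop)"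
    by (simp add: wd_mult_wconst unital_ring_homD[OF unital_ring_hom_wconst])
  obtain F :: "'k polyC_weyl \<Rightarrow> 'k poly fract wop" where F: "unital_ring_hom F"
    "\<And>p. F (pure_tensor p 1) = poly_eval ?\<eta> (wfun [:0, 1:]) p"
    "F tensor_d = wd" "F tensor_t = wconst fls_X"
    by (rule polyC_weyl_hom_exists[OF \<eta> _ wfun_commute wfun_commute rel])
       (use wfun_commute in blast)+
  have "wfun p = poly_eval ?\<eta> (wfun [:0, 1:]) p" for p :: "'k poly"
    using hom_poly_eval[OF unital_ring_hom_wfun unital_ring_hom_const_poly, of "[:0, 1:]" p]
    by (simp add: poly_eval_const_poly)
  then show ?thesis using F by metis
qed

definition weyl_op :: "'k::field polyC_weyl \<Rightarrow> 'k poly fract wop" where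
  "weyl_op = (SOME F. unital_ring_hom F \<and>
    (\<forall>p. F (pure_tensor p 1) = wfun p) \<and> F tensor_d = wd \<and> F tensor_t = wconst fls_X)"

lemma unital_ring_hom_weyl_op: "unital_ring_hom weyl_op"
  and weyl_op_simps [simp]: "weyl_op (pure_tensor p 1) = wfun p" "weyl_op tensor_d = wd"
    "weyl_op tensor_t = wconst fls_X"
  using someI_ex[OF weyl_op_exists] unfolding weyl_op_def by blast+

section \<open>Normal forms in \<open>\<bbbk>[C] \<otimes> A_1\<close>\<close>

definition tensor_poly2 :: "'k::field poly poly \<Rightarrow> 'k polyC_weyl" where
  "tensor_poly2 = poly_eval (\<lambda>p. pure_tensor p 1) tensor_t"

text \<open>Normal forms with \<open>C\<close>, then \<open>t\<close>, then
  \<open>\<partial>\<close> on the right. The map is additive but not multiplicative; it is shown to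
  be onto by commuting \<open>\<partial>\<close> to the right, and normal forms are separated by
  symbols afterwards.\<close>

definition tensor_poly3 :: "'k::field poly poly poly \<Rightarrow> 'k polyC_weyl" where
  "tensor_poly3 = poly_eval tensor_poly2 tensor_d"

lemma unital_ring_hom_tensor_poly2: "unital_ring_hom tensor_poly2"
  unfolding tensor_poly2_def
  by (intro unital_ring_hom_poly_eval unital_ring_hom_pure_tensor_1 pure_tensor_1_commute)

lemma tensor_poly2_pCons:
  "tensor_poly2 (pCons a p) = pure_tensor a 1 + tensor_poly2 p * tensor_t"
  by (simp add: tensor_poly2_def poly_eval_pCons unital_ring_hom_pure_tensor_1)

lemma tensor_poly3_pCons:
  "tensor_poly3 (pCons a p) = tensor_poly2 a + tensor_poly3 p * tensor_d"
  by (simp add: tensor_poly3_def poly_eval_pCons unital_ring_hom_tensor_poly2)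

lemma tensor_poly3_add: "tensor_poly3 (p + q) = tensor_poly3 p + tensor_poly3 q"
  by (simp add: tensor_poly3_def poly_eval_add unital_ring_hom_tensor_poly2)

lemma tensor_poly3_0 [simp]: "tensor_poly3 0 = 0"
  by (simp add: tensor_poly3_def poly_eval_0 unital_ring_hom_tensor_poly2)

lemma tensor_poly3_smult: "tensor_poly3 (smult a q) = tensor_poly2 a * tensor_poly3 q"
  by (simp add: tensor_poly3_def poly_eval_smult unital_ring_hom_tensor_poly2)

lemma tensor_d_mult_poly2:
  "tensor_d * tensor_poly2 p = tensor_poly2 p * tensor_d + tensor_poly2 (pderiv p)"
proof (induction p)
  case 0
  then show ?case by (simp add: unital_ring_homD[OF unital_ring_hom_tensor_poly2])
next
  case (pCons a p)
  have "tensor_d * (tensor_poly2 p * tensor_t) =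
      (tensor_poly2 p * tensor_d + tensor_poly2 (pderiv p)) * tensor_t"
    by (simp add: pCons.IH flip: mult.assoc)
  also have "\<dots> = tensor_poly2 p * (tensor_d * tensor_t) + tensor_poly2 (pderiv p) * tensor_t"
    by (simp add: distrib_right mult.assoc)
  also have "\<dots> = tensor_poly2 p * tensor_t * tensor_d + tensor_poly2 p +
      tensor_poly2 (pderiv p) * tensor_t"
    by (simp only: tensor_rels distrib_left mult.assoc mult_1_right)
  finally show ?case
    using pure_tensor_1_commute[of a tensor_d]
    by (simp add: tensor_poly2_pCons pderiv_pCons distrib_left distrib_right add_ac
        unital_ring_homD[OF unital_ring_hom_tensor_poly2] unital_ring_homD[OF unital_ring_hom_pure_tensor_1])
qed

lemma tensor_d_mult_poly3: "\<exists>r. tensor_d * tensor_poly3 q = tensor_poly3 r"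
proof (induction q)
  case 0
  show ?case by (rule exI[of _ 0]) simp
next
  case (pCons a q)
  then obtain r where r: "tensor_d * tensor_poly3 q = tensor_poly3 r" by blast
  have "tensor_d * tensor_poly3 (pCons a q) =
      tensor_poly2 a * tensor_d + tensor_poly2 (pderiv a) + tensor_d * tensor_poly3 q * tensor_d"
    by (simp add: tensor_poly3_pCons distrib_left tensor_d_mult_poly2 mult.assoc)
  \<comment> \<open>This is the recursion of \<open>dz_pCons\<close> with \<open>pderiv\<close> in
    place of \<open>fls_deriv\<close>.\<close>
  also have "\<dots> = tensor_poly3 (pCons (pderiv a) ([:a:] + r))"
    by (simp add: r tensor_poly3_pCons tensor_poly3_add distrib_right add_ac del: add_pCons)
  finally show ?case by blast
qed

lemma surj_tensor_poly3: "\<exists>q. w = tensor_poly3 q"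
proof (induction w rule: polyC_weyl_induct)
  case (scalar c)
  have "tensor_scalar c = tensor_poly3 [:[:[:c:]:]:]"
    by (simp add: tensor_poly3_pCons tensor_poly2_pCons
        unital_ring_homD[OF unital_ring_hom_tensor_poly2])
  then show ?case by blast
next
  case (add v w)
  then show ?case by (metis tensor_poly3_add)
next
  case (C w)
  then obtain q where "w = tensor_poly3 q" by blast
  then have "tensor_C * w = tensor_poly3 (smult [:[:0, 1:]:] q)"
    by (simp add: tensor_poly3_smult tensor_poly2_pCons
        unital_ring_homD[OF unital_ring_hom_tensor_poly2])
  then show ?case by blast
next
  case (d w)
  then show ?case using tensor_d_mult_poly3 by metis
next
  case (t w)
  then obtain q where "w = tensor_poly3 q" by blast
  then have "tensor_t * w = tensor_poly3 (smult [:0, 1:] q)"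
    by (simp add: tensor_poly3_smult tensor_poly2_pCons pure_tensor_one
        unital_ring_homD[OF unital_ring_hom_tensor_poly2] unital_ring_homD[OF unital_ring_hom_pure_tensor_1])
  then show ?case by blast
qed

definition fls_poly2 :: "'k::field poly poly \<Rightarrow> 'k poly fract fls" where
  "fls_poly2 = poly_eval (\<lambda>p. fls_const (to_fract p)) fls_X"

lemma unital_ring_hom_fls_const_to_fract:
  "unital_ring_hom (\<lambda>p :: 'k::field poly. fls_const (to_fract p))"
  by (simp add: unital_ring_hom_def fls_plus_const fls_const_mult_const)

lemma unital_ring_hom_fls_poly2: "unital_ring_hom fls_poly2"
  unfolding fls_poly2_def
  by (intro unital_ring_hom_poly_eval unital_ring_hom_fls_const_to_fract) (simp add: mult.commute)

lemma fls_poly2_pCons: "fls_poly2 (pCons a p) = fls_const (to_fract a) + fls_poly2 p * fls_X"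
  by (simp add: fls_poly2_def poly_eval_pCons unital_ring_hom_fls_const_to_fract)

lemma fls_nth_poly2: "fls_nth (fls_poly2 p) n = (if n < 0 then 0 else to_fract (coeff p (nat n)))"
proof (induction p arbitrary: n)
  case 0
  then show ?case by (simp add: unital_ring_homD[OF unital_ring_hom_fls_poly2])
next
  case (pCons a p)
  show ?case
    by (cases "nat n") (auto simp: fls_poly2_pCons fls_X_times_conv_shift pCons.IH coeff_pCons nat_diff_distrib split: nat.split)
qed

lemma fls_poly2_eq_0_iff [simp]: "fls_poly2 p = 0 \<longleftrightarrow> p = 0"
proof
  assume "fls_poly2 p = 0"
  then have "coeff p n = 0" for n
    using fls_nth_poly2[of p "int n"] by simp
  then show "p = 0" by (simp add: poly_eqI)
qed (simp add: unital_ring_homD[OF unital_ring_hom_fls_poly2])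

lemma weyl_op_tensor_poly3: "weyl_op (tensor_poly3 q) = Wop (map_poly fls_poly2 q)"
proof -
  have 2: "weyl_op (tensor_poly2 p) = wconst (fls_poly2 p)" for p :: "'a poly poly"
    by (induction p)
       (simp_all add: tensor_poly2_pCons fls_poly2_pCons wfun_def
         unital_ring_homD[OF unital_ring_hom_tensor_poly2] unital_ring_homD[OF unital_ring_hom_weyl_op]
         unital_ring_homD[OF unital_ring_hom_wconst] unital_ring_homD[OF unital_ring_hom_fls_poly2])
  show ?thesis
  proof (induction q)
    case 0
    then show ?case
      by (simp add: unital_ring_homD[OF unital_ring_hom_weyl_op] zero_wop_def)
  next
    case (pCons a q)
    then show ?case
      by (simp add: tensor_poly3_pCons unital_ring_homD[OF unital_ring_hom_weyl_op] 2
          map_poly_pCons wconst_def Wop_mult_wd Wop_add)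
  qed
qed

text \<open>The symbol of a normal form is that normal form itself, its coefficients being embedded
  from \<open>\<bbbk>[C][t]\<close> into \<open>\<bbbk>(C)((X))\<close>. So the image determines all
  coefficients, and the absence of zero divisors is inherited from the operators.\<close>

lemma weyl_op_eq_0_iff [simp]: "weyl_op w = 0 \<longleftrightarrow> w = 0"
proof
  assume "weyl_op w = 0"
  obtain q where q: "w = tensor_poly3 q" using surj_tensor_poly3 by blast
  have "map_poly fls_poly2 q = 0"
    using \<open>weyl_op w = 0\<close> by (simp add: q weyl_op_tensor_poly3 zero_wop_def)
  then have "fls_poly2 (coeff q n) = 0" for n
    by (metis coeff_0 coeff_map_poly fls_poly2_eq_0_iff)
  then have "q = 0" by (simp add: poly_eqI)
  then show "w = 0" by (simp add: q)
qed (simp add: unital_ring_homD[OF unital_ring_hom_weyl_op])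

instance polyC_weyl :: (field) ring_1_no_zero_divisors
proof
  note hom = unital_ring_homD[OF unital_ring_hom_weyl_op]
  have "weyl_op (1 :: 'a polyC_weyl) \<noteq> 0" by (simp add: hom del: weyl_op_eq_0_iff)
  then show "(0 :: 'a polyC_weyl) \<noteq> 1" by simp
  fix a b :: "'a polyC_weyl"
  assume "a \<noteq> 0" "b \<noteq> 0"
  then have "weyl_op (a * b) \<noteq> 0" by (simp add: hom del: weyl_op_eq_0_iff) simp
  then show "a * b \<noteq> 0" by simp
qed

lemma regular_polyC_weyl: "w \<noteq> 0 \<Longrightarrow> regular (w :: 'k::field polyC_weyl)"
  by (simp add: regular_def)


section \<open>The matrix representation of the bosonization\<close>

text \<open>The image of \<open>y^2\<close> is \<open>diag(t \<partial> t, t^2 \<partial>)\<close>,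
  whose entries differ by \<open>t\<close>; subtracting \<open>x y\<close>, which maps to
  \<open>diag(t, 0)\<close>, makes it scalar.\<close>

definition sjp_tau :: "'k::field sjp" where
  "sjp_tau = sjp_y * sjp_y - sjp_x * sjp_y"

text \<open>Instantiated twice: with the differential operators, where faithfulness is computed, and
  with an arbitrary quotient ring, where the theorem takes place. The inverses are parameters
  because the target is merely a ring.\<close>

locale weyl_ext =
  fixes om :: "'k::field polyC_weyl \<Rightarrow> 'r::ring_1" and t' C' :: 'r
  assumes hom: "unital_ring_hom om"
    and t': "om tensor_t * t' = 1" "t' * om tensor_t = 1"
    and C': "om tensor_C * C' = 1" "C' * om tensor_C = 1"
begin

abbreviation "t \<equiv> om tensor_t"
abbreviation "d \<equiv> om tensor_d"
abbreviation "C \<equiv> om tensor_C"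

lemmas om = unital_ring_homD[OF hom]

lemma d_t: "d * t = t * d + 1" "d * (t * z) = t * (d * z) + z"
proof -
  show "d * t = t * d + 1" by (simp add: tensor_rels flip: om)
  then have "d * t * z = (t * d + 1) * z" by simp
  then show "d * (t * z) = t * (d * z) + z" by (simp add: distrib_right mult.assoc)
qed

lemma pure_commute: "om (pure_tensor p 1) * om w = om w * om (pure_tensor p 1)"
  by (simp add: pure_tensor_1_commute flip: om)

lemma inverse_commute:
  assumes "u * v = 1" "v * u = 1" "u * z = z * u"
  shows "v * z = z * (v :: 'r)"
  by (metis assms mult.assoc mult_1_left mult_1_right)

lemma C'_commute: "C' * om w = om w * C'"
  by (rule inverse_commute[OF C' pure_commute])

lemma t'_pure_commute: "t' * om (pure_tensor p 1) = om (pure_tensor p 1) * t'"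
  by (rule inverse_commute[OF t' pure_commute[symmetric]])

lemma C'_t': "C' * t' = t' * C'"
  by (rule inverse_commute[OF C']) (rule t'_pure_commute[symmetric])

lemma move_right:
  "a * b = b * a \<Longrightarrow> a * (b * z) = b * (a * (z::'r))"
  by (simp flip: mult.assoc)

lemma cancel_left: "a * b = 1 \<Longrightarrow> a * (b * z) = (z::'r)"
  by (simp flip: mult.assoc)

text \<open>As rewrite rules these move the central \<open>C\<close> and \<open>C'\<close> to the
  left and \<open>d\<close> to the right of \<open>t\<close>, and cancel inverse pairs. Each rule
  also appears with a tail, since products are nested to the right.\<close>

lemmas normal_order = mult.assoc d_t t' C' cancel_left[OF t'(1)] cancel_left[OF t'(2)]
  cancel_left[OF C'(1)] cancel_left[OF C'(2)]
  C'_commute[of tensor_t, symmetric] C'_commute[of tensor_d, symmetric]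
  move_right[OF C'_commute[of tensor_t, symmetric]] move_right[OF C'_commute[of tensor_d, symmetric]]
  C'_t'[symmetric] move_right[OF C'_t'[symmetric]]
  pure_commute[of _ tensor_t, symmetric] move_right[OF pure_commute[of _ tensor_t, symmetric]]
  pure_commute[of _ tensor_d, symmetric] move_right[OF pure_commute[of _ tensor_d, symmetric]]
  t'_pure_commute move_right[OF t'_pure_commute]

lemma psi_exists:
  "\<exists>F :: 'k sjp \<Rightarrow> 'r m2. unital_ring_hom F \<and>
    (\<forall>c. F (sjp_scalar c) = scalar_m2 (om (tensor_scalar c))) \<and>
    F sjp_x = M2 0 1 0 0 \<and> F sjp_y = M2 0 (t * d) t 0 \<and>
    F sjp_g = M2 (- (C' * t)) 0 0 (C' * t) \<and> F sjp_ginv = M2 (- (C * t')) 0 0 (C * t')"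
proof -
  let ?\<eta> = "\<lambda>c. scalar_m2 (om (tensor_scalar c))"
  let ?X = "M2 0 1 0 0 :: 'r m2" and ?Y = "M2 0 (t * d) t 0"
    and ?G = "M2 (- (C' * t)) 0 0 (C' * t)" and ?H = "M2 (- (C * t')) 0 0 (C * t')"
  have \<eta>: "unital_ring_hom ?\<eta>"
    by (intro unital_ring_hom_comp[OF unital_ring_hom_scalar_m2] unital_ring_hom_comp[OF hom]
        unital_ring_hom_comp[OF unital_ring_hom_pure_tensor_1] unital_ring_hom_const_poly)
  have comm: "?\<eta> c * a = a * ?\<eta> c" if "a \<in> {?X, ?Y, ?G, ?H}" for c a
  proof -
    let ?S = "om (tensor_scalar c)"
    have "?S * t = t * ?S" "?S * d = d * ?S" "?S * C = C * ?S" "?S * t' = t' * ?S" "?S * C' = C' * ?S"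
      by (rule pure_commute t'_pure_commute[symmetric] C'_commute[symmetric])+
    then show ?thesis using that by (auto simp: scalar_m2_def commute_mult[where z = ?S])
  qed
  have rel: "?X * ?X = 0"
    "?Y * (?X * ?Y + ?Y * ?X) = (?X * ?Y + ?Y * ?X) * ?Y + ?X * (?X * ?Y + ?Y * ?X)"
    "?G * ?H = 1" "?H * ?G = 1" "?G * ?X = - ?X * ?G" "?G * ?Y = (- ?Y + ?X) * ?G"
    by (simp_all add: zero_m2_def one_m2_def normal_order algebra_simps)
  obtain F :: "'k sjp \<Rightarrow> 'r m2" where "unital_ring_hom F" "\<And>c. F (sjp_scalar c) = ?\<eta> c"
    "F sjp_x = ?X" "F sjp_y = ?Y" "F sjp_g = ?G" "F sjp_ginv = ?H"
    by (rule sjp_hom_exists[OF \<eta> comm rel]) blast+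
  then show ?thesis by blast
qed

definition psi :: "'k sjp \<Rightarrow> 'r m2" where
  "psi = (SOME F. unital_ring_hom F \<and>
    (\<forall>c. F (sjp_scalar c) = scalar_m2 (om (tensor_scalar c))) \<and>
    F sjp_x = M2 0 1 0 0 \<and> F sjp_y = M2 0 (t * d) t 0 \<and>
    F sjp_g = M2 (- (C' * t)) 0 0 (C' * t) \<and> F sjp_ginv = M2 (- (C * t')) 0 0 (C * t'))"

lemma unital_ring_hom_psi: "unital_ring_hom psi"
  and psi_gens: "psi (sjp_scalar c) = scalar_m2 (om (tensor_scalar c))"
    "psi sjp_x = M2 0 1 0 0" "psi sjp_y = M2 0 (t * d) t 0"
    "psi sjp_g = M2 (- (C' * t)) 0 0 (C' * t)" "psi sjp_ginv = M2 (- (C * t')) 0 0 (C * t')"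
  using someI_ex[OF psi_exists] unfolding psi_def by blast+

lemmas psi = unital_ring_homD[OF unital_ring_hom_psi]

lemma psi_s: "psi sjp_s = scalar_m2 t"
  by (simp add: sjp_s_def psi psi_gens scalar_m2_def)

lemma psi_tau: "psi sjp_tau = scalar_m2 (t * t * d)"
  by (simp add: sjp_tau_def psi psi_gens scalar_m2_def normal_order distrib_left)

text \<open>Two signs cancel: \<open>2 y x - s\<close> maps to \<open>diag(- t, t)\<close>, and
  \<open>sjp_ginv\<close> to \<open>diag(- C t', C t')\<close>.\<close>

lemma psi_C: "psi sjp_C = scalar_m2 C"
proof -
  have "psi (2 * sjp_y * sjp_x - sjp_s) = M2 (- t) 0 0 t"
    by (simp add: psi psi_gens psi_s scalar_m2_def distrib_right flip: one_add_one)
  then show ?thesis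
    by (simp add: sjp_C_def psi psi_gens scalar_m2_def normal_order)
qed

lemma psi_eval_C: "psi (eval_C p) = scalar_m2 (om (pure_tensor p 1))"
proof -
  have "psi (eval_C p) =
      poly_eval (\<lambda>c. scalar_m2 (om (tensor_scalar c))) (scalar_m2 C) p"
    using hom_poly_eval[OF unital_ring_hom_psi unital_ring_hom_sjp_scalar]
    by (simp add: eval_C_eq_poly_eval psi_gens psi_C)
  also have "\<dots> = scalar_m2 (om (pure_tensor (poly_eval (\<lambda>c. [:c:]) [:0, 1:] p) 1))"
    by (rule hom_poly_eval[symmetric, OF _ unital_ring_hom_const_poly])
       (intro unital_ring_hom_comp[OF unital_ring_hom_scalar_m2] unital_ring_hom_comp[OF hom]
         unital_ring_hom_pure_tensor_1)
  finally show ?thesis by (simp only: poly_eval_const_poly)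
qed

end


section \<open>Normal forms in the bosonization\<close>

text \<open>A rewrite system sorting words into the order \<open>x\<close>, \<open>s\<close>,
  \<open>y\<close>, \<open>g\<close>, with \<open>s\<close> kept as a symbol of its own. Each rule
  also appears with a tail \<open>z\<close>.\<close>

lemma sjp_normal_order:
  "sjp_x * sjp_x = (0 :: 'k::field sjp)" "sjp_x * (sjp_x * z) = (0 :: 'k sjp)"
  "sjp_y * sjp_x = sjp_s - sjp_x * (sjp_y :: 'k sjp)"
  "sjp_y * (sjp_x * z) = sjp_s * z - sjp_x * (sjp_y * z)"
  "sjp_y * sjp_s = sjp_s * sjp_y + sjp_x * (sjp_s :: 'k sjp)"
  "sjp_y * (sjp_s * z) = sjp_s * (sjp_y * z) + sjp_x * (sjp_s * z)"
  "sjp_s * sjp_x = sjp_x * (sjp_s :: 'k sjp)" "sjp_s * (sjp_x * z) = sjp_x * (sjp_s * z)"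
  "sjp_g * sjp_x = - (sjp_x * (sjp_g :: 'k sjp))" "sjp_g * (sjp_x * z) = - (sjp_x * (sjp_g * z))"
  "sjp_g * sjp_y = - (sjp_y * sjp_g) + sjp_x * (sjp_g :: 'k sjp)"
  "sjp_g * (sjp_y * z) = - (sjp_y * (sjp_g * z)) + sjp_x * (sjp_g * z)"
  "sjp_g * sjp_s = sjp_s * (sjp_g :: 'k sjp)" "sjp_g * (sjp_s * z) = sjp_s * (sjp_g * z)"
proof -
  have assoc: "a * (b * z) = c * z" if "a * b = c" for a b c z :: "'k sjp"
    using that by (simp flip: mult.assoc)
  note rels = sjp_rels[where 'a = 'k]
  show 1: "sjp_x * sjp_x = (0 :: 'k sjp)" by (rule rels(1))
  have 2: "sjp_x * (sjp_x * z) = (0 :: 'k sjp)" for z using assoc[OF 1] by simp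
  show "sjp_x * (sjp_x * z) = (0 :: 'k sjp)" by (rule 2)
  show 3: "sjp_y * sjp_x = sjp_s - sjp_x * (sjp_y :: 'k sjp)" by (simp add: sjp_s_def)
  show "sjp_y * (sjp_x * z) = sjp_s * z - sjp_x * (sjp_y * z)"
    using assoc[OF 3] by (simp add: left_diff_distrib mult.assoc)
  show 5: "sjp_y * sjp_s = sjp_s * sjp_y + sjp_x * (sjp_s :: 'k sjp)" by (rule rels(2))
  show "sjp_y * (sjp_s * z) = sjp_s * (sjp_y * z) + sjp_x * (sjp_s * z)"
    using assoc[OF 5] by (simp add: distrib_right mult.assoc)
  \<comment> \<open>Both sides equal \<open>x y x\<close>, because \<open>x^2 = 0\<close>.\<close>
  show 7: "sjp_s * sjp_x = sjp_x * (sjp_s :: 'k sjp)"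
    by (simp add: sjp_s_def distrib_left distrib_right mult.assoc 1 2)
  show "sjp_s * (sjp_x * z) = sjp_x * (sjp_s * z)"
    using assoc[OF 7] by (simp add: mult.assoc)
  show 9: "sjp_g * sjp_x = - (sjp_x * (sjp_g :: 'k sjp))" using rels(5) by simp
  have 10: "sjp_g * (sjp_x * z) = - (sjp_x * (sjp_g * z))" for z :: "'k sjp"
    using assoc[OF 9] by (simp add: mult.assoc)
  show "sjp_g * (sjp_x * z) = - (sjp_x * (sjp_g * z))" by (rule 10)
  show 11: "sjp_g * sjp_y = - (sjp_y * sjp_g) + sjp_x * (sjp_g :: 'k sjp)"
    using rels(6) by (simp add: distrib_right left_diff_distrib)
  have 12: "sjp_g * (sjp_y * z) = - (sjp_y * (sjp_g * z)) + sjp_x * (sjp_g * z)" for z :: "'k sjp"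
    using assoc[OF 11] by (simp add: distrib_right left_diff_distrib mult.assoc)
  show "sjp_g * (sjp_y * z) = - (sjp_y * (sjp_g * z)) + sjp_x * (sjp_g * z)" by (rule 12)
  show 13: "sjp_g * sjp_s = sjp_s * (sjp_g :: 'k sjp)"
    by (simp add: sjp_s_def distrib_left distrib_right right_diff_distrib mult.assoc 9 10 11 12 1 2)
  show "sjp_g * (sjp_s * z) = sjp_s * (sjp_g * z)"
    using assoc[OF 13] by (simp add: mult.assoc)
qed

lemma sjp_tau_rels:
  "sjp_x * sjp_tau = sjp_tau * (sjp_x :: 'k::field sjp)"
  "sjp_y * sjp_tau = sjp_tau * sjp_y - sjp_s * sjp_y + sjp_tau * sjp_x + sjp_tau * (sjp_x :: 'k sjp)"
  "sjp_tau * sjp_s = sjp_s * sjp_tau + sjp_s * (sjp_s :: 'k sjp)"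
  "sjp_tau * sjp_g = sjp_g * sjp_tau + sjp_s * (sjp_g :: 'k sjp)"
  "sjp_y * (sjp_x * sjp_y) = sjp_s * sjp_y - sjp_tau * (sjp_x :: 'k sjp)"
  "sjp_y * sjp_y = sjp_tau + sjp_x * (sjp_y :: 'k sjp)"
  by (simp_all add: sjp_tau_def algebra_simps sjp_normal_order)

text \<open>The representation maps this subalgebra to diagonal matrices.\<close>

inductive_set sjp_diag :: "'k::field sjp set" where
  scalar: "sjp_scalar c \<in> sjp_diag"
| add: "a \<in> sjp_diag \<Longrightarrow> b \<in> sjp_diag \<Longrightarrow> a + b \<in> sjp_diag"
| g: "a \<in> sjp_diag \<Longrightarrow> sjp_g * a \<in> sjp_diag"
| s: "a \<in> sjp_diag \<Longrightarrow> sjp_s * a \<in> sjp_diag"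
| tau: "a \<in> sjp_diag \<Longrightarrow> sjp_tau * a \<in> sjp_diag"

lemma sjp_scalar_mult_diag: "a \<in> sjp_diag \<Longrightarrow> sjp_scalar c * a \<in> sjp_diag"
proof (induction rule: sjp_diag.induct)
  case (scalar b)
  have "sjp_scalar c * sjp_scalar b = sjp_scalar (c * b)"
    by (simp add: unital_ring_homD[OF unital_ring_hom_sjp_scalar])
  then show ?case by (simp add: sjp_diag.scalar)
next
  case (add a b)
  then show ?case by (simp add: distrib_left sjp_diag.add)
qed (metis mult.assoc sjp_scalar_commute sjp_diag.intros)+

lemma sjp_diag_mult: "a \<in> sjp_diag \<Longrightarrow> b \<in> sjp_diag \<Longrightarrow> a * b \<in> sjp_diag"
  by (induction rule: sjp_diag.induct)
     (simp_all add: sjp_scalar_mult_diag distrib_right mult.assoc sjp_diag.intros)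

lemma sjp_scalar_1 [simp]: "sjp_scalar 1 = 1" and sjp_scalar_0 [simp]: "sjp_scalar 0 = 0"
  by (simp_all add: unital_ring_homD[OF unital_ring_hom_sjp_scalar])

lemma sjp_diag_0: "0 \<in> sjp_diag" and sjp_diag_1: "1 \<in> sjp_diag"
  using sjp_diag.scalar[of 0] sjp_diag.scalar[of 1] by simp_all

lemma sjp_diag_gens: "sjp_g \<in> sjp_diag" "sjp_s \<in> sjp_diag" "sjp_tau \<in> sjp_diag"
  using sjp_diag.intros(3-)[OF sjp_diag_1] by simp_all

lemma sjp_diag_uminus: "a \<in> sjp_diag \<Longrightarrow> - a \<in> sjp_diag"
  using sjp_scalar_mult_diag[of a "- 1"]
  by (simp add: unital_ring_homD(5)[OF unital_ring_hom_sjp_scalar])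

lemma sjp_diag_diff: "a \<in> sjp_diag \<Longrightarrow> b \<in> sjp_diag \<Longrightarrow> a - b \<in> sjp_diag"
  using sjp_diag.add[of a "- b"] by (simp add: sjp_diag_uminus)

lemmas sjp_diag_closed = sjp_diag.intros sjp_diag_mult sjp_diag_uminus sjp_diag_diff sjp_diag_0
  sjp_diag_1 sjp_diag_gens

lemma sjp_x_mult_diag: "v \<in> sjp_diag \<Longrightarrow> \<exists>v'\<in>sjp_diag. sjp_x * v = v' * sjp_x"
proof (induction rule: sjp_diag.induct)
  case (scalar c)
  then show ?case by (metis sjp_scalar_commute sjp_diag.scalar)
next
  case (add a b)
  then show ?case by (metis distrib_left distrib_right sjp_diag.add)
next
  case (g v)
  then obtain v' where v': "v' \<in> sjp_diag" "sjp_x * v = v' * sjp_x" by blast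
  have "sjp_x * (sjp_g * v) = - (sjp_g * (sjp_x * v))"
    by (simp add: sjp_normal_order)
  then have "sjp_x * (sjp_g * v) = - (sjp_g * v') * sjp_x"
    by (simp add: v' mult.assoc)
  then show ?case using v' by (blast intro: sjp_diag_closed)
next
  case (s v)
  then obtain v' where v': "v' \<in> sjp_diag" "sjp_x * v = v' * sjp_x" by blast
  have "sjp_x * (sjp_s * v) = sjp_s * (sjp_x * v)"
    by (simp add: sjp_normal_order)
  then have "sjp_x * (sjp_s * v) = (sjp_s * v') * sjp_x"
    by (simp add: v' mult.assoc)
  then show ?case using v' by (blast intro: sjp_diag_closed)
next
  case (tau v)
  then obtain v' where v': "v' \<in> sjp_diag" "sjp_x * v = v' * sjp_x" by blast
  have "sjp_x * (sjp_tau * v) = sjp_tau * (sjp_x * v)"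
    by (simp add: sjp_tau_rels flip: mult.assoc)
  then have "sjp_x * (sjp_tau * v) = (sjp_tau * v') * sjp_x"
    by (simp add: v' mult.assoc)
  then show ?case using v' by (blast intro: sjp_diag_closed)
qed

text \<open>Moving \<open>y\<close> past \<open>g\<close>, \<open>s\<close> or \<open>\<tau>\<close>
  leaves a correction ending in \<open>x\<close>; hence the coefficient passes to the left only
  modulo a term \<open>p * sjp_x\<close>.\<close>

lemma sjp_y_mult_diag:
  "v \<in> sjp_diag \<Longrightarrow> \<exists>p\<in>sjp_diag. \<exists>q\<in>sjp_diag. sjp_y * v = p * sjp_x + q * sjp_y"
proof (induction rule: sjp_diag.induct)
  case (scalar c)
  have "sjp_y * sjp_scalar c = 0 * sjp_x + sjp_scalar c * sjp_y"
    by (simp add: sjp_scalar_commute)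
  then show ?case by (blast intro: sjp_diag_closed)
next
  case (add a b)
  then obtain p q p' q' where pq: "p \<in> sjp_diag" "q \<in> sjp_diag" "p' \<in> sjp_diag" "q' \<in> sjp_diag"
    "sjp_y * a = p * sjp_x + q * sjp_y" "sjp_y * b = p' * sjp_x + q' * sjp_y" by blast
  then have "sjp_y * (a + b) = (p + p') * sjp_x + (q + q') * sjp_y"
    by (simp add: distrib_left distrib_right)
  then show ?case using pq by (blast intro: sjp_diag_closed)
next
  case (g v)
  then obtain p q r where v': "r \<in> sjp_diag" "p \<in> sjp_diag" "q \<in> sjp_diag" "sjp_x * v = r * sjp_x"
    "sjp_y * v = p * sjp_x + q * sjp_y" using sjp_x_mult_diag by blast
  have "sjp_y * (sjp_g * v) = - (sjp_g * (sjp_y * v)) - sjp_g * (sjp_x * v)"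
    by (simp add: sjp_normal_order)
  then have "sjp_y * (sjp_g * v) = (- (sjp_g * p) - sjp_g * r) * sjp_x + - (sjp_g * q) * sjp_y"
    by (simp add: v' algebra_simps)
  then show ?case using v' by (blast intro: sjp_diag_closed)
next
  case (s v)
  then obtain p q r where v': "r \<in> sjp_diag" "p \<in> sjp_diag" "q \<in> sjp_diag" "sjp_x * v = r * sjp_x"
    "sjp_y * v = p * sjp_x + q * sjp_y" using sjp_x_mult_diag by blast
  have "sjp_y * (sjp_s * v) = sjp_s * (sjp_y * v) + sjp_s * (sjp_x * v)"
    by (simp add: sjp_normal_order)
  then have "sjp_y * (sjp_s * v) = (sjp_s * p + sjp_s * r) * sjp_x + (sjp_s * q) * sjp_y"
    by (simp add: v' algebra_simps)
  then show ?case using v' by (blast intro: sjp_diag_closed)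
next
  case (tau v)
  then obtain p q r where v': "r \<in> sjp_diag" "p \<in> sjp_diag" "q \<in> sjp_diag" "sjp_x * v = r * sjp_x"
    "sjp_y * v = p * sjp_x + q * sjp_y" using sjp_x_mult_diag by blast
  have "sjp_y * (sjp_tau * v) = (sjp_tau - sjp_s) * (sjp_y * v) + (sjp_tau + sjp_tau) * (sjp_x * v)"
    using sjp_tau_rels(2)[where 'k = 'a] by (simp add: distrib_right left_diff_distrib flip: mult.assoc)
  then have "sjp_y * (sjp_tau * v) =
      ((sjp_tau - sjp_s) * p + (sjp_tau + sjp_tau) * r) * sjp_x + ((sjp_tau - sjp_s) * q) * sjp_y"
    by (simp add: v' distrib_left distrib_right mult.assoc)
  then show ?case using v' by (blast intro: sjp_diag_closed)
qed

text \<open>The left \<open>sjp_diag\<close>-module spanned by \<open>1\<close>, \<open>x\<close>,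
  \<open>y\<close> and \<open>x y\<close>. Coefficients contain no \<open>g^-1\<close>, so that they
  stay polynomial and can be compared degree by degree.\<close>

definition sjp_nf :: "'k::field sjp set" where
  "sjp_nf = {v0 + v1 * sjp_x + v2 * sjp_y + v3 * (sjp_x * sjp_y) | v0 v1 v2 v3.
     v0 \<in> sjp_diag \<and> v1 \<in> sjp_diag \<and> v2 \<in> sjp_diag \<and> v3 \<in> sjp_diag}"

lemma sjp_nfI:
  "a = v0 + v1 * sjp_x + v2 * sjp_y + v3 * (sjp_x * sjp_y) \<Longrightarrow> v0 \<in> sjp_diag \<Longrightarrow>
    v1 \<in> sjp_diag \<Longrightarrow> v2 \<in> sjp_diag \<Longrightarrow> v3 \<in> sjp_diag \<Longrightarrow> a \<in> sjp_nf"
  unfolding sjp_nf_def by blast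

lemma sjp_nfE:
  assumes "a \<in> sjp_nf"
  obtains v0 v1 v2 v3 where "a = v0 + v1 * sjp_x + v2 * sjp_y + v3 * (sjp_x * sjp_y)"
    "v0 \<in> sjp_diag" "v1 \<in> sjp_diag" "v2 \<in> sjp_diag" "v3 \<in> sjp_diag"
  using assms unfolding sjp_nf_def by blast

lemma sjp_nf_add: "a \<in> sjp_nf \<Longrightarrow> b \<in> sjp_nf \<Longrightarrow> a + b \<in> sjp_nf"
proof (elim sjp_nfE)
  fix v0 v1 v2 v3 w0 w1 w2 w3 :: "'a sjp"
  assume "a = v0 + v1 * sjp_x + v2 * sjp_y + v3 * (sjp_x * sjp_y)"
    "b = w0 + w1 * sjp_x + w2 * sjp_y + w3 * (sjp_x * sjp_y)"
  then have "a + b = (v0 + w0) + (v1 + w1) * sjp_x + (v2 + w2) * sjp_y + (v3 + w3) * (sjp_x * sjp_y)"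
    by (simp add: distrib_right add_ac)
  moreover assume "v0 \<in> sjp_diag" "v1 \<in> sjp_diag" "v2 \<in> sjp_diag" "v3 \<in> sjp_diag"
    "w0 \<in> sjp_diag" "w1 \<in> sjp_diag" "w2 \<in> sjp_diag" "w3 \<in> sjp_diag"
  ultimately show ?thesis by (blast intro: sjp_nfI sjp_diag_closed)
qed

lemma sjp_nf_diag_mult:
  assumes "d \<in> sjp_diag" "a \<in> sjp_nf"
  shows "d * a \<in> sjp_nf"
  using assms(2)
proof (rule sjp_nfE)
  fix v0 v1 v2 v3 :: "'a sjp"
  assume "a = v0 + v1 * sjp_x + v2 * sjp_y + v3 * (sjp_x * sjp_y)"
  then have "d * a = d * v0 + (d * v1) * sjp_x + (d * v2) * sjp_y + (d * v3) * (sjp_x * sjp_y)"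
    by (simp add: distrib_left mult.assoc)
  moreover assume "v0 \<in> sjp_diag" "v1 \<in> sjp_diag" "v2 \<in> sjp_diag" "v3 \<in> sjp_diag"
  ultimately show ?thesis using assms(1) by (blast intro: sjp_nfI sjp_diag_closed)
qed

lemma sjp_nf_x_mult:
  assumes "a \<in> sjp_nf"
  shows "sjp_x * a \<in> sjp_nf"
  using assms
proof (rule sjp_nfE)
  fix v0 v1 v2 v3 :: "'a sjp"
  assume a: "a = v0 + v1 * sjp_x + v2 * sjp_y + v3 * (sjp_x * sjp_y)"
    and v: "v0 \<in> sjp_diag" "v1 \<in> sjp_diag" "v2 \<in> sjp_diag" "v3 \<in> sjp_diag"
  obtain w0 w1 w2 w3 where w: "w0 \<in> sjp_diag" "w1 \<in> sjp_diag" "w2 \<in> sjp_diag" "w3 \<in> sjp_diag"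
    "sjp_x * v0 = w0 * sjp_x" "sjp_x * v1 = w1 * sjp_x" "sjp_x * v2 = w2 * sjp_x"
    "sjp_x * v3 = w3 * sjp_x"
    using sjp_x_mult_diag v by meson
  have "sjp_x * a = sjp_x * v0 + (sjp_x * v1) * sjp_x + (sjp_x * v2) * sjp_y + (sjp_x * v3) * (sjp_x * sjp_y)"
    unfolding a by (simp add: distrib_left mult.assoc)
  also have "\<dots> = 0 + w0 * sjp_x + 0 * sjp_y + w2 * (sjp_x * sjp_y)"
    unfolding w by (simp add: mult.assoc sjp_normal_order)
  finally show ?thesis using w by (blast intro: sjp_nfI sjp_diag_closed)
qed

lemma sjp_nf_y_mult:
  assumes "a \<in> sjp_nf"
  shows "sjp_y * a \<in> sjp_nf"
  using assms
proof (rule sjp_nfE)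
  fix v0 v1 v2 v3 :: "'a sjp"
  assume a: "a = v0 + v1 * sjp_x + v2 * sjp_y + v3 * (sjp_x * sjp_y)"
    and v: "v0 \<in> sjp_diag" "v1 \<in> sjp_diag" "v2 \<in> sjp_diag" "v3 \<in> sjp_diag"
  obtain p0 q0 where w0: "p0 \<in> sjp_diag" "q0 \<in> sjp_diag" "sjp_y * v0 = p0 * sjp_x + q0 * sjp_y"
    using sjp_y_mult_diag[OF v(1)] by blast
  obtain p1 q1 where w1: "p1 \<in> sjp_diag" "q1 \<in> sjp_diag" "sjp_y * v1 = p1 * sjp_x + q1 * sjp_y"
    using sjp_y_mult_diag[OF v(2)] by blast
  obtain p2 q2 where w2: "p2 \<in> sjp_diag" "q2 \<in> sjp_diag" "sjp_y * v2 = p2 * sjp_x + q2 * sjp_y"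
    using sjp_y_mult_diag[OF v(3)] by blast
  obtain p3 q3 where w3: "p3 \<in> sjp_diag" "q3 \<in> sjp_diag" "sjp_y * v3 = p3 * sjp_x + q3 * sjp_y"
    using sjp_y_mult_diag[OF v(4)] by blast
  note w = w0 w1 w2 w3
  have "sjp_y * a = sjp_y * v0 + (sjp_y * v1) * sjp_x + (sjp_y * v2) * sjp_y + (sjp_y * v3) * (sjp_x * sjp_y)"
    unfolding a by (simp add: distrib_left mult.assoc)
  \<comment> \<open>The products outside the span are reduced by \<open>y x = s - x y\<close>,
    \<open>y y = \<tau> + x y\<close> and \<open>y x y = s y - \<tau> x\<close>.\<close>
  also have "\<dots> = (q1 * sjp_s + q2 * sjp_tau) + (p0 - q3 * sjp_tau) * sjp_x + (q0 + q3 * sjp_s) * sjp_y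
      + (p2 + q2 - q1) * (sjp_x * sjp_y)"
    unfolding w
    by (simp add: distrib_left distrib_right left_diff_distrib right_diff_distrib mult.assoc
        sjp_normal_order(1-3) sjp_tau_rels(5,6))
  finally show ?thesis using w by (blast intro: sjp_nfI sjp_diag_closed)
qed

lemma sjp_g_power_mult_nf: "a \<in> sjp_nf \<Longrightarrow> sjp_g ^ n * a \<in> sjp_nf"
  by (induction n) (simp_all add: mult.assoc sjp_nf_diag_mult sjp_diag_closed)

text \<open>\<open>g^n x = \<plusminus> x g^n\<close>. The induction moves one factor
  \<open>g\<close> at a time into \<open>a\<close>, so the sign \<open>(-1)^n\<close> never has to
  be written.\<close>

lemma sjp_g_power_x_nf: "sjp_g ^ n * a \<in> sjp_nf \<Longrightarrow> sjp_g ^ n * (sjp_x * a) \<in> sjp_nf"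
proof (induction n arbitrary: a)
  case 0
  then show ?case by (simp add: sjp_nf_x_mult)
next
  case (Suc n)
  have "sjp_g ^ n * (sjp_g * a) \<in> sjp_nf"
    using Suc.prems by (simp only: power_Suc2 mult.assoc)
  note Suc.IH[OF this]
  then have "(- 1) * (sjp_g ^ n * (sjp_x * (sjp_g * a))) \<in> sjp_nf"
    by (rule sjp_nf_diag_mult[rotated]) (intro sjp_diag_closed)
  then show ?case
    by (simp add: power_Suc2 mult.assoc sjp_normal_order del: power_Suc)
qed

lemma sjp_g_power_y_nf: "sjp_g ^ n * a \<in> sjp_nf \<Longrightarrow> sjp_g ^ n * (sjp_y * a) \<in> sjp_nf"
proof (induction n arbitrary: a)
  case 0
  then show ?case by (simp add: sjp_nf_y_mult)
next
  case (Suc n)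
  have *: "sjp_g ^ n * (sjp_g * a) \<in> sjp_nf"
    using Suc.prems by (simp only: power_Suc2 mult.assoc)
  have "(- 1) * (sjp_g ^ n * (sjp_y * (sjp_g * a))) + sjp_g ^ n * (sjp_x * (sjp_g * a)) \<in> sjp_nf"
    by (intro sjp_nf_add sjp_nf_diag_mult[of "- 1"] sjp_g_power_x_nf Suc.IH * sjp_diag_uminus
        sjp_diag_1)
  then show ?case
    by (simp add: power_Suc2 mult.assoc sjp_normal_order distrib_left right_diff_distrib del: power_Suc)
qed

text \<open>Only left multiplication by \<open>sjp_ginv\<close> leads outside the normal forms, and
  one more power of \<open>g\<close> absorbs it. As \<open>g\<close> is a unit, the factor loses no
  information.\<close>

lemma sjp_g_power_mult_in_nf: "\<exists>n. sjp_g ^ n * a \<in> sjp_nf"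
proof (induction a rule: sjp_induct)
  case (scalar c)
  have "sjp_scalar c \<in> sjp_nf"
    by (rule sjp_nfI[of _ "sjp_scalar c" 0 0 0]) (simp_all add: sjp_diag_closed)
  then have "sjp_g ^ 0 * sjp_scalar c \<in> sjp_nf" by simp
  then show ?case by blast
next
  case (add a b)
  then obtain m n where "sjp_g ^ m * a \<in> sjp_nf" "sjp_g ^ n * b \<in> sjp_nf" by blast
  then have "sjp_g ^ n * (sjp_g ^ m * a) + sjp_g ^ m * (sjp_g ^ n * b) \<in> sjp_nf"
    by (rule sjp_nf_add[OF sjp_g_power_mult_nf sjp_g_power_mult_nf])
  moreover have "sjp_g ^ n * (sjp_g ^ m * a) + sjp_g ^ m * (sjp_g ^ n * b) = sjp_g ^ (m + n) * (a + b)"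
    by (metis add.commute distrib_left mult.assoc power_add)
  ultimately have "sjp_g ^ (m + n) * (a + b) \<in> sjp_nf" by simp
  then show ?case by blast
next
  case (x a)
  then show ?case using sjp_g_power_x_nf by blast
next
  case (y a)
  then show ?case using sjp_g_power_y_nf by blast
next
  case (g a)
  then obtain n where "sjp_g ^ n * a \<in> sjp_nf" by blast
  then have "sjp_g * (sjp_g ^ n * a) \<in> sjp_nf" by (rule sjp_nf_diag_mult[OF sjp_diag_gens(1)])
  moreover have "sjp_g * (sjp_g ^ n * a) = sjp_g ^ n * (sjp_g * a)"
    by (simp add: power_commutes flip: mult.assoc)
  ultimately show ?case by auto
next
  case (ginv a)
  then obtain n where n: "sjp_g ^ n * a \<in> sjp_nf" by blast
  have "sjp_g ^ Suc n * (sjp_ginv * a) = sjp_g ^ n * (sjp_g * sjp_ginv * a)"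
    by (simp only: power_Suc2 mult.assoc)
  then show ?case using n by (metis mult_1_left sjp_rels(3))
qed


section \<open>Faithfulness of the representation by differential operators\<close>

definition s_poly :: "'k::field poly \<Rightarrow> 'k sjp" where
  "s_poly = poly_eval sjp_scalar sjp_s"

definition gs_poly :: "'k::field poly poly \<Rightarrow> 'k sjp" where
  "gs_poly = poly_eval s_poly sjp_g"

text \<open>\<open>s\<close> and \<open>g\<close> commute, so \<open>gs_poly\<close> is a ring
  homomorphism; \<open>\<tau>\<close> commutes with neither, so this outer map is treated as
  additive and linear over coefficients on the left.\<close>

definition diag_poly :: "'k::field poly poly poly \<Rightarrow> 'k sjp" where
  "diag_poly = poly_eval gs_poly sjp_tau"

lemma unital_ring_hom_s_poly: "unital_ring_hom s_poly"
  unfolding s_poly_def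
  by (intro unital_ring_hom_poly_eval unital_ring_hom_sjp_scalar sjp_scalar_commute)

lemma s_poly_commute: "z * sjp_s = sjp_s * z \<Longrightarrow> z * s_poly u = s_poly u * z"
  unfolding s_poly_def
  by (rule poly_eval_commute) (simp_all add: unital_ring_hom_sjp_scalar sjp_scalar_commute)

lemma unital_ring_hom_gs_poly: "unital_ring_hom gs_poly"
  unfolding gs_poly_def
  by (intro unital_ring_hom_poly_eval unital_ring_hom_s_poly s_poly_commute[symmetric])
     (simp add: sjp_normal_order)

lemma s_poly_pCons: "s_poly (pCons c u) = sjp_scalar c + s_poly u * sjp_s"
  by (simp add: s_poly_def poly_eval_pCons unital_ring_hom_sjp_scalar)

lemma gs_poly_pCons: "gs_poly (pCons u p) = s_poly u + gs_poly p * sjp_g"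
  by (simp add: gs_poly_def poly_eval_pCons unital_ring_hom_s_poly)

lemma diag_poly_pCons: "diag_poly (pCons p q) = gs_poly p + diag_poly q * sjp_tau"
  by (simp add: diag_poly_def poly_eval_pCons unital_ring_hom_gs_poly)

lemmas s_poly = unital_ring_homD[OF unital_ring_hom_s_poly]
lemmas gs_poly = unital_ring_homD[OF unital_ring_hom_gs_poly]

lemma diag_poly_0 [simp]: "diag_poly 0 = 0"
  by (simp add: diag_poly_def poly_eval_0 unital_ring_hom_gs_poly)

lemma diag_poly_add: "diag_poly (p + q) = diag_poly p + diag_poly q"
  by (simp add: diag_poly_def poly_eval_add unital_ring_hom_gs_poly)

lemma diag_poly_smult: "diag_poly (smult a q) = gs_poly a * diag_poly q"
  by (simp add: diag_poly_def poly_eval_smult unital_ring_hom_gs_poly)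

lemma gs_poly_s: "gs_poly [:[:0, 1:]:] = sjp_s" and gs_poly_g: "gs_poly [:0, 1:] = sjp_g"
  by (simp_all add: gs_poly_pCons s_poly_pCons s_poly gs_poly)

text \<open>The commutator with \<open>\<tau>\<close> is a derivation with
  \<open>s \<mapsto> s^2\<close> and \<open>g \<mapsto> s g\<close>, hence preserves the polynomials
  in \<open>g\<close> and \<open>s\<close>.\<close>

lemma tau_mult_gs_poly: "\<exists>p'. sjp_tau * gs_poly p = gs_poly p * sjp_tau + gs_poly p'"
proof (induction p)
  case 0
  show ?case by (rule exI[of _ 0]) (simp add: gs_poly)
next
  case (pCons u p)
  have u: "\<exists>u'. sjp_tau * s_poly u = s_poly u * sjp_tau + s_poly u'"
  proof (induction u)
    case 0
    show ?case by (rule exI[of _ 0]) (simp add: s_poly)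
  next
    case (pCons c u)
    then obtain u' where u': "sjp_tau * s_poly u = s_poly u * sjp_tau + s_poly u'" by blast
    have "sjp_tau * s_poly (pCons c u) = sjp_tau * sjp_scalar c + sjp_tau * s_poly u * sjp_s"
      by (simp add: s_poly_pCons distrib_left mult.assoc)
    also have "\<dots> = s_poly (pCons c u) * sjp_tau + (s_poly u * sjp_s * sjp_s + s_poly u' * sjp_s)"
      by (simp add: u' s_poly_pCons distrib_left distrib_right mult.assoc sjp_tau_rels
          sjp_scalar_commute)
    also have "s_poly u * sjp_s * sjp_s + s_poly u' * sjp_s = s_poly (pCons 0 (pCons 0 u + u'))"
      by (simp add: s_poly_pCons s_poly distrib_right del: add_pCons)
    finally show ?case by blast
  qed
  then obtain u' where u': "sjp_tau * s_poly u = s_poly u * sjp_tau + s_poly u'" by blast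
  obtain p' where p': "sjp_tau * gs_poly p = gs_poly p * sjp_tau + gs_poly p'"
    using pCons.IH by blast
  have "sjp_tau * gs_poly (pCons u p) = sjp_tau * s_poly u + sjp_tau * gs_poly p * sjp_g"
    by (simp add: gs_poly_pCons distrib_left mult.assoc)
  also have "\<dots> = gs_poly (pCons u p) * sjp_tau +
      (s_poly u' + (gs_poly p * sjp_s + gs_poly p') * sjp_g)"
    by (simp add: u' p' gs_poly_pCons distrib_left distrib_right mult.assoc sjp_tau_rels)
  also have "s_poly u' + (gs_poly p * sjp_s + gs_poly p') * sjp_g =
      gs_poly (pCons u' (p * [:[:0, 1:]:] + p'))"
    by (simp only: gs_poly_pCons[of u'] gs_poly(3,6) gs_poly_s)
  finally show ?case by blast
qed

lemma sjp_diag_subset: "v \<in> sjp_diag \<Longrightarrow> \<exists>p. v = diag_poly p"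
proof (induction rule: sjp_diag.induct)
  case (scalar c)
  have "sjp_scalar c = diag_poly [:[:[:c:]:]:]"
    by (simp add: diag_poly_pCons gs_poly_pCons s_poly_pCons s_poly gs_poly)
  then show ?case by blast
next
  case (add a b)
  then show ?case by (metis diag_poly_add)
next
  case (g a)
  then show ?case by (metis diag_poly_smult gs_poly_g)
next
  case (s a)
  then show ?case by (metis diag_poly_smult gs_poly_s)
next
  case (tau a)
  have "\<exists>q. sjp_tau * diag_poly p = diag_poly q" for p :: "'a poly poly poly"
  proof (induction p)
    case 0
    show ?case by (rule exI[of _ 0]) simp
  next
    case (pCons u p)
    obtain q where q: "sjp_tau * diag_poly p = diag_poly q" using pCons.IH by blast
    obtain u' where u': "sjp_tau * gs_poly u = gs_poly u * sjp_tau + gs_poly u'"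
      using tau_mult_gs_poly by blast
    have "sjp_tau * diag_poly (pCons u p) = sjp_tau * gs_poly u + sjp_tau * diag_poly p * sjp_tau"
      by (simp add: diag_poly_pCons distrib_left mult.assoc)
    also have "\<dots> = diag_poly (pCons u' ([:u:] + q))"
      by (simp add: q u' diag_poly_pCons diag_poly_add distrib_right add_ac del: add_pCons)
    finally show ?case by blast
  qed
  then show ?case using tau by blast
qed

section \<open>Polynomials in \<open>g\<close> and \<open>s\<close> as Laurent series\<close>

definition fls_s :: "'k::field poly \<Rightarrow> 'k poly fract fls" where
  "fls_s = poly_eval (\<lambda>c. fls_const (to_fract [:c:])) fls_X"

text \<open>One diagonal entry of the representation: \<open>s\<close> becomes \<open>X\<close> and
  \<open>g\<close> becomes \<open>e C^-1 X\<close>, where \<open>e = - 1\<close> gives the upper and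
  \<open>e = 1\<close> the lower entry.\<close>

definition fls_gs :: "'k::field \<Rightarrow> 'k poly poly \<Rightarrow> 'k poly fract fls" where
  "fls_gs e = poly_eval fls_s (fls_const (to_fract [:e:] / to_fract [:0, 1:]) * fls_X)"

lemma unital_ring_hom_fls_scalar:
  "unital_ring_hom (\<lambda>c :: 'k::field. fls_const (to_fract [:c:]))"
  by (rule unital_ring_hom_comp[OF unital_ring_hom_fls_const_to_fract unital_ring_hom_const_poly])

lemma unital_ring_hom_fls_s: "unital_ring_hom fls_s"
  unfolding fls_s_def
  by (intro unital_ring_hom_poly_eval unital_ring_hom_fls_scalar) (simp add: mult.commute)

lemma unital_ring_hom_fls_gs: "unital_ring_hom (fls_gs e)"
  unfolding fls_gs_def
  by (intro unital_ring_hom_poly_eval unital_ring_hom_fls_s) (simp add: mult.commute)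

lemmas fls_s = unital_ring_homD[OF unital_ring_hom_fls_s]
lemmas fls_gs = unital_ring_homD[OF unital_ring_hom_fls_gs]

lemma fls_s_pCons: "fls_s (pCons c u) = fls_const (to_fract [:c:]) + fls_s u * fls_X"
  unfolding fls_s_def by (rule poly_eval_pCons[OF unital_ring_hom_fls_scalar])

lemma fls_gs_pCons:
  "fls_gs e (pCons u p) =
    fls_s u + fls_gs e p * (fls_const (to_fract [:e:] / to_fract [:0, 1:]) * fls_X)"
  unfolding fls_gs_def by (rule poly_eval_pCons[OF unital_ring_hom_fls_s])

lemma fls_nth_s: "fls_nth (fls_s u) n = (if n < 0 then 0 else to_fract [:coeff u (nat n):])"
proof (induction u arbitrary: n)
  case 0
  then show ?case by (simp add: fls_s)
next
  case (pCons c u)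
  show ?case
    by (cases "nat n")
       (auto simp: fls_s_pCons fls_X_times_conv_shift pCons.IH coeff_pCons nat_diff_distrib
         split: nat.split)
qed

lemma fls_nth_gs_pCons:
  "fls_nth (fls_gs e (pCons u p)) n =
    fls_nth (fls_s u) n + to_fract [:e:] / to_fract [:0, 1:] * fls_nth (fls_gs e p) (n - 1)"
proof -
  have "fls_gs e p * (fls_const k * fls_X) = fls_const k * fls_shift (- 1) (fls_gs e p)" for k
    by (simp add: mult_ac flip: fls_X_times_conv_shift(1))
  then show ?thesis unfolding fls_gs_pCons by (simp only: fls_plus_nth fls_mult_const_nth) simp
qed

lemma fls_nth_gs_neg: "n < 0 \<Longrightarrow> fls_nth (fls_gs e p) n = 0"
  by (induction p arbitrary: n) (simp_all add: fls_gs fls_nth_gs_pCons fls_nth_s)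

text \<open>
  The coefficient of \<open>X\<^sup>n\<close> is a polynomial in \<open>C\<^sup>-\<^sup>1\<close> of degree at most \<open>n\<close>; multiplied by
  \<open>C\<^sup>n\<close> it becomes a polynomial in \<open>C\<close> from which all coefficients of \<open>p\<close> can be read off.
\<close>
lemma fls_nth_gs:
  "\<exists>P. fls_nth (fls_gs e p) (int n) * to_fract [:0, 1:] ^ n = to_fract P \<and>
    (\<forall>m. coeff P m = (if m \<le> n then e ^ (n - m) * coeff (coeff p (n - m)) m else 0))"
proof (induction p arbitrary: n)
  case 0
  show ?case by (rule exI[of _ 0]) (simp add: fls_gs)
next
  case (pCons u p)
  let ?C = "to_fract [:0, 1:] :: 'a poly fract"
  have hom: "unital_ring_hom (to_fract :: 'a poly \<Rightarrow> _)"
    by (simp add: unital_ring_hom_def)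
  have monom: "to_fract [:c:] * ?C ^ k = to_fract (monom c k)" for c k
    by (simp add: monom_altdef flip: unital_ring_hom_power[OF hom] to_fract_mult)
  show ?case
  proof (cases n)
    case 0
    show ?thesis
      by (rule exI[of _ "[:coeff u 0:]"])
         (simp add: 0 fls_nth_gs_pCons fls_nth_s fls_nth_gs_neg coeff_pCons split: nat.split)
  next
    case (Suc k)
    obtain P where P: "fls_nth (fls_gs e p) (int k) * ?C ^ k = to_fract P"
      "\<And>m. coeff P m = (if m \<le> k then e ^ (k - m) * coeff (coeff p (k - m)) m else 0)"
      using pCons.IH[of k] by blast
    let ?Q = "monom (coeff u n) n + smult e P"
    have "fls_nth (fls_gs e (pCons u p)) (int n) * ?C ^ n =
        to_fract [:coeff u n:] * ?C ^ n +
        to_fract [:e:] / ?C * fls_nth (fls_gs e p) (int k) * ?C ^ n"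
      by (simp add: Suc fls_nth_gs_pCons fls_nth_s nat_add_distrib distrib_right)
    also have "to_fract [:e:] / ?C * fls_nth (fls_gs e p) (int k) * ?C ^ n =
        to_fract [:e:] * (fls_nth (fls_gs e p) (int k) * ?C ^ k)"
      by (simp add: Suc)
    also have "to_fract [:coeff u n:] * ?C ^ n + \<dots> = to_fract ?Q"
      by (simp add: P(1) monom flip: to_fract_mult)
    finally have "fls_nth (fls_gs e (pCons u p)) (int n) * ?C ^ n = to_fract ?Q" .
    moreover have "coeff ?Q m =
        (if m \<le> n then e ^ (n - m) * coeff (coeff (pCons u p) (n - m)) m else 0)" for m
      by (auto simp: Suc P(2) Suc_diff_le not_less_eq_eq le_Suc_eq)
    ultimately show ?thesis by blast
  qed
qed

text \<open>\<open>g^d s^m\<close> becomes \<open>e^d C^-d X^(d+m)\<close>. Monomials of equal total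
  degree share the power of \<open>X\<close> and are separated by \<open>C\<close>: after
  multiplication by \<open>C^(d+m)\<close>, this one sits at \<open>C^m\<close>.\<close>

lemma fls_gs_eq_0_iff:
  assumes "e \<noteq> 0"
  shows "fls_gs e p = 0 \<longleftrightarrow> p = 0"
proof
  assume 0: "fls_gs e p = 0"
  have "coeff (coeff p d) m = 0" for d m
  proof -
    obtain P where P: "fls_nth (fls_gs e p) (int (d + m)) * to_fract [:0, 1:] ^ (d + m) = to_fract P"
      "\<And>i. coeff P i = (if i \<le> d + m then e ^ (d + m - i) * coeff (coeff p (d + m - i)) i else 0)"
      using fls_nth_gs by blast
    have "P = 0" using P(1) by (simp add: 0)
    then show ?thesis using P(2)[of m] assms by simp
  qed
  then show "p = 0" by (intro poly_eqI) simp
qed (simp add: fls_gs)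

text \<open>Right multiplication by an operator of order one raises the order by exactly one, so the
  constant added at each step of the recursion cannot cancel the leading term.\<close>

lemma poly_eval_wop_degree:
  fixes T :: "'a::field wop" and h :: "'c::comm_ring_1 \<Rightarrow> 'a fls"
  assumes T: "degree (symbol T) = 1" and h: "unital_ring_hom h" "\<And>c. h c = 0 \<longleftrightarrow> c = 0"
    and "p \<noteq> 0"
  shows "symbol (poly_eval (\<lambda>c. wconst (h c)) T p) \<noteq> 0 \<and>
    degree (symbol (poly_eval (\<lambda>c. wconst (h c)) T p)) = degree p"
  using \<open>p \<noteq> 0\<close>
proof (induction p)
  case 0
  then show ?case by simp
next
  case (pCons c p)
  let ?E = "poly_eval (\<lambda>c. wconst (h c)) T"
  have hom: "unital_ring_hom (\<lambda>c. wconst (h c))"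
    by (rule unital_ring_hom_comp[OF unital_ring_hom_wconst h(1)])
  show ?case
  proof (cases "p = 0")
    case True
    then show ?thesis using pCons.hyps h(2)
      by (simp add: poly_eval_const[OF hom]) (simp add: wconst_def)
  next
    case False
    have sym: "symbol (?E (pCons c p)) = [:h c:] + wapp (symbol (?E p)) (symbol T)"
      by (simp add: poly_eval_pCons[OF hom]) (simp add: wconst_def plus_wop_def times_wop_def)
    have "degree (wapp (symbol (?E p)) (symbol T)) = Suc (degree p)"
      using wapp_lead[of "symbol (?E p)" "symbol T"] pCons.IH[OF False] T by fastforce
    then have "degree (symbol (?E (pCons c p))) = Suc (degree p)"
      unfolding sym by (subst degree_add_eq_right) simp_all
    then show ?thesis using False by auto
  qed
qed

section \<open>The representation over differential operators\<close>

interpretation W: weyl_ext "weyl_op :: 'k::field polyC_weyl \<Rightarrow> _" "wconst (inverse fls_X)"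
  "wconst (fls_const (inverse (to_fract [:0, 1:])))"
proof
  note wc = unital_ring_homD[OF unital_ring_hom_wconst]
  show "unital_ring_hom (weyl_op :: 'k polyC_weyl \<Rightarrow> _)" by (rule unital_ring_hom_weyl_op)
  have X: "fls_X * inverse fls_X = (1 :: 'k poly fract fls)" by simp
  have C: "fls_const (to_fract [:0, 1:]) * fls_const (inverse (to_fract [:0, 1:])) =
      (1 :: 'k poly fract fls)"
    by (simp add: fls_const_mult_const)
  show "weyl_op tensor_t * wconst (inverse fls_X) = (1 :: 'k poly fract wop)"
    "wconst (inverse fls_X) * weyl_op tensor_t = (1 :: 'k poly fract wop)"
    using X by (simp_all add: mult.commute flip: wc)
  show "weyl_op tensor_C * wconst (fls_const (inverse (to_fract [:0, 1:]))) = (1 :: 'k poly fract wop)"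
    "wconst (fls_const (inverse (to_fract [:0, 1:]))) * weyl_op tensor_C = (1 :: 'k poly fract wop)"
    using C by (simp_all add: wfun_def mult.commute flip: wc)
qed

lemma psi_gs_poly:
  "W.psi (gs_poly p) = M2 (wconst (fls_gs (- 1) p)) 0 0 (wconst (fls_gs 1 p))"
proof -
  note wc = unital_ring_homD[OF unital_ring_hom_wconst]
  have s: "W.psi (s_poly u) = scalar_m2 (wconst (fls_s u))" for u :: "'a poly"
    by (induction u)
       (simp_all add: s_poly fls_s s_poly_pCons fls_s_pCons W.psi W.psi_gens W.psi_s wc wfun_def
         unital_ring_homD[OF unital_ring_hom_scalar_m2])
  have minus: "to_fract [:- 1:] = (- 1 :: 'a poly fract)"
    by (metis minus_pCons minus_zero pCons_one to_fract_1 to_fract_uminus)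
  have one: "to_fract [:1:] = (1 :: 'a poly fract)" by (simp flip: one_pCons)
  show ?thesis
    by (induction p)
       (simp_all add: gs_poly fls_gs gs_poly_pCons fls_gs_pCons W.psi W.psi_gens s wc scalar_m2_def
         zero_m2_def minus one divide_inverse mult.assoc)
qed

lemma psi_diag_poly:
  fixes p :: "'k::field poly poly poly"
  defines "T \<equiv> W.t * W.t * W.d"
  shows "W.psi (diag_poly p) =
    M2 (poly_eval (\<lambda>u. wconst (fls_gs (- 1) u)) T p) 0 0
       (poly_eval (\<lambda>u. wconst (fls_gs 1 u)) T p)"
proof -
  have hom: "unital_ring_hom (\<lambda>u. wconst (fls_gs e u))" for e :: 'k
    by (rule unital_ring_hom_comp[OF unital_ring_hom_wconst unital_ring_hom_fls_gs])
  show ?thesis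
    by (induction p)
       (simp_all add: diag_poly_pCons W.psi psi_gs_poly W.psi_tau poly_eval_0 poly_eval_pCons hom
         T_def zero_m2_def scalar_m2_def del: weyl_op_simps)
qed

text \<open>Each diagonal entry alone determines \<open>v\<close>, because \<open>- 1\<close> and
  \<open>1\<close> are both nonzero. Faithfulness needs this: a coefficient of \<open>x\<close> or
  of \<open>x y\<close> shows only its upper entry in the product.\<close>

lemma psi_sjp_diag:
  fixes v :: "'k::field sjp"
  assumes "v \<in> sjp_diag"
  obtains a b where "W.psi v = M2 a 0 0 b" "a = 0 \<Longrightarrow> v = 0" "b = 0 \<Longrightarrow> v = 0"
proof -
  obtain p where v: "v = diag_poly p" using sjp_diag_subset[OF assms] by blast
  let ?T = "W.t * W.t * W.d :: 'k poly fract wop"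
  have T: "degree (symbol ?T) = 1"
    by (simp add: wd_def wconst_mult_Wop mult.assoc)
  have "p = 0" if "poly_eval (\<lambda>u. wconst (fls_gs e u)) ?T p = 0" "e \<noteq> 0" for e
    using poly_eval_wop_degree[OF T unital_ring_hom_fls_gs[of e], of p] fls_gs_eq_0_iff[OF that(2)]
      that(1) by (auto simp: zero_wop_def)
  then show thesis
    using that psi_diag_poly[of p] v by (metis diag_poly_0 one_neq_zero neg_equal_0_iff_equal)
qed

lemma psi_eq_0_iff: "W.psi (a :: 'k::field sjp) = 0 \<longleftrightarrow> a = 0"
proof
  assume 0: "W.psi a = 0"
  obtain n where "sjp_g ^ n * a \<in> sjp_nf" using sjp_g_power_mult_in_nf by blast
  then obtain v0 v1 v2 v3 where
    nf: "sjp_g ^ n * a = v0 + v1 * sjp_x + v2 * sjp_y + v3 * (sjp_x * sjp_y)"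
    and v: "v0 \<in> sjp_diag" "v1 \<in> sjp_diag" "v2 \<in> sjp_diag" "v3 \<in> sjp_diag"
    by (rule sjp_nfE)
  obtain a0 b0 where 0: "W.psi v0 = M2 a0 0 0 b0" "a0 = 0 \<Longrightarrow> v0 = 0" "b0 = 0 \<Longrightarrow> v0 = 0"
    by (rule psi_sjp_diag[OF v(1)]) blast
  obtain a1 b1 where 1: "W.psi v1 = M2 a1 0 0 b1" "a1 = 0 \<Longrightarrow> v1 = 0" "b1 = 0 \<Longrightarrow> v1 = 0"
    by (rule psi_sjp_diag[OF v(2)]) blast
  obtain a2 b2 where 2: "W.psi v2 = M2 a2 0 0 b2" "a2 = 0 \<Longrightarrow> v2 = 0" "b2 = 0 \<Longrightarrow> v2 = 0"
    by (rule psi_sjp_diag[OF v(3)]) blast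
  obtain a3 b3 where 3: "W.psi v3 = M2 a3 0 0 b3" "a3 = 0 \<Longrightarrow> v3 = 0" "b3 = 0 \<Longrightarrow> v3 = 0"
    by (rule psi_sjp_diag[OF v(4)]) blast
  have "W.psi (sjp_g ^ n * a) = 0" using \<open>W.psi a = 0\<close> by (simp add: W.psi)
  then have eq: "M2 (a0 + a3 * W.t) (a1 + a2 * (W.t * W.d)) (b2 * W.t) b0 = M2 0 0 0 0"
    unfolding nf by (simp add: W.psi W.psi_gens 0 1 2 3 zero_m2_def)
  have t: "W.t \<noteq> (0 :: 'k poly fract wop)" by simp
  \<comment> \<open>The second row isolates \<open>b0\<close> and \<open>b2\<close>. Only after
    these have killed \<open>v0\<close> and \<open>v2\<close> does the first row expose
    \<open>a3\<close> and \<open>a1\<close>.\<close>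
  have "v0 = 0" using eq 0 by simp
  moreover from this have "a0 = 0" using 0(1) by (simp add: W.psi zero_m2_def)
  then have "v3 = 0" using eq 3 t by simp
  moreover have "v2 = 0" using eq 2 t by simp
  moreover from this have "a2 = 0" using 2(1) by (simp add: W.psi zero_m2_def)
  then have "v1 = 0" using eq 1 by simp
  ultimately have "sjp_g ^ n * a = 0" by (simp add: nf)
  moreover have "sjp_ginv ^ n * (sjp_g ^ n * a) = a"
  proof (induction n)
    case (Suc n)
    have "sjp_ginv ^ Suc n * (sjp_g ^ Suc n * a) =
        sjp_ginv ^ n * (sjp_ginv * sjp_g * (sjp_g ^ n * a))"
      by (simp only: power_Suc2[of sjp_ginv] power_Suc[of sjp_g] mult.assoc)
    then show ?case using Suc by (simp add: sjp_rels)
  qed simp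
  ultimately show "a = 0" by simp
qed (simp add: W.psi)

lemma inj_psi: "W.psi a = W.psi b \<longleftrightarrow> a = b"
  using psi_eq_0_iff[of "a - b"] by (simp add: W.psi)


section \<open>The centre\<close>

text \<open>
  Giving \<open>X\<close> degree \<open>1\<close>, the image of the bosonization only involves Laurent series whose
  coefficient of degree \<open>n\<close> lies in \<open>C\<^sup>-\<^sup>n \<bbbk>[C]\<close>. For constants this forces polynomials in \<open>C\<close>.
\<close>

definition graded_fls :: "'k::field poly fract fls set" where
  "graded_fls = {f. \<forall>n. to_fract [:0, 1:] powi n * fls_nth f n \<in> range to_fract}"

definition graded_wop :: "'k::field poly fract wop set" where
  "graded_wop = {a. \<forall>i. coeff (symbol a) i \<in> graded_fls}"

lemma range_to_fract_closed:
  "0 \<in> range to_fract" "a \<in> range to_fract \<Longrightarrow> b \<in> range to_fract \<Longrightarrow> a + b \<in> range to_fract"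
  "a \<in> range to_fract \<Longrightarrow> b \<in> range to_fract \<Longrightarrow> a * b \<in> range to_fract"
  "a \<in> range to_fract \<Longrightarrow> - a \<in> range to_fract"
proof -
  show "0 \<in> range to_fract" by (metis rangeI to_fract_0)
qed (auto simp flip: to_fract_add to_fract_mult to_fract_uminus)

lemma of_int_in_range_to_fract: "of_int n \<in> range (to_fract :: 'a::idom \<Rightarrow> 'a fract)"
proof (cases n rule: int_diff_cases)
  case (diff k l)
  have "to_fract (of_nat m) = (of_nat m :: 'a fract)" for m
    by (induction m) simp_all
  then have "of_int n = to_fract (of_nat k - of_nat l :: 'a)" by (simp add: diff)
  then show ?thesis by blast
qed

text \<open>These are the operations occurring in the matrices of the generators. A shift by
  \<open>X\<close> or \<open>X^-1\<close> is balanced by \<open>C^-1\<close> or \<open>C\<close>; a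
  bare \<open>X\<close> gains a factor \<open>C\<close>; \<open>X d/dX\<close> multiplies the
  coefficient of degree \<open>n\<close> by the integer \<open>n\<close>. The derivative alone would
  break the condition, but the matrix of \<open>y\<close> only involves
  \<open>t \<partial>\<close>.\<close>

lemma graded_fls_closed:
  fixes f g :: "'k::field poly fract fls"
  assumes "f \<in> graded_fls"
  shows "g \<in> graded_fls \<Longrightarrow> f + g \<in> graded_fls" "- f \<in> graded_fls"
    "fls_const (to_fract p) * f \<in> graded_fls" "fls_X * f \<in> graded_fls"
    "fls_const (inverse (to_fract [:0, 1:])) * (fls_X * f) \<in> graded_fls"
    "fls_const (to_fract [:0, 1:]) * (inverse fls_X * f) \<in> graded_fls"
    "fls_X * fls_deriv f \<in> graded_fls"
proof -
  let ?C = "to_fract [:0, 1:] :: 'k poly fract"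
  have f: "?C powi n * fls_nth f n \<in> range to_fract" for n
    using assms by (simp add: graded_fls_def)
  note closed = range_to_fract_closed
  have C: "?C powi (n + 1) = ?C * ?C powi n" for n
    by (simp add: power_int_add)
  have X: "fls_nth (fls_X * h) n = fls_nth h (n - 1)"
    "fls_nth (inverse fls_X * h) n = fls_nth h (n + 1)" for h :: "'k poly fract fls" and n
    by (simp_all add: fls_X_times_conv_shift fls_inverse_X fls_X_inv_times_conv_shift)
  show "f + g \<in> graded_fls" if "g \<in> graded_fls"
    using that f by (simp add: graded_fls_def distrib_left closed)
  show "- f \<in> graded_fls"
    using f by (simp add: graded_fls_def closed)
  show "fls_const (to_fract p) * f \<in> graded_fls"
    using closed(3)[OF rangeI f, of p]
    by (simp add: graded_fls_def mult.left_commute[of "_ powi _" "to_fract p"])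
  show "fls_X * f \<in> graded_fls"
  proof -
    have eq: "?C powi n * fls_nth f (n - 1) = ?C * (?C powi (n - 1) * fls_nth f (n - 1))" for n
      using C[of "n - 1"] by simp
    have "?C powi n * fls_nth f (n - 1) \<in> range to_fract" for n
      unfolding eq by (rule closed(3)[OF rangeI f])
    then show ?thesis by (simp add: graded_fls_def X)
  qed
  have "?C powi n * (inverse ?C * fls_nth f (n - 1)) = ?C powi (n - 1) * fls_nth f (n - 1)" for n
    using C[of "n - 1"] by simp
  then show "fls_const (inverse ?C) * (fls_X * f) \<in> graded_fls"
    using f by (simp only: graded_fls_def mem_Collect_eq X fls_mult_const_nth) simp
  have eq: "?C powi n * (?C * fls_nth f (n + 1)) = ?C powi (n + 1) * fls_nth f (n + 1)" for n
    using C[of n] by simp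
  have "?C powi n * (?C * fls_nth f (n + 1)) \<in> range to_fract" for n
    unfolding eq by (rule f)
  then show "fls_const ?C * (inverse fls_X * f) \<in> graded_fls"
    by (simp add: graded_fls_def X)
  have "of_int n * (?C powi n * fls_nth f n) \<in> range to_fract" for n
    by (intro closed(3) of_int_in_range_to_fract f)
  then show "fls_X * fls_deriv f \<in> graded_fls"
    by (simp add: graded_fls_def X mult.left_commute[of "_ powi _" "of_int _"])
qed

lemma graded_wop_closed:
  fixes a b :: "'k::field poly fract wop"
  assumes "a \<in> graded_wop"
  shows "b \<in> graded_wop \<Longrightarrow> a + b \<in> graded_wop" "- a \<in> graded_wop"
    "wfun p * a \<in> graded_wop" "W.t * a \<in> graded_wop"
    "wconst (fls_const (inverse (to_fract [:0, 1:]))) * W.t * a \<in> graded_wop"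
    "W.C * wconst (inverse fls_X) * a \<in> graded_wop" "W.t * W.d * a \<in> graded_wop"
proof -
  obtain q where a: "a = Wop q" by (metis symbol_inverse)
  have q: "coeff q i \<in> graded_fls" for i
    using assms by (simp add: a graded_wop_def)
  note closed = graded_fls_closed[OF q]
  show "a + b \<in> graded_wop" if "b \<in> graded_wop"
    using that closed(1) by (simp add: a graded_wop_def plus_wop_def)
  show "- a \<in> graded_wop" using closed(2) by (simp add: a graded_wop_def uminus_wop_def)
  show "wfun p * a \<in> graded_wop" "W.t * a \<in> graded_wop"
    "wconst (fls_const (inverse (to_fract [:0, 1:]))) * W.t * a \<in> graded_wop"
    "W.C * wconst (inverse fls_X) * a \<in> graded_wop"
    using closed(3-6)
    by (simp_all add: a graded_wop_def wfun_def mult.assoc wconst_mult_Wop del: fls_inverse_X)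
  have "fls_X * coeff (dz q) i \<in> graded_fls" for i
    using closed(4,7) graded_fls_closed(1)[OF closed(4) closed(7), of "i - 1" i]
    by (simp add: coeff_dz distrib_left)
  then show "W.t * W.d * a \<in> graded_wop"
    by (simp add: a graded_wop_def mult.assoc wd_mult_Wop wconst_mult_Wop)
qed

lemma graded_wop_0: "0 \<in> graded_wop"
  using range_to_fract_closed(1) by (simp add: graded_wop_def graded_fls_def zero_wop_def)

lemma graded_wop_wfun: "wfun p \<in> graded_wop"
proof -
  have "(1 :: 'a poly fract wop) \<in> graded_wop"
    using range_to_fract_closed(1) rangeI[of to_fract "1 :: 'a poly"]
    by (auto simp: graded_wop_def graded_fls_def one_wop_def)
  from graded_wop_closed(3)[OF this, of p] show ?thesis by simp
qed

lemma psi_graded: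
  "m11 (W.psi a) \<in> graded_wop \<and> m12 (W.psi a) \<in> graded_wop \<and>
    m21 (W.psi a) \<in> graded_wop \<and> m22 (W.psi a) \<in> graded_wop"
proof (induction a rule: sjp_induct)
  case (scalar c)
  show ?case
    by (simp add: W.psi_gens scalar_m2_def graded_wop_0 graded_wop_wfun)
next
  case (add a b)
  then show ?case by (simp add: W.psi graded_wop_closed)
next
  case (x a)
  then show ?case by (cases "W.psi a") (simp add: W.psi W.psi_gens graded_wop_0)
next
  case (y a)
  then show ?case
    by (cases "W.psi a") (simp add: W.psi W.psi_gens graded_wop_closed del: weyl_op_simps)
next
  case (g a)
  then show ?case
    by (cases "W.psi a")
       (simp add: W.psi W.psi_gens graded_wop_closed del: weyl_op_simps)
next
  case (ginv a)
  then show ?case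
    by (cases "W.psi a")
       (simp add: W.psi W.psi_gens graded_wop_closed del: weyl_op_simps fls_inverse_X)
qed

lemma eval_C_in_centre: "eval_C p \<in> centre"
proof -
  have "W.psi (eval_C p) * A = A * W.psi (eval_C p)" for A
    by (cases A) (simp add: W.psi_eval_C scalar_m2_def wfun_commute)
  then show ?thesis
    by (simp add: centre_def W.psi flip: inj_psi)
qed

lemma inj_eval_C: "inj (eval_C :: 'k::field poly \<Rightarrow> 'k sjp)"
proof (rule injI)
  fix p q :: "'k poly"
  assume "eval_C p = eval_C q"
  then have "W.psi (eval_C p) = W.psi (eval_C q)" by simp
  then show "p = q" by (simp add: W.psi_eval_C)
qed

lemma centre_subset_range_eval_C:
  fixes a :: "'k::field_char_0 sjp"
  assumes "a \<in> centre"
  shows "a \<in> range eval_C"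
proof -
  have comm: "W.psi a * W.psi b = W.psi b * W.psi a" for b
    using assms by (simp add: centre_def flip: W.psi)
  obtain \<alpha> \<beta> \<gamma> \<delta> where a: "W.psi a = M2 \<alpha> \<beta> \<gamma> \<delta>" by (cases "W.psi a")
  have x: "\<gamma> = 0" "\<alpha> = \<delta>"
    using comm[of sjp_x] by (auto simp: a W.psi_gens)
  \<comment> \<open>Entries of the commutator with \<open>y\<close>, once commutation with
    \<open>E12\<close> has made the matrix upper triangular with equal diagonal entries.\<close>
  have y: "W.t * \<beta> = 0" "W.t * \<alpha> = \<alpha> * W.t" "\<alpha> * (W.t * W.d) = W.t * W.d * \<alpha>"
    using comm[of sjp_y] by (auto simp: a W.psi_gens x simp del: weyl_op_simps)
  have t: "W.t \<noteq> (0 :: 'k poly fract wop)" by simp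
  have "\<beta> = 0" using y(1) t by (simp del: weyl_op_simps)
  have "W.t * (\<alpha> * W.d) = W.t * \<alpha> * W.d" by (rule mult.assoc[symmetric])
  also have "\<dots> = \<alpha> * (W.t * W.d)" unfolding y(2) by (rule mult.assoc)
  also have "\<dots> = W.t * (W.d * \<alpha>)" unfolding y(3) by (rule mult.assoc)
  finally have "W.t * (\<alpha> * W.d) = W.t * (W.d * \<alpha>)" .
  then have d: "\<alpha> * W.d = W.d * \<alpha>" using t by (simp del: weyl_op_simps)
  obtain q where q: "\<alpha> = Wop q" by (metis symbol_inverse)
  \<comment> \<open>The commutator of \<open>\<alpha>\<close> with \<open>X\<close> has symbol
    \<open>pderiv q\<close>. In characteristic zero its vanishing makes \<open>\<alpha>\<close> an
    operator of order zero; commutation with \<open>\<partial>\<close> then makes the coefficient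
    constant.\<close>
  have "pderiv q = 0"
    using y(2) by (simp add: q wconst_mult_Wop Wop_mult_wconst_X)
  then have "degree q = 0" by (simp add: pderiv_eq_0_iff)
  then obtain k where k: "q = [:k:]" by (rule degree_eq_zeroE)
  have \<alpha>: "\<alpha> = wconst k" by (simp add: q k wconst_def)
  have "wconst (fls_deriv k) = 0" using d by (simp add: \<alpha> wd_mult_wconst)
  then have "fls_deriv k = 0" by simp
  then have k0: "k = fls_const (fls_nth k 0)" by (simp add: fls_deriv_eq_0_iff)
  have "k \<in> graded_fls"
  proof -
    have "wconst k \<in> graded_wop" using psi_graded[of a] by (simp add: a \<alpha>)
    then have "coeff [:k:] 0 \<in> graded_fls" 
      unfolding graded_wop_def wconst_def mem_Collect_eq wop_inverse by blast
    then show ?thesis by simp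
  qed
  \<comment> \<open>In degree zero the power of \<open>C\<close> is trivial, so the grading
    condition puts the constant itself in \<open>\<bbbk>[C]\<close>.\<close>
  then have "to_fract [:0, 1:] powi 0 * fls_nth k 0 \<in> range to_fract"
    unfolding graded_fls_def by blast
  then obtain p where "fls_nth k 0 = to_fract p" by auto
  then have "W.psi a = W.psi (eval_C p)"
    using k0 by (simp add: a x(1) x(2)[symmetric] \<open>\<beta> = 0\<close> \<alpha> W.psi_eval_C scalar_m2_def wfun_def)
  then show ?thesis by (simp add: inj_psi)
qed


section \<open>Faithfulness over every extension of the Weyl algebra\<close>

text \<open>
  \<open>sjp_matrix a m w\<close>: after multiplication by \<open>(C t)\<^sup>m\<close>, the matrix of \<open>a\<close> has the entries \<open>w\<close>
  in \<open>\<bbbk>[C] \<otimes> A\<^sub>1\<close>, whatever the extension in which \<open>C\<close> and \<open>t\<close> have been inverted. This reduces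
  faithfulness over an arbitrary extension to the case of differential operators.
\<close>
inductive sjp_matrix :: "'k::field sjp \<Rightarrow> nat \<Rightarrow> 'k polyC_weyl m2 \<Rightarrow> bool" where
  scalar: "sjp_matrix (sjp_scalar c) 0 (scalar_m2 (tensor_scalar c))"
| add: "sjp_matrix a m v \<Longrightarrow> sjp_matrix b m w \<Longrightarrow> sjp_matrix (a + b) m (v + w)"
| raise: "sjp_matrix a m w \<Longrightarrow> sjp_matrix a (Suc m) (scalar_m2 (tensor_C * tensor_t) * w)"
| x: "sjp_matrix a m w \<Longrightarrow> sjp_matrix (sjp_x * a) m (M2 0 1 0 0 * w)"
| y: "sjp_matrix a m w \<Longrightarrow>
    sjp_matrix (sjp_y * a) m (M2 0 (tensor_t * tensor_d - of_nat m) tensor_t 0 * w)"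
| g: "sjp_matrix a m w \<Longrightarrow>
    sjp_matrix (sjp_g * a) (Suc m) (M2 (- (tensor_t * tensor_t)) 0 0 (tensor_t * tensor_t) * w)"
| ginv: "sjp_matrix a m w \<Longrightarrow>
    sjp_matrix (sjp_ginv * a) (Suc m) (M2 (- (tensor_C * tensor_C)) 0 0 (tensor_C * tensor_C) * w)"

lemma sjp_matrix_raise: "sjp_matrix a m w \<Longrightarrow> \<exists>w'. sjp_matrix a (n + m) w'"
  by (induction n) (auto intro: sjp_matrix.raise)

lemma sjp_matrix_exists: "\<exists>m w. sjp_matrix a m w"
proof (induction a rule: sjp_induct)
  case (add a b)
  then show ?case by (metis add.commute sjp_matrix.add sjp_matrix_raise)
qed (blast intro: sjp_matrix.intros)+

text \<open>\<open>t\<close> has weight one for the Euler operator \<open>t d\<close>, so each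
  factor \<open>t\<close> shifts it by \<open>- 1\<close>. This is the origin of
  \<open>- of_nat m\<close> in the clause for \<open>y\<close> in \<open>sjp_matrix\<close>.\<close>

lemma weyl_power_commute:
  fixes C t d :: "'a::ring_1"
  assumes "C * t = t * C" "C * d = d * C" "d * t = t * d + 1"
  shows "(C * t) ^ m * (t * d) = (t * d - of_nat m) * (C * t) ^ m"
proof (induction m)
  case (Suc m)
  have "t * d * (C * t) = C * t * (t * d) + C * t"
    by (metis assms distrib_left mult.assoc mult_1_right)
  then have step: "C * t * (t * d - of_nat m) = (t * d - of_nat (Suc m)) * (C * t)"
    by (simp add: algebra_simps mult_of_nat_commute)
  have "(C * t) ^ Suc m * (t * d) = C * t * (t * d - of_nat m) * (C * t) ^ m"
    by (simp add: mult.assoc Suc.IH)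
  also have "\<dots> = (t * d - of_nat (Suc m)) * (C * t) * (C * t) ^ m" by (simp only: step)
  finally show ?case by (simp only: mult.assoc power_Suc)
qed simp

lemma map_m2_hom:
  assumes "unital_ring_hom f"
  shows "map_m2 f (A + B) = map_m2 f A + map_m2 f B" "map_m2 f (A * B) = map_m2 f A * map_m2 f B"
    "map_m2 f (scalar_m2 c) = scalar_m2 (f c)"
  by (cases A; cases B; simp add: unital_ring_homD[OF assms] scalar_m2_def)+

lemma scalar_m2_eq_0_iff:
  "scalar_m2 (c :: 'a::ring_1_no_zero_divisors) * A = 0 \<longleftrightarrow> c = 0 \<or> A = 0"
  by (cases A) (auto simp: scalar_m2_def zero_m2_def)

lemma intertwine_mult:
  "u * p = q * v \<Longrightarrow> v * a = w \<Longrightarrow> u * (p * a) = q * (w :: 'a::semigroup_mult)"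
  by (metis mult.assoc)

context weyl_ext
begin

text \<open>Each clause moves \<open>(C t)^m\<close> past the matrix of a generator. For
  \<open>g\<close> and its inverse one further factor clears the denominator:
  \<open>(C t) (C' t) = t^2\<close> and \<open>(C t) (C t') = C^2\<close>.\<close>

lemma psi_sjp_matrix:
  "sjp_matrix a m w \<Longrightarrow> scalar_m2 ((C * t) ^ m) * psi a = map_m2 om w"
proof (induction rule: sjp_matrix.induct)
  case (scalar c)
  then show ?case
    by (simp add: psi_gens map_m2_hom[OF hom] unital_ring_homD(2)[OF unital_ring_hom_scalar_m2])
next
  case (add a m v b w)
  then show ?case by (simp add: psi distrib_left map_m2_hom[OF hom])
next
  case (raise a m w)
  then show ?case
    by (simp add: map_m2_hom[OF hom] om unital_ring_homD(6)[OF unital_ring_hom_scalar_m2] mult.assoc)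
next
  case (x a m w)
  have "scalar_m2 ((C * t) ^ m) * (M2 0 1 0 0 * psi a) = M2 0 1 0 0 * (scalar_m2 ((C * t) ^ m) * psi a)"
    by (cases "psi a") (simp add: scalar_m2_def)
  then show ?case using x by (simp add: psi psi_gens map_m2_hom[OF hom] om)
next
  case (y a m w)
  have "(C * t) ^ m * (t * d) = (t * d - of_nat m) * (C * t) ^ m"
    by (rule weyl_power_commute) (simp_all add: d_t pure_commute)
  moreover have "(C * t) ^ m * t = t * (C * t) ^ m"
    by (rule power_commuting_commutes) (simp add: mult.assoc pure_commute)
  ultimately have "scalar_m2 ((C * t) ^ m) * psi sjp_y =
      M2 0 (t * d - of_nat m) t 0 * scalar_m2 ((C * t) ^ m)"
    by (simp add: scalar_m2_def psi_gens)
  then have "scalar_m2 ((C * t) ^ m) * (psi sjp_y * psi a) =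
      M2 0 (t * d - of_nat m) t 0 * map_m2 om w"
    using y.IH by (rule intertwine_mult)
  moreover have "om (of_nat m) = of_nat m"
    by (induction m) (simp_all add: om)
  ultimately show ?case by (simp add: psi map_m2_hom[OF hom] om)
next
  case (g a m w)
  have "C * t * C' = t"
    by (metis C'(1) C'_commute mult.assoc mult_1_left)
  moreover have "(C * t) ^ m * (C' * t) = C' * t * (C * t) ^ m"
    by (rule power_commuting_commutes) (simp add: normal_order)
  ultimately have "(C * t) ^ Suc m * (C' * t) = t * t * (C * t) ^ m"
    by (metis mult.assoc power_Suc)
  then have "scalar_m2 ((C * t) ^ Suc m) * psi sjp_g =
      M2 (- (t * t)) 0 0 (t * t) * scalar_m2 ((C * t) ^ m)"
    by (simp add: scalar_m2_def psi_gens del: power_Suc)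
  then have "scalar_m2 ((C * t) ^ Suc m) * (psi sjp_g * psi a) =
      M2 (- (t * t)) 0 0 (t * t) * map_m2 om w"
    using g.IH by (rule intertwine_mult)
  then show ?case by (simp add: psi map_m2_hom[OF hom] om)
next
  case (ginv a m w)
  have "C * t * (C * t') = C * C"
    by (simp add: normal_order)
  moreover have "(C * t) ^ m * (C * t') = C * t' * (C * t) ^ m"
    by (rule power_commuting_commutes) (simp add: normal_order)
  ultimately have "(C * t) ^ Suc m * (C * t') = C * C * (C * t) ^ m"
    by (metis mult.assoc power_Suc)
  then have "scalar_m2 ((C * t) ^ Suc m) * psi sjp_ginv =
      M2 (- (C * C)) 0 0 (C * C) * scalar_m2 ((C * t) ^ m)"
    by (simp add: scalar_m2_def psi_gens del: power_Suc)
  then have "scalar_m2 ((C * t) ^ Suc m) * (psi sjp_ginv * psi a) =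
      M2 (- (C * C)) 0 0 (C * C) * map_m2 om w"
    using ginv.IH by (rule intertwine_mult)
  then show ?case by (simp add: psi map_m2_hom[OF hom] om)
qed

lemma psi_injective:
  assumes "inj om"
  shows "inj psi"
proof (rule injI)
  fix a b
  assume "psi a = psi b"
  then have 0: "psi (a - b) = 0" by (simp add: psi)
  obtain m w where mw: "sjp_matrix (a - b) m w" using sjp_matrix_exists by blast
  have "map_m2 om w = 0" using psi_sjp_matrix[OF mw] by (simp add: 0)
  moreover have "om u = 0 \<longleftrightarrow> u = 0" for u using injD[OF assms, of u 0] om(1) by auto
  ultimately have "w = 0" by (cases w) (simp add: zero_m2_def)
  \<comment> \<open>The same \<open>w\<close> describes the element over the differential operators,
    where the power of \<open>C t\<close> can be cancelled.\<close>
  then have "scalar_m2 ((weyl_op tensor_C * weyl_op tensor_t) ^ m) * W.psi (a - b) = 0"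
    using W.psi_sjp_matrix[OF mw] by (simp add: zero_m2_def W.om(1))
  moreover have "weyl_op tensor_C * weyl_op tensor_t \<noteq> (0 :: 'k poly fract wop)"
    using wfun_eq_iff[of "[:0, 1:]" 0] by (simp add: unital_ring_homD(1)[OF unital_ring_hom_wfun])
  ultimately have "W.psi (a - b) = 0"
    by (simp add: scalar_m2_eq_0_iff del: weyl_op_simps)
  then show "a = b" by (simp add: psi_eq_0_iff)
qed


section \<open>Matrices as left fractions\<close>

text \<open>A subring containing \<open>C\<close>, \<open>t\<close> and
  \<open>t^2 \<partial>\<close>. The derivation \<open>\<partial>\<close> is reached only after
  multiplication by powers of \<open>t\<close>.\<close>

definition scalar_image :: "'k polyC_weyl set" where
  "scalar_image = {w. \<exists>a. psi a = scalar_m2 (om w)}"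

lemma scalar_image_closed:
  "v \<in> scalar_image \<Longrightarrow> w \<in> scalar_image \<Longrightarrow> v + w \<in> scalar_image"
  "v \<in> scalar_image \<Longrightarrow> w \<in> scalar_image \<Longrightarrow> v - w \<in> scalar_image"
  "v \<in> scalar_image \<Longrightarrow> w \<in> scalar_image \<Longrightarrow> v * w \<in> scalar_image"
  "tensor_scalar c \<in> scalar_image" "tensor_C \<in> scalar_image" "tensor_t \<in> scalar_image"
  "tensor_t * tensor_t * tensor_d \<in> scalar_image" "of_nat n \<in> scalar_image"
proof -
  note sc = unital_ring_homD[OF unital_ring_hom_scalar_m2]
  show add: "v \<in> scalar_image \<Longrightarrow> w \<in> scalar_image \<Longrightarrow> v + w \<in> scalar_image" for v w
    unfolding scalar_image_def mem_Collect_eq om sc by (metis psi(3))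
  show "v \<in> scalar_image \<Longrightarrow> w \<in> scalar_image \<Longrightarrow> v - w \<in> scalar_image"
    unfolding scalar_image_def mem_Collect_eq om sc by (metis psi(4))
  show "v \<in> scalar_image \<Longrightarrow> w \<in> scalar_image \<Longrightarrow> v * w \<in> scalar_image"
    unfolding scalar_image_def mem_Collect_eq om sc by (metis psi(6))
  show "tensor_scalar c \<in> scalar_image" "tensor_C \<in> scalar_image" "tensor_t \<in> scalar_image"
    "tensor_t * tensor_t * tensor_d \<in> scalar_image"
    unfolding scalar_image_def mem_Collect_eq
    by (rule exI, rule psi_gens psi_C psi_s psi_tau[folded om])+
  have "0 \<in> scalar_image" "1 \<in> scalar_image"
    unfolding scalar_image_def mem_Collect_eq om sc by (metis psi(1), metis psi(2))
  then show "of_nat n \<in> scalar_image" by (induction n) (simp_all add: add)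
qed

lemma t_power_mult_scalar_image_mono:
  assumes "tensor_t ^ n * w \<in> scalar_image" "n \<le> m"
  shows "tensor_t ^ m * w \<in> scalar_image"
proof -
  have "tensor_t ^ k \<in> scalar_image" for k
    using scalar_image_closed(8)[of 1] by (induction k) (simp_all add: scalar_image_closed)
  then have "tensor_t ^ (m - n) * (tensor_t ^ n * w) \<in> scalar_image"
    using assms(1) by (rule scalar_image_closed(3))
  then show ?thesis using assms(2) by (simp flip: mult.assoc power_add)
qed

text \<open>The case of \<open>\<partial>\<close> uses
  \<open>t^2 \<partial> t^n = t^(n+2) \<partial> + n t^(n+1)\<close>: if \<open>t^n w\<close> is in
  the subring, then so is
  \<open>t^(n+2) \<partial> w = t^2 \<partial> (t^n w) - n t (t^n w)\<close>.\<close>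

lemma t_power_mult_scalar_image: "\<exists>n. tensor_t ^ n * w \<in> scalar_image"
proof (induction w rule: polyC_weyl_induct)
  case (scalar c)
  show ?case by (rule exI[of _ 0]) (simp add: scalar_image_closed)
next
  case (add v w)
  then obtain m n where "tensor_t ^ m * v \<in> scalar_image" "tensor_t ^ n * w \<in> scalar_image"
    by blast
  then have "tensor_t ^ (m + n) * (v + w) \<in> scalar_image"
    unfolding distrib_left
    by (intro scalar_image_closed(1)) (auto intro: t_power_mult_scalar_image_mono)
  then show ?case by blast
next
  case (C w)
  then obtain n where "tensor_t ^ n * w \<in> scalar_image" by blast
  then have "tensor_C * (tensor_t ^ n * w) \<in> scalar_image"
    by (rule scalar_image_closed(3)[OF scalar_image_closed(5)])
  also have "tensor_C * (tensor_t ^ n * w) = tensor_t ^ n * (tensor_C * w)"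
    by (simp add: pure_tensor_1_commute[of _ "tensor_t ^ n"] flip: mult.assoc)
  finally show ?case by blast
next
  case (t w)
  then obtain n where "tensor_t ^ n * w \<in> scalar_image" by blast
  then have "tensor_t * (tensor_t ^ n * w) \<in> scalar_image"
    by (rule scalar_image_closed(3)[OF scalar_image_closed(6)])
  also have "tensor_t * (tensor_t ^ n * w) = tensor_t ^ n * (tensor_t * w)"
    by (simp add: power_commutes flip: mult.assoc)
  finally show ?case by blast
next
  case (d w)
  then obtain n where n: "tensor_t ^ n * w \<in> scalar_image" by blast
  let ?t = "tensor_t :: 'k polyC_weyl" and ?d = "tensor_d :: 'k polyC_weyl"
  have nat: "u * (of_nat m * v) = of_nat m * (u * v)" for m :: nat and u v :: "'k polyC_weyl"
    by (metis mult.assoc mult_of_nat_commute)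
  \<comment> \<open>For \<open>n = 0\<close> the truncated exponent \<open>n - 1\<close> is
    harmless, since the factor \<open>of_nat n\<close> vanishes.\<close>
  have t_pow: "?t * (of_nat n * ?t ^ (n - 1)) = of_nat n * ?t ^ n" for n
    by (cases n) (simp_all only: nat, simp_all)
  have "?d * ?t ^ n = ?t ^ n * ?d + of_nat n * ?t ^ (n - 1)" for n
  proof (induction n)
    case (Suc n)
    have "?d * ?t ^ Suc n = ?t * (?d * ?t ^ n) + ?t ^ n"
      by (simp add: tensor_rels distrib_right flip: mult.assoc)
    also have "\<dots> = ?t ^ Suc n * ?d + (?t * (of_nat n * ?t ^ (n - 1)) + ?t ^ n)"
      by (simp add: Suc.IH distrib_left mult.assoc)
    finally show ?case unfolding t_pow by (simp add: distrib_right add_ac)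
  qed simp
  then have "?t * ?t * ?d * (?t ^ n * w) =
      ?t * ?t * (?t ^ n * ?d + of_nat n * ?t ^ (n - 1)) * w"
    by (simp only: mult.assoc) (simp flip: mult.assoc)
  also have "\<dots> = ?t ^ (n + 2) * (?d * w) + ?t * (?t * (of_nat n * ?t ^ (n - 1))) * w"
    by (simp add: distrib_left distrib_right mult.assoc power2_eq_square power_add
        power_commutes[symmetric]) (simp add: power_commutes flip: mult.assoc)
  also note t_pow
  finally have "?t ^ (n + 2) * (?d * w) = ?t * ?t * ?d * (?t ^ n * w) - ?t * of_nat n * (?t ^ n * w)"
    by (simp add: mult.assoc)
  moreover have "\<dots> \<in> scalar_image" by (intro scalar_image_closed n)
  ultimately show ?case by metis
qed

lemma t_power_mult_scalar_image_finite:
  "finite F \<Longrightarrow> \<exists>n. \<forall>w\<in>F. tensor_t ^ n * w \<in> scalar_image"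
proof (induction rule: finite_induct)
  case (insert v F)
  then obtain m n where "tensor_t ^ m * v \<in> scalar_image" "\<forall>w\<in>F. tensor_t ^ n * w \<in> scalar_image"
    using t_power_mult_scalar_image by blast
  then have "\<forall>w\<in>insert v F. tensor_t ^ (m + n) * w \<in> scalar_image"
    by (auto intro: t_power_mult_scalar_image_mono)
  then show ?case by blast
qed simp

text \<open>With the same power of \<open>t\<close> on both sides, \<open>psi s\<close> and
  \<open>psi a\<close> represent the left fraction of \<open>A\<close> by the scalar
  \<open>v\<close>: that power cancels.\<close>

lemma scalar_multiples_in_image:
  assumes "v \<noteq> 0"
  obtains n a s where "psi s = scalar_m2 (om (tensor_t ^ n * v))"
    "psi a = scalar_m2 (om (tensor_t ^ n)) * map_m2 om A"
proof -
  obtain b c d e where A: "A = M2 b c d e" by (cases A)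
  obtain n where "\<forall>w\<in>{v, b, c, d, e}. tensor_t ^ n * w \<in> scalar_image"
    using t_power_mult_scalar_image_finite[of "{v, b, c, d, e}"] by auto
  then obtain b' c' d' e' where *: "psi b' = scalar_m2 (om (tensor_t ^ n * b))"
    "psi c' = scalar_m2 (om (tensor_t ^ n * c))" "psi d' = scalar_m2 (om (tensor_t ^ n * d))"
    "psi e' = scalar_m2 (om (tensor_t ^ n * e))" and v: "tensor_t ^ n * v \<in> scalar_image"
    unfolding scalar_image_def by auto
  have "tensor_t ^ (n + 2) * v \<in> scalar_image"
    by (rule t_power_mult_scalar_image_mono[OF v]) simp
  then obtain s where s: "psi s = scalar_m2 (om (tensor_t ^ (n + 2) * v))"
    unfolding scalar_image_def by auto
  \<comment> \<open>The words \<open>s x y\<close>, \<open>s s x\<close>, \<open>y x y\<close> and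
    \<open>s y x\<close> map to \<open>t^2\<close> times the four matrix units; hence the exponent
    \<open>n + 2\<close>.\<close>
  define a where "a = sjp_s * (sjp_x * sjp_y * b') + sjp_s * (sjp_s * (sjp_x * c')) +
    sjp_y * sjp_x * sjp_y * d' + sjp_s * (sjp_y * sjp_x * e')"
  have "psi a = scalar_m2 (om (tensor_t ^ (n + 2))) * map_m2 om A"
    by (simp add: a_def A psi psi_gens psi_s * scalar_m2_def om power_add power2_eq_square
        power_commutes mult.assoc unital_ring_hom_power[OF hom])
  with s show thesis by (rule that)
qed

end


section \<open>Uniqueness of left quotient rings\<close>

text \<open>Denominators are cleared from the left above, by powers of \<open>t\<close>, so quotient
  rings are compared through left fractions.\<close>

definition left_quotient_ring ::
    "('r::{ring, monoid_mult} \<Rightarrow> 'q::{ring, monoid_mult}) \<Rightarrow> bool" where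
  "left_quotient_ring \<iota> \<longleftrightarrow> unital_ring_hom \<iota> \<and> inj \<iota> \<and>
     (\<forall>s. regular s \<longrightarrow> two_sided_unit (\<iota> s)) \<and> (\<forall>q. \<exists>a s. regular s \<and> \<iota> s * q = \<iota> a)"

lemma classical_quotient_ring_imp_left: "classical_quotient_ring \<iota> \<Longrightarrow> left_quotient_ring \<iota>"
  by (simp add: classical_quotient_ring_def left_quotient_ring_def)

lemma regular_mult:
  assumes "regular a" "regular b"
  shows "regular (a * b)"
  using assms unfolding regular_def by (metis mult.assoc)

lemma two_sided_unit_cancel_left:
  "two_sided_unit u \<Longrightarrow> u * a = u * b \<Longrightarrow> a = (b :: 'a::monoid_mult)"
  unfolding two_sided_unit_def by (metis mult.assoc mult_1_left)

text \<open>The left Ore condition, obtained by rewriting the right fraction of \<open>a\<close> by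
  \<open>s\<close> as a left fraction.\<close>

lemma left_quotient_ring_ore:
  fixes \<iota> :: "'r::{ring, monoid_mult} \<Rightarrow> 'q::{ring, monoid_mult}" and a s :: 'r
  assumes "left_quotient_ring \<iota>" "regular s"
  obtains u b where "regular u" "u * a = b * s"
proof -
  have hom: "unital_ring_hom \<iota>" and "inj \<iota>"
    using assms(1) by (simp_all add: left_quotient_ring_def)
  obtain v where v: "v * \<iota> s = 1"
    using assms by (auto simp: left_quotient_ring_def two_sided_unit_def)
  obtain b u where u: "regular u" "\<iota> u * (\<iota> a * v) = \<iota> b"
    using assms(1) unfolding left_quotient_ring_def by blast
  have "\<iota> u * (\<iota> a * v) * \<iota> s = \<iota> u * \<iota> a"
    using v by (simp add: mult.assoc)
  then have "\<iota> (u * a) = \<iota> (b * s)"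
    by (simp add: u unital_ring_homD[OF hom])
  with \<open>inj \<iota>\<close> have "u * a = b * s" by (rule injD)
  with u(1) show thesis by (rule that)
qed

text \<open>The graph of the isomorphism. As it is symmetric in the two quotient rings, totality and
  uniqueness in one direction also yield surjectivity and injectivity.\<close>

definition same_left_fraction ::
    "('r::{ring, monoid_mult} \<Rightarrow> 'p::{ring, monoid_mult}) \<Rightarrow> ('r \<Rightarrow> 'q::{ring, monoid_mult}) \<Rightarrow>
     'p \<Rightarrow> 'q \<Rightarrow> bool" where
  "same_left_fraction \<iota> \<kappa> p q \<longleftrightarrow> (\<exists>a s. regular s \<and> \<iota> s * p = \<iota> a \<and> \<kappa> s * q = \<kappa> a)"

lemma same_left_fraction_commute: "same_left_fraction \<iota> \<kappa> p q \<longleftrightarrow> same_left_fraction \<kappa> \<iota> q p"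
  by (auto simp: same_left_fraction_def)

context
  fixes \<iota> :: "'r::{ring, monoid_mult} \<Rightarrow> 'p::{ring, monoid_mult}"
    and \<kappa> :: "'r \<Rightarrow> 'q::{ring, monoid_mult}"
  assumes \<iota>: "left_quotient_ring \<iota>" and \<kappa>: "left_quotient_ring \<kappa>"
begin

lemma quotient_homs: "unital_ring_hom \<iota>" "unital_ring_hom \<kappa>" "inj \<iota>"
  using \<iota> \<kappa> by (simp_all add: left_quotient_ring_def)

lemmas \<iota>_hom = unital_ring_homD[OF quotient_homs(1)]
lemmas \<kappa>_hom = unital_ring_homD[OF quotient_homs(2)]

lemma same_left_fraction_total: "\<exists>q. same_left_fraction \<iota> \<kappa> p q"
proof -
  obtain a s where s: "regular s" "\<iota> s * p = \<iota> a"
    using \<iota> unfolding left_quotient_ring_def by blast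
  obtain v where "\<kappa> s * v = 1"
    using \<kappa> s(1) by (auto simp: left_quotient_ring_def two_sided_unit_def)
  then have "\<kappa> s * (v * \<kappa> a) = \<kappa> a" by (simp flip: mult.assoc)
  then show ?thesis using s unfolding same_left_fraction_def by blast
qed

lemma same_left_fraction_unique:
  assumes "same_left_fraction \<iota> \<kappa> p q" "same_left_fraction \<iota> \<kappa> p q'"
  shows "q = q'"
proof -
  obtain a s a' s' where s: "regular s" "\<iota> s * p = \<iota> a" "\<kappa> s * q = \<kappa> a"
    and s': "regular s'" "\<iota> s' * p = \<iota> a'" "\<kappa> s' * q' = \<kappa> a'"
    using assms unfolding same_left_fraction_def by blast
  obtain u b where u: "regular u" "u * s = b * s'"
    using left_quotient_ring_ore[OF \<iota> s'(1)] by blast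
  have "\<iota> (u * a) = \<iota> (u * s) * p" "\<iota> (b * a') = \<iota> (b * s') * p"
    by (simp_all add: \<iota>_hom mult.assoc s s')
  then have "\<iota> (u * a) = \<iota> (b * a')" by (simp add: u(2))
  with quotient_homs(3) have "u * a = b * a'" by (rule injD)
  moreover have "\<kappa> (u * s) * q = \<kappa> (u * a)" "\<kappa> (b * s') * q' = \<kappa> (b * a')"
    by (simp_all add: \<kappa>_hom mult.assoc s s')
  ultimately have "\<kappa> (u * s) * q = \<kappa> (u * s) * q'"
    by (simp add: u(2))
  moreover have "two_sided_unit (\<kappa> (u * s))"
    using \<kappa> regular_mult[OF u(1) s(1)] by (simp add: left_quotient_ring_def)
  ultimately show ?thesis by (metis two_sided_unit_cancel_left)
qed

lemma same_left_fraction_ring: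
  assumes "same_left_fraction \<iota> \<kappa> p q" "same_left_fraction \<iota> \<kappa> p' q'"
  shows "same_left_fraction \<iota> \<kappa> (p + p') (q + q')" "same_left_fraction \<iota> \<kappa> (p * p') (q * q')"
proof -
  obtain a s a' s' where s: "regular s" "\<iota> s * p = \<iota> a" "\<kappa> s * q = \<kappa> a"
    and s': "regular s'" "\<iota> s' * p' = \<iota> a'" "\<kappa> s' * q' = \<kappa> a'"
    using assms unfolding same_left_fraction_def by blast
  obtain u b where u: "regular u" "u * s = b * s'"
    using left_quotient_ring_ore[OF \<iota> s'(1)] by blast
  have "\<iota> (u * s) * p = \<iota> (u * a)" "\<iota> (b * s') * p' = \<iota> (b * a')"
    "\<kappa> (u * s) * q = \<kappa> (u * a)" "\<kappa> (b * s') * q' = \<kappa> (b * a')"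
    by (simp_all add: \<iota>_hom \<kappa>_hom mult.assoc s s')
  then have "\<iota> (u * s) * (p + p') = \<iota> (u * a + b * a')" "\<kappa> (u * s) * (q + q') = \<kappa> (u * a + b * a')"
    by (simp_all add: distrib_left u(2) \<iota>_hom(3) \<kappa>_hom(3))
  then show "same_left_fraction \<iota> \<kappa> (p + p') (q + q')"
    using regular_mult[OF u(1) s(1)] unfolding same_left_fraction_def by blast
  \<comment> \<open>The Ore condition moves \<open>a\<close> past the denominator \<open>s'\<close>,
    so that \<open>(s^-1 a) (s'^-1 a') = (v s)^-1 (c a')\<close>.\<close>
  obtain v c where v: "regular v" "v * a = c * s'"
    using left_quotient_ring_ore[OF \<iota> s'(1)] by blast
  have "\<iota> (v * s) * (p * p') = \<iota> v * (\<iota> s * p) * p'"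
    by (simp add: \<iota>_hom mult.assoc)
  also have "\<dots> = \<iota> (c * s') * p'" by (simp add: s \<iota>_hom flip: v(2))
  also have "\<dots> = \<iota> (c * a')" by (simp add: \<iota>_hom mult.assoc s')
  finally have 1: "\<iota> (v * s) * (p * p') = \<iota> (c * a')" .
  have "\<kappa> (v * s) * (q * q') = \<kappa> v * (\<kappa> s * q) * q'"
    by (simp add: \<kappa>_hom mult.assoc)
  also have "\<dots> = \<kappa> (c * s') * q'" by (simp add: s \<kappa>_hom flip: v(2))
  also have "\<dots> = \<kappa> (c * a')" by (simp add: \<kappa>_hom mult.assoc s')
  finally have "\<kappa> (v * s) * (q * q') = \<kappa> (c * a')" .
  with 1 show "same_left_fraction \<iota> \<kappa> (p * p') (q * q')"
    using regular_mult[OF v(1) s(1)] unfolding same_left_fraction_def by blast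
qed

lemma same_left_fraction_embed: "same_left_fraction \<iota> \<kappa> (\<iota> r) (\<kappa> r)"
  unfolding same_left_fraction_def
  by (rule exI[of _ r], rule exI[of _ 1]) (simp add: regular_def \<iota>_hom \<kappa>_hom)

end

lemma left_quotient_ring_unique:
  fixes \<iota> :: "'r::{ring, monoid_mult} \<Rightarrow> 'p::{ring, monoid_mult}"
    and \<kappa> :: "'r \<Rightarrow> 'q::{ring, monoid_mult}"
  assumes \<iota>: "left_quotient_ring \<iota>" and \<kappa>: "left_quotient_ring \<kappa>"
  obtains f where "bij f" "unital_ring_hom f" "\<And>r. f (\<iota> r) = \<kappa> r"
proof -
  let ?R = "same_left_fraction \<iota> \<kappa>"
  define f where "f p = (SOME q. ?R p q)" for p
  have R: "?R p (f p)" for p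
    unfolding f_def by (rule someI_ex[OF same_left_fraction_total[OF \<iota> \<kappa>]])
  have eq: "f p = q" if "?R p q" for p q
    by (rule same_left_fraction_unique[OF \<iota> \<kappa> R that])
  have "bij f"
  proof (rule bijI)
    show "inj f"
    proof (rule injI)
      fix p p' assume "f p = f p'"
      then have "?R p (f p)" "?R p' (f p)" using R by metis+
      then show "p = p'"
        using same_left_fraction_unique[OF \<kappa> \<iota>] same_left_fraction_commute[of \<iota> \<kappa>] by blast
    qed
    show "surj f"
    proof (rule surjI)
      fix q
      show "f (SOME p. same_left_fraction \<kappa> \<iota> q p) = q"
        using someI_ex[OF same_left_fraction_total[OF \<kappa> \<iota>]] eq same_left_fraction_commute[of \<iota> \<kappa>]
        by blast
    qed
  qed
  have embed: "f (\<iota> r) = \<kappa> r" for r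
    by (rule eq[OF same_left_fraction_embed[OF \<iota> \<kappa>]])
  have "unital_ring_hom f"
    unfolding unital_ring_hom_def
    using embed[of 1] eq same_left_fraction_ring[OF \<iota> \<kappa> R R]
    by (simp add: unital_ring_homD[OF quotient_homs(1)[OF \<iota> \<kappa>]]
        unital_ring_homD[OF quotient_homs(2)[OF \<iota> \<kappa>]])
  from \<open>bij f\<close> this embed show thesis by (rule that)
qed


section \<open>The quotient ring as a matrix ring\<close>

lemma skew_field_quotient:
  assumes j: "left_quotient_ring (j :: 'k::field polyC_weyl \<Rightarrow> 'd::ring_1)"
  shows "skew_field TYPE('d)"
  unfolding skew_field_def
proof (intro allI impI)
  fix q :: 'd
  assume "q \<noteq> 0"
  note hom = unital_ring_homD[OF quotient_homs(1)[OF j j]]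
  have unit: "two_sided_unit (j s)" if "s \<noteq> 0" for s
    using j regular_polyC_weyl[OF that] by (simp add: left_quotient_ring_def)
  obtain a s where s: "regular s" "j s * q = j a"
    using j unfolding left_quotient_ring_def by blast
  have "s \<noteq> 0" using s(1) by (auto simp: regular_def dest: spec[of _ 1])
  then obtain v where v: "j s * v = 1" "v * j s = 1"
    using unit by (auto simp: two_sided_unit_def)
  have q: "q = v * j a"
    using v(2) by (simp flip: s(2) mult.assoc)
  then have "a \<noteq> 0" using \<open>q \<noteq> 0\<close> by (auto simp: hom)
  moreover have "two_sided_unit v" using v by (auto simp: two_sided_unit_def)
  ultimately show "two_sided_unit q"
    unfolding q using unit by (intro two_sided_unit_mult)
qed

lemma common_left_denominator:
  assumes j: "left_quotient_ring (j :: 'k::field polyC_weyl \<Rightarrow> 'd::ring_1)" and "finite F"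
  shows "\<exists>v. v \<noteq> 0 \<and> (\<forall>q\<in>F. j v * q \<in> range j)"
  using \<open>finite F\<close>
proof (induction rule: finite_induct)
  case empty
  show ?case by (rule exI[of _ 1]) simp
next
  case (insert p F)
  note hom = unital_ring_homD[OF quotient_homs(1)[OF j j]]
  obtain v where v: "v \<noteq> 0" "\<forall>q\<in>F. j v * q \<in> range j" using insert.IH by blast
  obtain a s where s: "regular s" "j s * (j v * p) = j a"
    using j unfolding left_quotient_ring_def by blast
  have "s \<noteq> 0" using s(1) by (auto simp: regular_def dest: spec[of _ 1])
  moreover have "j (s * v) * q \<in> range j" if q: "q \<in> insert p F" for q
  proof (cases "q = p")
    case True
    then show ?thesis using s(2) by (simp add: hom mult.assoc)
  next
    case False
    then obtain b where "j v * q = j b" using q v by blast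
    then have "j (s * v) * q = j (s * b)" by (simp add: hom mult.assoc)
    then show ?thesis by simp
  qed
  ultimately show ?case using v(1) by (metis mult_eq_0_iff)
qed

text \<open>That \<open>t\<close> and \<open>C\<close> are nonzero in the presented algebra is seen
  from their images under \<open>weyl_op\<close>; nonzero elements are regular and become
  units.\<close>

lemma weyl_ext_quotient:
  assumes j: "left_quotient_ring (j :: 'k::field polyC_weyl \<Rightarrow> 'd::ring_1)"
  shows "\<exists>t' C'. weyl_ext j t' C'"
proof -
  have hom: "unital_ring_hom j" by (rule quotient_homs(1)[OF j j])
  have unit: "two_sided_unit (j s)" if "weyl_op s \<noteq> 0" for s
    using j regular_polyC_weyl[of s] that by (simp add: left_quotient_ring_def)
  have "wfun [:0, 1:] \<noteq> (0 :: 'k poly fract wop)"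
    using wfun_eq_iff[of "[:0, 1:]" 0] by (simp add: unital_ring_homD(1)[OF unital_ring_hom_wfun])
  then have "two_sided_unit (j tensor_t)" "two_sided_unit (j tensor_C)"
    by (intro unit; simp del: weyl_op_eq_0_iff)+
  then show ?thesis
    using hom unfolding two_sided_unit_def weyl_ext_def by blast
qed

text \<open>If a regular \<open>s\<close> had a singular image, a nonzero matrix would annihilate
  that image from the left; clearing its denominators would give \<open>b \<noteq> 0\<close> with
  \<open>b * s = 0\<close>.\<close>

lemma left_quotient_ring_psi:
  assumes j: "left_quotient_ring (j :: 'k::field polyC_weyl \<Rightarrow> 'd::ring_1)"
    and ext: "weyl_ext j t' C'"
  shows "left_quotient_ring (weyl_ext.psi j t' C')"
proof -
  interpret weyl_ext j t' C' by (rule ext)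
  have "inj psi" using psi_injective quotient_homs(3)[OF j j] by blast
  have j_unit: "two_sided_unit (j s)" if "s \<noteq> 0" for s
    using j regular_polyC_weyl[OF that] by (simp add: left_quotient_ring_def)
  \<comment> \<open>Two denominators combine: \<open>v\<close> carries the entries into
    \<open>\<bbbk>[C] \<otimes> A_1\<close>, and a power of \<open>t\<close> carries the result into
    the image. Regularity of \<open>s\<close> follows afterwards from its image being a
    unit.\<close>
  have frac: "\<exists>a s. two_sided_unit (psi s) \<and> psi s * M = psi a" for M
  proof -
    obtain p q r u where M: "M = M2 p q r u" by (cases M)
    obtain v where v: "v \<noteq> 0" "\<forall>q\<in>{p, q, r, u}. j v * q \<in> range j"
      using common_left_denominator[OF j, of "{p, q, r, u}"] by auto
    then have "j v * p \<in> range j" "j v * q \<in> range j" "j v * r \<in> range j" "j v * u \<in> range j"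
      by simp_all
    then obtain p' q' r' u' where *: "j v * p = j p'" "j v * q = j q'" "j v * r = j r'"
      "j v * u = j u'" by (elim rangeE)
    obtain n a s where s: "psi s = scalar_m2 (j (tensor_t ^ n * v))"
      and a: "psi a = scalar_m2 (j (tensor_t ^ n)) * map_m2 j (M2 p' q' r' u')"
      using scalar_multiples_in_image[OF v(1)] by blast
    have "psi s * M = psi a"
      unfolding s a M by (simp add: scalar_m2_def om mult.assoc *)
    moreover have "tensor_t \<noteq> (0 :: 'k polyC_weyl)"
      using weyl_op_eq_0_iff[of "tensor_t :: 'k polyC_weyl"] by (auto simp del: weyl_op_eq_0_iff)
    then have "two_sided_unit (psi s)"
      unfolding s using v(1) j_unit by (intro two_sided_unit_hom[OF unital_ring_hom_scalar_m2]) simp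
    ultimately show ?thesis by blast
  qed
  have reg: "regular s" if "two_sided_unit (psi s)" for s
  proof -
    obtain v where v: "psi s * v = 1" "v * psi s = 1"
      using \<open>two_sided_unit (psi s)\<close> by (auto simp: two_sided_unit_def)
    have 0: "a = 0" if "psi a = 0" for a
      using injD[OF \<open>inj psi\<close>, of a 0] that by (simp add: psi)
    show ?thesis
      unfolding regular_def
    proof (intro conjI allI impI)
      fix a
      assume "s * a = 0"
      then have "psi s * psi a = 0" using psi(1) by (simp only: psi(6)[symmetric])
      then have "v * psi s * psi a = 0" by (simp add: mult.assoc)
      then show "a = 0" using v(2) by (simp add: 0)
    next
      fix a
      assume "a * s = 0"
      then have "psi a * psi s = 0" using psi(1) by (simp only: psi(6)[symmetric])
      then have "psi a * (psi s * v) = 0" by (simp flip: mult.assoc)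
      then show "a = 0" using v(1) by (simp add: 0)
    qed
  qed
  have unit: "two_sided_unit (psi s)" if s: "regular s" for s
  proof (rule ccontr)
    assume "\<not> two_sided_unit (psi s)"
    then obtain N where N: "N \<noteq> 0" "N * psi s = 0"
      using m2_unit_or_zero_divisor[OF skew_field_quotient[OF j]] by blast
    obtain b r where r: "two_sided_unit (psi r)" "psi r * N = psi b"
      using frac by blast
    have "psi (b * s) = psi r * (N * psi s)"
      by (simp add: psi(6) mult.assoc flip: r(2))
    then have "psi (b * s) = psi 0" by (simp add: N psi)
    then have "b * s = 0" using \<open>inj psi\<close> by (simp add: inj_eq)
    then have "b = 0" using s unfolding regular_def by blast
    then have "psi r * N = psi r * 0" using r(2) by (simp add: psi)
    then show False using two_sided_unit_cancel_left[OF r(1)] N(1) by blast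
  qed
  show ?thesis
    unfolding left_quotient_ring_def
    using unital_ring_hom_psi \<open>inj psi\<close> unit frac reg by blast
qed

section \<open>Matrix rings over skew fields are central simple\<close>

lemma central_simple_algebra_scalar_m2:
  assumes "skew_field TYPE('d::ring_1)"
  shows "central_simple_algebra (scalar_m2 :: 'd \<Rightarrow> 'd m2)"
  unfolding central_simple_algebra_def
proof (intro conjI)
  show "unital_ring_hom (scalar_m2 :: 'd \<Rightarrow> _)" by (rule unital_ring_hom_scalar_m2)
  show "simple_ring TYPE('d m2)"
    unfolding simple_ring_def
  proof (intro allI impI)
    fix I :: "'d m2 set"
    assume I: "is_ideal I"
    have mult: "A * M * B \<in> I" if "M \<in> I" for A M B
      using I that unfolding is_ideal_def by blast
    show "I = {0} \<or> I = UNIV"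
    proof (cases "I = {0}")
      case False
      moreover have "0 \<in> I" using I by (simp add: is_ideal_def)
      ultimately obtain M where M: "M \<in> I" "M \<noteq> 0" by blast
      obtain a b c d where abcd: "M = M2 a b c d" by (cases M)
      \<comment> \<open>Multiplication by matrix units on both sides moves any chosen entry of
        \<open>M\<close> to the corner while clearing the others.\<close>
      have "\<exists>e. e \<noteq> 0 \<and> M2 e 0 0 0 \<in> I"
      proof -
        have "M2 a 0 0 0 \<in> I" using mult[OF M(1), of "M2 1 0 0 0" "M2 1 0 0 0"] by (simp add: abcd)
        moreover have "M2 b 0 0 0 \<in> I"
          using mult[OF M(1), of "M2 1 0 0 0" "M2 0 0 1 0"] by (simp add: abcd)
        moreover have "M2 c 0 0 0 \<in> I"
          using mult[OF M(1), of "M2 0 1 0 0" "M2 1 0 0 0"] by (simp add: abcd)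
        moreover have "M2 d 0 0 0 \<in> I"
          using mult[OF M(1), of "M2 0 1 0 0" "M2 0 0 1 0"] by (simp add: abcd)
        ultimately show ?thesis using M(2) by (auto simp: abcd zero_m2_def)
      qed
      then obtain e where e: "e \<noteq> 0" "M2 e 0 0 0 \<in> I" by blast
      obtain e' where "e' * e = 1" using assms e(1) by (auto simp: skew_field_def two_sided_unit_def)
      then have "M2 1 0 0 0 \<in> I" "M2 0 0 0 1 \<in> I"
        using mult[OF e(2), of "M2 e' 0 0 0" "M2 1 0 0 0"] mult[OF e(2), of "M2 0 0 e' 0" "M2 0 1 0 0"]
        by simp_all
      then have "M2 1 0 0 0 + M2 0 0 0 1 \<in> I" using I unfolding is_ideal_def by blast
      then have "1 \<in> I" by (simp add: one_m2_def)
      then have "I = UNIV" using mult[of 1] by (metis UNIV_eq_I mult_1_right)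
      then show ?thesis by simp
    qed simp
  qed
  show "\<exists>B. finite B \<and> (\<forall>r :: 'd m2. \<exists>c. r = (\<Sum>b\<in>B. scalar_m2 (c b) * b))"
  proof (intro exI[of _ "{M2 1 0 0 0, M2 0 1 0 0, M2 0 0 1 0, M2 0 0 0 1}"] conjI allI)
    fix r :: "'d m2"
    show "\<exists>c. r = (\<Sum>b\<in>{M2 1 0 0 0, M2 0 1 0 0, M2 0 0 1 0, M2 0 0 0 1}. scalar_m2 (c b) * b)"
    proof (cases r)
      case (M2 p q u v)
      show ?thesis
        \<comment> \<open>The matrix units are told apart by the position of their entry
          \<open>1\<close>, so the coefficient can be a function of the unit.\<close>
        by (rule exI[of _ "\<lambda>b. if m11 b = 1 then p else if m12 b = 1 then q else
            if m21 b = 1 then u else v"]) (simp add: M2 scalar_m2_def)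
    qed
  qed simp
  show "(centre :: 'd m2 set) = scalar_m2 ` centre"
  proof
    show "(centre :: 'd m2 set) \<subseteq> scalar_m2 ` centre"
    proof
      fix M :: "'d m2"
      assume "M \<in> centre"
      then have comm: "M * A = A * M" for A by (simp add: centre_def)
      obtain a b c d where abcd: "M = M2 a b c d" by (cases M)
      have "M = scalar_m2 a"
        using comm[of "M2 0 1 0 0"] comm[of "M2 1 0 0 0"] by (simp add: abcd scalar_m2_def)
      moreover have "a * e = e * a" for e
        using comm[of "scalar_m2 e"] by (simp add: \<open>M = scalar_m2 a\<close> scalar_m2_def)
      ultimately show "M \<in> scalar_m2 ` centre" by (simp add: centre_def)
    qed
    show "scalar_m2 ` centre \<subseteq> (centre :: 'd m2 set)"
    proof
      fix M :: "'d m2"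
      assume "M \<in> scalar_m2 ` centre"
      then obtain a where "M = scalar_m2 a" "\<And>e. a * e = e * a" by (auto simp: centre_def)
      then have "M * A = A * M" for A by (cases A) (simp add: scalar_m2_def)
      then show "M \<in> centre" by (simp add: centre_def)
    qed
  qed
qed (rule assms)

lemma central_simple_algebra_transport:
  fixes h :: "'r::ring_1 \<Rightarrow> 's::ring_1"
  assumes csa: "central_simple_algebra \<phi>" and h: "bij h" "unital_ring_hom h"
  shows "central_simple_algebra (\<lambda>x. h (\<phi> x))"
  unfolding central_simple_algebra_def
proof (intro conjI)
  note hom = unital_ring_homD[OF h(2)]
  have inj: "h a = h b \<longleftrightarrow> a = b" for a b using h(1) by (simp add: bij_is_inj inj_eq)
  have surj: "\<exists>a. b = h a" for b using h(1) by (metis bij_pointE)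
  show "skew_field TYPE('a)" using csa by (simp add: central_simple_algebra_def)
  show "unital_ring_hom (\<lambda>x. h (\<phi> x))"
    using csa h(2) by (simp add: central_simple_algebra_def unital_ring_hom_comp)
  show "simple_ring TYPE('s)"
    unfolding simple_ring_def
  proof (intro allI impI)
    fix I :: "'s set"
    assume I: "is_ideal I"
    have "is_ideal (h -` I)"
      using I by (simp add: is_ideal_def hom)
    then have "h -` I = {0} \<or> h -` I = UNIV"
      using csa by (simp add: central_simple_algebra_def simple_ring_def)
    moreover have "I = h ` (h -` I)" using h(1) by (simp add: bij_is_surj surj_image_vimage_eq)
    ultimately show "I = {0} \<or> I = UNIV"
      using h(1) by (metis bij_is_surj hom(1) image_empty image_insert)
  qed
  obtain B where B: "finite B" "\<forall>r. \<exists>c. r = (\<Sum>b\<in>B. \<phi> (c b) * b)"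
    using csa unfolding central_simple_algebra_def by blast
  have "\<exists>c. r = (\<Sum>b\<in>h ` B. h (\<phi> (c b)) * b)" for r
  proof -
    obtain r' where r': "r = h r'" using surj by blast
    obtain c where c: "r' = (\<Sum>b\<in>B. \<phi> (c b) * b)" using B(2) by blast
    have sum: "h (sum f S) = (\<Sum>b\<in>S. h (f b))" for f :: "'r \<Rightarrow> 'r" and S
      by (induction S rule: infinite_finite_induct) (simp_all add: hom)
    have "(\<Sum>b\<in>h ` B. h (\<phi> (c (inv h b))) * b) = (\<Sum>b\<in>B. h (\<phi> (c b)) * h b)"
      using bij_is_inj[OF h(1)] by (subst sum.reindex) (auto simp: inv_f_f inj_def inj_on_def)
    also have "\<dots> = r" unfolding r' c by (simp add: sum hom)
    finally show ?thesis by metis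
  qed
  then show "\<exists>B. finite B \<and> (\<forall>r. \<exists>c. r = (\<Sum>b\<in>B. h (\<phi> (c b)) * b))"
    using B(1) by blast
  have "(centre :: 's set) = h ` centre"
  proof (rule set_eqI)
    fix b
    obtain a where b: "b = h a" using surj by blast
    have "b \<in> centre \<longleftrightarrow> (\<forall>c. h (a * c) = h (c * a))"
      unfolding centre_def b using surj by (simp add: hom) metis
    also have "\<dots> \<longleftrightarrow> a \<in> centre" by (simp add: inj centre_def)
    also have "\<dots> \<longleftrightarrow> b \<in> h ` centre" by (auto simp: b inj)
    finally show "b \<in> centre \<longleftrightarrow> b \<in> h ` centre" .
  qed
  also have "centre = \<phi> ` centre"
    using csa by (simp add: central_simple_algebra_def)
  finally show "centre = (\<lambda>x. h (\<phi> x)) ` centre" by (simp add: image_image)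
qed

section \<open>From \<open>m2\<close> to \<open>'d^2^2\<close>\<close>

definition matrix_of_m2 :: "'d::ring_1 m2 \<Rightarrow> 'd ^ 2 ^ 2" where
  "matrix_of_m2 M = vector [vector [m11 M, m12 M], vector [m21 M, m22 M]]"

lemma matrix_of_m2_hom:
  fixes A B :: "'d::ring_1 m2"
  shows "bij (matrix_of_m2 :: 'd m2 \<Rightarrow> _)" "matrix_of_m2 (scalar_m2 d) = mat d"
    "matrix_of_m2 (A + B) = matrix_of_m2 A + matrix_of_m2 B"
    "matrix_of_m2 (A * B) = matrix_of_m2 A ** matrix_of_m2 B"
proof -
  show "bij (matrix_of_m2 :: 'd m2 \<Rightarrow> _)"
  proof (rule bijI)
    show "inj (matrix_of_m2 :: 'd m2 \<Rightarrow> _)"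
      by (rule injI) (auto simp: matrix_of_m2_def vec_eq_iff forall_2 m2.expand)
    show "surj (matrix_of_m2 :: 'd m2 \<Rightarrow> _)"
      by (rule surjI[of _ "\<lambda>M. M2 (vec_nth (vec_nth M 1) 1) (vec_nth (vec_nth M 1) 2)
          (vec_nth (vec_nth M 2) 1) (vec_nth (vec_nth M 2) 2)"])
         (simp add: matrix_of_m2_def vec_eq_iff forall_2)
  qed
  show "matrix_of_m2 (scalar_m2 d) = mat d"
    "matrix_of_m2 (A + B) = matrix_of_m2 A + matrix_of_m2 B"
    by (simp_all add: matrix_of_m2_def vec_eq_iff forall_2 mat_def scalar_m2_def)
  show "matrix_of_m2 (A * B) = matrix_of_m2 A ** matrix_of_m2 B"
    by (simp add: matrix_of_m2_def vec_eq_iff forall_2 matrix_matrix_mult_def sum_2 times_m2_def)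
qed

theorem proposition3p1:
  shows "(inj (eval_C :: 'k::field_char_0 poly \<Rightarrow> 'k sjp) \<and>
          range (eval_C :: 'k poly \<Rightarrow> 'k sjp) = centre) \<and>
         (\<forall>(\<iota> :: 'k sjp \<Rightarrow> 'q::ring_1) (j :: 'k polyC_weyl \<Rightarrow> 'd::ring_1).
            classical_quotient_ring \<iota> \<and> classical_quotient_ring j \<longrightarrow>
              skew_field TYPE('d) \<and>
              (\<exists>(f :: 'q \<Rightarrow> 'd ^ 2 ^ 2) (\<phi> :: 'd \<Rightarrow> 'q).
                 iso_matrix_ring f \<and>
                 (\<forall>p. f (\<iota> (eval_C p)) = mat (j (pure_tensor p 1))) \<and>
                 (\<forall>d. f (\<phi> d) = mat d) \<and>
                 central_simple_algebra \<phi>))"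
proof (intro conjI allI impI)
  show "inj (eval_C :: 'k poly \<Rightarrow> 'k sjp)" by (rule inj_eval_C)
  show "range (eval_C :: 'k poly \<Rightarrow> 'k sjp) = centre"
    using eval_C_in_centre centre_subset_range_eval_C by blast
next
  fix \<iota> :: "'k sjp \<Rightarrow> 'q" and j :: "'k polyC_weyl \<Rightarrow> 'd"
  assume "classical_quotient_ring \<iota> \<and> classical_quotient_ring j"
  then have \<iota>: "left_quotient_ring \<iota>" and j: "left_quotient_ring j"
    by (simp_all add: classical_quotient_ring_imp_left)
  show skew: "skew_field TYPE('d)" by (rule skew_field_quotient[OF j])
  obtain t' C' where ext: "weyl_ext j t' C'" using weyl_ext_quotient[OF j] by blast
  interpret weyl_ext j t' C' by (rule ext)
  \<comment> \<open>Both \<open>\<iota>\<close> and \<open>psi\<close> are left quotient rings of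
    the bosonization. Since \<open>g\<close> identifies \<open>\<iota>\<close> with
    \<open>psi\<close>, the compatibility with \<open>C\<close> is inherited from
    \<open>psi_eval_C\<close>.\<close>
  obtain g where g: "bij g" "unital_ring_hom g" "\<And>a. g (\<iota> a) = psi a"
    using left_quotient_ring_unique[OF \<iota> left_quotient_ring_psi[OF j ext]] by blast
  note gh = unital_ring_homD[OF g(2)]
  define f where "f q = matrix_of_m2 (g q)" for q
  define \<phi> where "\<phi> d = inv g (scalar_m2 d)" for d
  have g_inv: "g (inv g M) = M" for M using g(1) by (simp add: bij_is_surj surj_f_inv_f)
  have inv_eq: "inv g M = q" if "g q = M" for M q
    using that g(1) by (auto simp: bij_is_inj inv_f_f)
  have inv: "bij (inv g)" "unital_ring_hom (inv g)"
    using g(1) by (simp_all add: bij_imp_bij_inv unital_ring_hom_def inv_eq gh g_inv)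
  have "iso_matrix_ring f"
    unfolding iso_matrix_ring_def
  proof (intro conjI allI)
    show "bij f" unfolding f_def using bij_comp[OF g(1) matrix_of_m2_hom(1)] by (simp add: comp_def)
    show "f 1 = mat 1"
      using matrix_of_m2_hom(2)[of 1]
      by (simp add: f_def gh unital_ring_homD(2)[OF unital_ring_hom_scalar_m2])
  qed (simp_all add: f_def gh matrix_of_m2_hom)
  moreover have "f (\<iota> (eval_C p)) = mat (j (pure_tensor p 1))" for p
    by (simp add: f_def g psi_eval_C matrix_of_m2_hom)
  moreover have "f (\<phi> d) = mat d" for d
    by (simp add: f_def \<phi>_def g_inv matrix_of_m2_hom)
  moreover have "central_simple_algebra \<phi>"
    unfolding \<phi>_def
    by (rule central_simple_algebra_transport[OF central_simple_algebra_scalar_m2[OF skew] inv])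
  ultimately show "\<exists>(f :: 'q \<Rightarrow> 'd ^ 2 ^ 2) (\<phi> :: 'd \<Rightarrow> 'q). iso_matrix_ring f \<and>
      (\<forall>p. f (\<iota> (eval_C p)) = mat (j (pure_tensor p 1))) \<and> (\<forall>d. f (\<phi> d) = mat d) \<and>
      central_simple_algebra \<phi>"
    by blast
qed

end
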